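(* Let $E$ be a Lusin topological space with $\mathscr{B}(E)=\sigma(C(E))$, $m$ a $\sigma$-finite measure on $E$ with $\mathrm{supp}[m]=E$, $(\mathscr{E},\mathscr{F})$ a quasi-regular (not necessarily symmetric) Dirichlet form on $L^2(E,m)$, and $X$ an $m$-tight Borel right process properly associated with $(\mathscr{E},\mathscr{F})$. Let $M\in\mathrm{MF}(X)$ be such that $m(E\setminus E_M)=0$. Then the Dirichlet form $(\mathscr{E}^M,\mathscr{F}^M)$ associated with the subprocess $X^M$ is dominated by $(\mathscr{E},\mathscr{F})$, i.e. $\mathscr{E}^M\preceq\mathscr{E}$. Furthermore, when considered as a Dirichlet form on $L^2(E,m)$, $(\mathscr{E}^M,\mathscr{F}^M)$ remains quasi-regular.
   Context: Dirichlet forms. A (not necessarily symmetric) Dirichlet form $(\mathscr{E},\mathscr{F})$ on $L^2(E,m)$ is a coercive closed form (dense domain, symmetric part nonnegative and closed, $|\mathscr{E}_1(u,v)|\le K\mathscr{E}_1(u,u)^{1/2}\mathscr{E}_1(v,v)^{1/2}$ with $\mathscr{E}_1=\mathscr{E}+(\cdot,\cdot)_m$) with the Markovian property ($u^+\wedge1\in\mathscr{F}$ and $\mathscr{E}(u\pm u^+\wedge1,u\mp u^+\wedge1)\ge0$ for $u\in\mathscr{F}$). $\mathscr{E}'\preceq\mathscr{E}$ means that the $L^2$-semigroups satisfy $T'_tf\le T_tf$ for all $t\ge0$ and non-negative $f\in L^2(E,m)$; equivalently $\mathscr{F}'\subset\mathscr{F}$, $\mathscr{F}'\cap L^\infty$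 is an algebraic ideal in $\mathscr{F}\cap L^\infty$, and $\mathscr{E}'(f,g)\ge\mathscr{E}(f,g)$ for non-negative $f,g\in\mathscr{F}'$. Quasi-notions. An increasing sequence of closed sets $\{F_n\}$ is an $\mathscr{E}$-nest if $\bigcup_n\{f\in\mathscr{F}:f=0\ m\text{-a.e. on }E\setminus F_n\}$ is $\mathscr{E}_1$-dense in $\mathscr{F}$. $N$ is $\mathscr{E}$-polar if $N\subset E\setminus\bigcup_nF_n$ for some $\mathscr{E}$-nest; $f$ is $\mathscr{E}$-quasi-continuous if for some $\mathscr{E}$-nest each $f|_{F_n}$ is finite and continuous. Quasi-regular: there is an $\mathscr{E}$-nest of compact sets, an $\mathscr{E}_1$-dense subset of $\mathscr{F}$ whose elements have $\mathscr{E}$-quasi-continuous $m$-versions, and a countable family in $\mathscr{F}$ with $\mathscr{E}$-quasi-continuous $m$-versions separating the points off some $\mathscr{E}$-polar set. Processes. $X=(\Omega,\mathcal{F},\mathcal{F}_t,X_t,\theta_t,\mathbb{P}_x)$ with lifetime $\zeta$ is a right process (in the sense of Sharpe), Borel if its semigroup maps bounded Borel functions to Borel functions; it is properly associated with $(\mathscr{E},\mathscr{F})$ if $x\mapsto\mathbb{P}_xf(X_t)$ is an $\mathscr{E}$-quasi-continuous $m$-version of $T_tf$ for all $t\ge0$ and non-negative Borel $f\in L^2(E,m)$; it is $m$-tight if there are increasing compact sets $K_n$ with $\mathbb{P}_m(\lim_nT_{E\setminus K_n}<\zeta)=0$, where $\mathbb{P}_m=\int m(dx)\mathbb{P}_x$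 and $T_A=\inf\{t>0:X_t\in A\}$. Multiplicative functionals. An MF of $X$ is a real process $M=(M_t)_{t\ge0}$ with $t\mapsto M_t(\omega)$ decreasing, right continuous and $[0,1]$-valued for all $\omega$, adapted, with $M_{t+s}=M_t\cdot(M_s\circ\theta_t)$ identically. $E_M:=\{x\in E:\mathbb{P}_x(M_0=1)=1\}$. $\mathrm{MF}(X)$ is the set of MFs such that $E_M$ is finely open and $M_\zeta=0$. The subprocess $X^M$ is the right process on $E_M$ with transition semigroup $Q_tf(x)=\mathbb{P}_x(f(X_t)M_t)$. $(\mathscr{E}^M,\mathscr{F}^M)$ denotes the Dirichlet form on $L^2(E_M,m|_{E_M})$ whose $L^2$-semigroup is induced by $(Q_t)$ (it is known that $X^M$ is properly associated with it and that it is quasi-regular on $L^2(E_M,m|_{E_M})$, $E_M$ carrying the relative topology). Since $m(E\setminus E_M)=0$, it may be regarded as a form on $L^2(E,m)$. *)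

theory Defs
  imports "HOL-Probability.Probability"
begin

section \<open>State space\<close>

text \<open>
  A Lusin space is a Hausdorff space that is the image of a Polish space under a continuous
  bijection. Transporting the Polish topology along the bijection puts it on the same carrier.
\<close>

definition lusin_space :: "'a topology \<Rightarrow> bool" where
  "lusin_space X \<longleftrightarrow> Hausdorff_space X \<and>
     (\<exists>Y. topspace Y = topspace X \<and> completely_metrizable_space Y \<and> second_countable Y \<and>
          continuous_map Y X (\<lambda>x. x))"

definition sigma_continuous :: "'a::topological_space set set" where
  "sigma_continuous =
     sigma_sets UNIV {f -` U | (f :: 'a \<Rightarrow> real) U. continuous_on UNIV f \<and> open U}"


section \<open>Coercive closed forms and Dirichlet forms\<close>

text \<open>
  Elements of \<open>L\<^sup>2(\<mu>)\<close> are represented by functions instead of equivalence classes. Accordingly, a form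
  \<open>(F, E)\<close> has a domain that is saturated under a.e. equality and values that respect it, and
  operators on \<open>L\<^sup>2(\<mu>)\<close> satisfy their algebraic laws almost everywhere.
\<close>

definition L2 :: "'a measure \<Rightarrow> ('a \<Rightarrow> real) set" where
  "L2 \<mu> = {f \<in> borel_measurable \<mu>. integrable \<mu> (\<lambda>x. (f x)\<^sup>2)}"

definition L2_inner :: "'a measure \<Rightarrow> ('a \<Rightarrow> real) \<Rightarrow> ('a \<Rightarrow> real) \<Rightarrow> real" where
  "L2_inner \<mu> f g = (\<integral>x. f x * g x \<partial>\<mu>)"

definition shifted_form ::
  "'a measure \<Rightarrow> (('a \<Rightarrow> real) \<Rightarrow> ('a \<Rightarrow> real) \<Rightarrow> real) \<Rightarrow> real \<Rightarrow> ('a \<Rightarrow> real) \<Rightarrow> ('a \<Rightarrow> real) \<Rightarrow> real"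
where
  "shifted_form \<mu> E \<alpha> u v = E u v + \<alpha> * L2_inner \<mu> u v"

definition bilinear_form ::
  "'a measure \<Rightarrow> ('a \<Rightarrow> real) set \<Rightarrow> (('a \<Rightarrow> real) \<Rightarrow> ('a \<Rightarrow> real) \<Rightarrow> real) \<Rightarrow> bool"
where
  "bilinear_form \<mu> F E \<longleftrightarrow>
     F \<subseteq> L2 \<mu> \<and> (\<lambda>x. 0) \<in> F \<and>
     (\<forall>u\<in>F. \<forall>v\<in>F. \<forall>a b. (\<lambda>x. a * u x + b * v x) \<in> F) \<and>
     (\<forall>u\<in>F. \<forall>v\<in>F. \<forall>w\<in>F. \<forall>a b.
        E (\<lambda>x. a * u x + b * v x) w = a * E u w + b * E v w \<and>
        E w (\<lambda>x. a * u x + b * v x) = a * E w u + b * E w v) \<and>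
     (\<forall>u\<in>F. \<forall>v\<in>L2 \<mu>. (AE x in \<mu>. u x = v x) \<longrightarrow>
        v \<in> F \<and> (\<forall>w\<in>F. E u w = E v w \<and> E w u = E w v))"

text \<open>
  The symmetric part of \<open>E\<close> has the same diagonal as \<open>E\<close>, so its nonnegativity and closedness are
  stated through \<open>E u u\<close>.
\<close>

definition coercive_closed_form ::
  "'a measure \<Rightarrow> ('a \<Rightarrow> real) set \<Rightarrow> (('a \<Rightarrow> real) \<Rightarrow> ('a \<Rightarrow> real) \<Rightarrow> real) \<Rightarrow> bool"
where
  "coercive_closed_form \<mu> F E \<longleftrightarrow>
     bilinear_form \<mu> F E \<and>
     (\<forall>f\<in>L2 \<mu>. \<forall>\<epsilon>>0. \<exists>u\<in>F. (\<integral>x. (f x - u x)\<^sup>2 \<partial>\<mu>) < \<epsilon>) \<and>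
     (\<forall>u\<in>F. 0 \<le> E u u) \<and>
     (\<forall>u :: nat \<Rightarrow> 'a \<Rightarrow> real.
        (\<forall>n. u n \<in> F) \<and>
        (\<forall>\<epsilon>>0. \<exists>N. \<forall>i\<ge>N. \<forall>j\<ge>N.
           shifted_form \<mu> E 1 (\<lambda>x. u i x - u j x) (\<lambda>x. u i x - u j x) < \<epsilon>) \<longrightarrow>
        (\<exists>v\<in>F. (\<lambda>n. shifted_form \<mu> E 1 (\<lambda>x. u n x - v x) (\<lambda>x. u n x - v x)) \<longlonglongrightarrow> 0)) \<and>
     (\<exists>K. \<forall>u\<in>F. \<forall>v\<in>F.
        \<bar>shifted_form \<mu> E 1 u v\<bar> \<le> K * sqrt (shifted_form \<mu> E 1 u u) * sqrt (shifted_form \<mu> E 1 v v))"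

definition unit_contraction :: "('a \<Rightarrow> real) \<Rightarrow> 'a \<Rightarrow> real" where
  "unit_contraction u x = min (max (u x) 0) 1"

definition dirichlet_form ::
  "'a measure \<Rightarrow> ('a \<Rightarrow> real) set \<Rightarrow> (('a \<Rightarrow> real) \<Rightarrow> ('a \<Rightarrow> real) \<Rightarrow> real) \<Rightarrow> bool"
where
  "dirichlet_form \<mu> F E \<longleftrightarrow>
     coercive_closed_form \<mu> F E \<and>
     (\<forall>u\<in>F. unit_contraction u \<in> F \<and>
        0 \<le> E (\<lambda>x. u x + unit_contraction u x) (\<lambda>x. u x - unit_contraction u x) \<and>
        0 \<le> E (\<lambda>x. u x - unit_contraction u x) (\<lambda>x. u x + unit_contraction u x))"

definition L2_contraction_semigroup ::
  "'a measure \<Rightarrow> (real \<Rightarrow> ('a \<Rightarrow> real) \<Rightarrow> 'a \<Rightarrow> real) \<Rightarrow> bool"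
where
  "L2_contraction_semigroup \<mu> T \<longleftrightarrow>
     (\<forall>t\<ge>0. \<forall>f\<in>L2 \<mu>. T t f \<in> L2 \<mu> \<and> (\<integral>x. (T t f x)\<^sup>2 \<partial>\<mu>) \<le> (\<integral>x. (f x)\<^sup>2 \<partial>\<mu>)) \<and>
     (\<forall>t\<ge>0. \<forall>f\<in>L2 \<mu>. \<forall>g\<in>L2 \<mu>. \<forall>a b.
        AE x in \<mu>. T t (\<lambda>y. a * f y + b * g y) x = a * T t f x + b * T t g x) \<and>
     (\<forall>f\<in>L2 \<mu>. AE x in \<mu>. T 0 f x = f x) \<and>
     (\<forall>s\<ge>0. \<forall>t\<ge>0. \<forall>f\<in>L2 \<mu>. AE x in \<mu>. T (s + t) f x = T s (T t f) x) \<and>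
     (\<forall>f\<in>L2 \<mu>. ((\<lambda>t. \<integral>x. (T t f x - f x)\<^sup>2 \<partial>\<mu>) \<longlongrightarrow> 0) (at_right 0))"

text \<open>
  \<open>T\<close> is the semigroup of \<open>(F, E)\<close> if its resolvent \<open>G\<^sub>\<alpha> f = \<integral>\<^sub>0\<^sup>\<infinity> e\<^sup>-\<^sup>\<alpha>\<^sup>t T\<^sub>t f dt\<close>, here a weak integral
  in \<open>L\<^sup>2\<close>, takes values in \<open>F\<close> and satisfies \<open>E\<^sub>\<alpha> (G\<^sub>\<alpha> f) u = (f, u)\<close> for all \<open>u \<in> F\<close>. The resolvent
  stands in the first argument of the form; this is what distinguishes \<open>T\<close> from the
  co-semigroup when \<open>E\<close> is not symmetric.
\<close>

definition form_semigroup ::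
  "'a measure \<Rightarrow> ('a \<Rightarrow> real) set \<Rightarrow> (('a \<Rightarrow> real) \<Rightarrow> ('a \<Rightarrow> real) \<Rightarrow> real) \<Rightarrow>
   (real \<Rightarrow> ('a \<Rightarrow> real) \<Rightarrow> 'a \<Rightarrow> real) \<Rightarrow> bool"
where
  "form_semigroup \<mu> F E T \<longleftrightarrow>
     L2_contraction_semigroup \<mu> T \<and>
     (\<forall>\<alpha>>0. \<forall>f\<in>L2 \<mu>. \<exists>g\<in>F.
        (\<forall>h\<in>L2 \<mu>. ((\<lambda>t. exp (- \<alpha> * t) * L2_inner \<mu> (T t f) h) has_integral L2_inner \<mu> g h) {0..}) \<and>
        (\<forall>u\<in>F. shifted_form \<mu> E \<alpha> g u = L2_inner \<mu> f u))"

text \<open>\<open>dominated_form \<mu> F' E' F E\<close> is \<open>(E', F') \<preceq> (E, F)\<close>.\<close>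

definition dominated_form ::
  "'a measure \<Rightarrow> ('a \<Rightarrow> real) set \<Rightarrow> (('a \<Rightarrow> real) \<Rightarrow> ('a \<Rightarrow> real) \<Rightarrow> real) \<Rightarrow>
   ('a \<Rightarrow> real) set \<Rightarrow> (('a \<Rightarrow> real) \<Rightarrow> ('a \<Rightarrow> real) \<Rightarrow> real) \<Rightarrow> bool"
where
  "dominated_form \<mu> F' E' F E \<longleftrightarrow>
     (\<exists>T' T. form_semigroup \<mu> F' E' T' \<and> form_semigroup \<mu> F E T \<and>
        (\<forall>t\<ge>0. \<forall>f\<in>L2 \<mu>. (AE x in \<mu>. 0 \<le> f x) \<longrightarrow> (AE x in \<mu>. T' t f x \<le> T t f x)))"


section \<open>Quasi-notions\<close>

definition form_dense ::
  "'a measure \<Rightarrow> ('a \<Rightarrow> real) set \<Rightarrow> (('a \<Rightarrow> real) \<Rightarrow> ('a \<Rightarrow> real) \<Rightarrow> real) \<Rightarrow> ('a \<Rightarrow> real) set \<Rightarrow> bool"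
where
  "form_dense m F E D \<longleftrightarrow> D \<subseteq> F \<and>
     (\<forall>u\<in>F. \<forall>\<epsilon>>0. \<exists>v\<in>D. shifted_form m E 1 (\<lambda>x. u x - v x) (\<lambda>x. u x - v x) < \<epsilon>)"

definition nest ::
  "'a::topological_space measure \<Rightarrow> ('a \<Rightarrow> real) set \<Rightarrow> (('a \<Rightarrow> real) \<Rightarrow> ('a \<Rightarrow> real) \<Rightarrow> real) \<Rightarrow>
   (nat \<Rightarrow> 'a set) \<Rightarrow> bool"
where
  "nest m F E C \<longleftrightarrow> incseq C \<and> (\<forall>n. closed (C n)) \<and>
     form_dense m F E (\<Union>n. {f \<in> F. AE x in m. x \<notin> C n \<longrightarrow> f x = 0})"

definition polar ::
  "'a::topological_space measure \<Rightarrow> ('a \<Rightarrow> real) set \<Rightarrow> (('a \<Rightarrow> real) \<Rightarrow> ('a \<Rightarrow> real) \<Rightarrow> real) \<Rightarrow>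
   'a set \<Rightarrow> bool"
where
  "polar m F E N \<longleftrightarrow> (\<exists>C. nest m F E C \<and> N \<subseteq> - (\<Union>n. C n))"

definition quasi_continuous ::
  "'a::topological_space measure \<Rightarrow> ('a \<Rightarrow> real) set \<Rightarrow> (('a \<Rightarrow> real) \<Rightarrow> ('a \<Rightarrow> real) \<Rightarrow> real) \<Rightarrow>
   ('a \<Rightarrow> ereal) \<Rightarrow> bool"
where
  "quasi_continuous m F E f \<longleftrightarrow>
     (\<exists>C. nest m F E C \<and> (\<forall>n. (\<forall>x\<in>C n. \<bar>f x\<bar> \<noteq> \<infinity>) \<and> continuous_on (C n) f))"

definition qc_version ::
  "'a::topological_space measure \<Rightarrow> ('a \<Rightarrow> real) set \<Rightarrow> (('a \<Rightarrow> real) \<Rightarrow> ('a \<Rightarrow> real) \<Rightarrow> real) \<Rightarrow>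
   ('a \<Rightarrow> real) \<Rightarrow> ('a \<Rightarrow> ereal) \<Rightarrow> bool"
where
  "qc_version m F E u v \<longleftrightarrow> quasi_continuous m F E v \<and> (AE x in m. v x = ereal (u x))"

definition quasi_regular ::
  "'a::topological_space measure \<Rightarrow> ('a \<Rightarrow> real) set \<Rightarrow> (('a \<Rightarrow> real) \<Rightarrow> ('a \<Rightarrow> real) \<Rightarrow> real) \<Rightarrow> bool"
where
  "quasi_regular m F E \<longleftrightarrow>
     (\<exists>C. nest m F E C \<and> (\<forall>n. compact (C n))) \<and>
     (\<exists>D. form_dense m F E D \<and> (\<forall>u\<in>D. \<exists>v. qc_version m F E u v)) \<and>
     (\<exists>(u :: nat \<Rightarrow> 'a \<Rightarrow> real) v N. polar m F E N \<and>
        (\<forall>n. u n \<in> F \<and> qc_version m F E (u n) (v n)) \<and>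
        (\<forall>x y. x \<notin> N \<and> y \<notin> N \<and> x \<noteq> y \<longrightarrow> (\<exists>n. v n x \<noteq> v n y)))"


section \<open>Right processes\<close>

text \<open>
  The sample space is the whole type \<open>'w\<close>, and \<open>'e option\<close> is the state space with the cemetery \<open>None\<close>
  adjoined as an isolated point. Processes, shifts and functionals are only relevant at times \<open>t \<ge> 0\<close>.
\<close>

definition borel_cemetery :: "'e::topological_space option measure" where
  "borel_cemetery = sigma UNIV {A. Some -` A \<in> sets borel}"

definition path_sigma :: "(real \<Rightarrow> 'w \<Rightarrow> 'e::topological_space option) \<Rightarrow> real set \<Rightarrow> 'w measure" where
  "path_sigma X I = sigma UNIV {X s -` A | s A. s \<in> I \<and> A \<in> sets borel_cemetery}"

definition initial_law :: "'e::topological_space option measure \<Rightarrow> bool" where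
  "initial_law \<mu> \<longleftrightarrow> prob_space \<mu> \<and> sets \<mu> = sets borel_cemetery"

text \<open>\<open>\<integral> \<mu>(dx) P\<^sub>x\<close>; the completion of \<open>\<mu>\<close> caters for kernels that are only universally measurable.\<close>

definition mixed_law :: "'x measure \<Rightarrow> ('x \<Rightarrow> 'w measure) \<Rightarrow> 'w measure" where
  "mixed_law \<mu> P = completion \<mu> \<bind> P"

definition universally_measurable :: "('e::topological_space \<Rightarrow> ennreal) \<Rightarrow> bool" where
  "universally_measurable f \<longleftrightarrow>
     (\<forall>\<mu>. prob_space \<mu> \<and> sets \<mu> = sets borel \<longrightarrow> f \<in> borel_measurable (completion \<mu>))"

definition transition ::
  "(real \<Rightarrow> 'w \<Rightarrow> 'e::topological_space option) \<Rightarrow> ('e option \<Rightarrow> 'w measure) \<Rightarrow>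
   real \<Rightarrow> ('e \<Rightarrow> ennreal) \<Rightarrow> 'e \<Rightarrow> ennreal"
where
  "transition X P t f x = (\<integral>\<^sup>+\<omega>. case_option 0 f (X t \<omega>) \<partial>completion (P (Some x)))"

definition excessive ::
  "(real \<Rightarrow> 'w \<Rightarrow> 'e::topological_space option) \<Rightarrow> ('e option \<Rightarrow> 'w measure) \<Rightarrow>
   real \<Rightarrow> ('e \<Rightarrow> ennreal) \<Rightarrow> bool"
where
  "excessive X P \<alpha> f \<longleftrightarrow>
     universally_measurable f \<and>
     (\<forall>t\<ge>0. \<forall>x. ennreal (exp (- \<alpha> * t)) * transition X P t f x \<le> f x) \<and>
     (\<forall>x. ((\<lambda>t. ennreal (exp (- \<alpha> * t)) * transition X P t f x) \<longlongrightarrow> f x) (at_right 0))"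

text \<open>
  Right processes in the sense of Sharpe. The conjuncts are: absorption in the cemetery; right continuity of
  every path (at a cemetery state it follows from absorption); the shift property; universal measurability
  of \<open>x \<mapsto> P\<^sub>x\<close>; \<open>P\<^sub>x(X\<^sub>0 = x) = 1\<close>; the Markov property under every initial law; and a.s. right continuity
  of \<open>f(X\<^sub>t)\<close> for every \<open>\<alpha>\<close>-excessive \<open>f\<close>. The last of these entails the strong Markov property.
\<close>

definition right_process ::
  "(real \<Rightarrow> 'w \<Rightarrow> 'e::topological_space option) \<Rightarrow> (real \<Rightarrow> 'w \<Rightarrow> 'w) \<Rightarrow> ('e option \<Rightarrow> 'w measure) \<Rightarrow> bool"
where
  "right_process X \<theta> P \<longleftrightarrow>
     (\<forall>\<omega> s t. 0 \<le> s \<and> s \<le> t \<and> X s \<omega> = None \<longrightarrow> X t \<omega> = None) \<and>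
     (\<forall>\<omega> t x U. 0 \<le> t \<and> X t \<omega> = Some x \<and> open U \<and> x \<in> U \<longrightarrow>
        (\<forall>\<^sub>F s in at_right t. X s \<omega> \<in> Some ` U)) \<and>
     (\<forall>\<omega>. \<forall>s\<ge>0. \<forall>t\<ge>0. X s (\<theta> t \<omega>) = X (s + t) \<omega>) \<and>
     (\<forall>\<mu>. initial_law \<mu> \<longrightarrow> P \<in> completion \<mu> \<rightarrow>\<^sub>M prob_algebra (path_sigma X {0..})) \<and>
     (\<forall>x. AE \<omega> in P x. X 0 \<omega> = x) \<and>
     (\<forall>\<mu>. initial_law \<mu> \<longrightarrow>
        (\<forall>t\<ge>0. \<forall>A\<in>sets (path_sigma X {0..t}). \<forall>B\<in>sets (path_sigma X {0..}).
           emeasure (mixed_law \<mu> P) (A \<inter> \<theta> t -` B) =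
             (\<integral>\<^sup>+\<omega>. indicator A \<omega> * emeasure (P (X t \<omega>)) B \<partial>completion (mixed_law \<mu> P)))) \<and>
     (\<forall>\<mu> \<alpha> f. initial_law \<mu> \<and> 0 < \<alpha> \<and> excessive X P \<alpha> f \<longrightarrow>
        (AE \<omega> in mixed_law \<mu> P. \<forall>t\<ge>0.
           ((\<lambda>s. case_option 0 f (X s \<omega>)) \<longlongrightarrow> case_option 0 f (X t \<omega>)) (at_right t)))"

definition borel_right_process ::
  "(real \<Rightarrow> 'w \<Rightarrow> 'e::topological_space option) \<Rightarrow> (real \<Rightarrow> 'w \<Rightarrow> 'w) \<Rightarrow> ('e option \<Rightarrow> 'w measure) \<Rightarrow> bool"
where
  "borel_right_process X \<theta> P \<longleftrightarrow>
     right_process X \<theta> P \<and>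
     (\<forall>t\<ge>0. \<forall>f :: 'e \<Rightarrow> real. f \<in> borel_measurable borel \<and> bounded (range f) \<longrightarrow>
        (\<lambda>x. \<integral>\<omega>. case_option 0 f (X t \<omega>) \<partial>P (Some x)) \<in> borel_measurable borel)"

text \<open>
  Time \<open>0\<close> is excluded: \<open>P\<^sub>0\<close> is the identity, and not every Borel function is quasi-continuous.
\<close>

definition properly_associated ::
  "'e::topological_space measure \<Rightarrow> ('e \<Rightarrow> real) set \<Rightarrow> (('e \<Rightarrow> real) \<Rightarrow> ('e \<Rightarrow> real) \<Rightarrow> real) \<Rightarrow>
   (real \<Rightarrow> 'w \<Rightarrow> 'e option) \<Rightarrow> ('e option \<Rightarrow> 'w measure) \<Rightarrow> bool"
where
  "properly_associated m F E X P \<longleftrightarrow>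
     (\<exists>T. form_semigroup m F E T \<and>
        (\<forall>t>0. \<forall>f\<in>L2 m. f \<in> borel_measurable borel \<and> (\<forall>x. 0 \<le> f x) \<longrightarrow>
           qc_version m F E (T t f) (\<lambda>x. enn2ereal (transition X P t (\<lambda>y. ennreal (f y)) x))))"

definition lifetime :: "(real \<Rightarrow> 'w \<Rightarrow> 'e option) \<Rightarrow> 'w \<Rightarrow> ereal" where
  "lifetime X \<omega> = Inf {ereal t | t. 0 \<le> t \<and> X t \<omega> = None}"

definition hitting_time :: "(real \<Rightarrow> 'w \<Rightarrow> 'e option) \<Rightarrow> 'e set \<Rightarrow> 'w \<Rightarrow> ereal" where
  "hitting_time X A \<omega> = Inf {ereal t | t. 0 < t \<and> X t \<omega> \<in> Some ` A}"

definition m_tight ::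
  "'e::topological_space measure \<Rightarrow> (real \<Rightarrow> 'w \<Rightarrow> 'e option) \<Rightarrow> ('e option \<Rightarrow> 'w measure) \<Rightarrow> bool"
where
  "m_tight m X P \<longleftrightarrow>
     (\<exists>K. incseq K \<and> (\<forall>n. compact (K n)) \<and>
        (AE \<omega> in mixed_law m (\<lambda>x. P (Some x)). \<not> lim (\<lambda>n. hitting_time X (- K n) \<omega>) < lifetime X \<omega>))"


section \<open>Multiplicative functionals and subprocesses\<close>

text \<open>The filtration \<open>\<F>\<^sub>t\<close> is the natural one, augmented with respect to all initial laws.\<close>

definition augmented_sigma ::
  "(real \<Rightarrow> 'w \<Rightarrow> 'e::topological_space option) \<Rightarrow> ('e option \<Rightarrow> 'w measure) \<Rightarrow> real \<Rightarrow> 'w measure"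
where
  "augmented_sigma X P t = sigma UNIV
     (\<Inter>\<mu>\<in>Collect initial_law.
        sigma_sets UNIV (sets (path_sigma X {0..t}) \<union> null_sets (completion (mixed_law \<mu> P))))"

definition multiplicative_functional ::
  "(real \<Rightarrow> 'w \<Rightarrow> 'e::topological_space option) \<Rightarrow> (real \<Rightarrow> 'w \<Rightarrow> 'w) \<Rightarrow> ('e option \<Rightarrow> 'w measure) \<Rightarrow>
   (real \<Rightarrow> 'w \<Rightarrow> real) \<Rightarrow> bool"
where
  "multiplicative_functional X \<theta> P M \<longleftrightarrow>
     (\<forall>\<omega>. \<forall>t\<ge>0. 0 \<le> M t \<omega> \<and> M t \<omega> \<le> 1) \<and>
     (\<forall>\<omega> s t. 0 \<le> s \<and> s \<le> t \<longrightarrow> M t \<omega> \<le> M s \<omega>) \<and>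
     (\<forall>\<omega>. \<forall>t\<ge>0. ((\<lambda>s. M s \<omega>) \<longlongrightarrow> M t \<omega>) (at_right t)) \<and>
     (\<forall>t\<ge>0. M t \<in> borel_measurable (augmented_sigma X P t)) \<and>
     (\<forall>\<omega>. \<forall>s\<ge>0. \<forall>t\<ge>0. M (t + s) \<omega> = M t \<omega> * M s (\<theta> t \<omega>))"

definition permanent_points :: "('e option \<Rightarrow> 'w measure) \<Rightarrow> (real \<Rightarrow> 'w \<Rightarrow> real) \<Rightarrow> 'e set" where
  "permanent_points P M = {x. emeasure (completion (P (Some x))) {\<omega>. M 0 \<omega> = 1} = 1}"

text \<open>The fine topology is the coarsest one making all \<open>\<alpha>\<close>-excessive functions, \<open>\<alpha> > 0\<close>, continuous.\<close>

definition fine_topology ::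
  "(real \<Rightarrow> 'w \<Rightarrow> 'e::topological_space option) \<Rightarrow> ('e option \<Rightarrow> 'w measure) \<Rightarrow> 'e topology"
where
  "fine_topology X P =
     topology_generated_by {f -` U | f \<alpha> U. 0 < \<alpha> \<and> excessive X P \<alpha> f \<and> open U}"

text \<open>
  The condition \<open>M\<^sub>\<zeta> = 0\<close> concerns finite \<open>\<zeta>\<close>. Since \<open>M\<close> decreases and \<open>X\<close> is right continuous, it says that
  \<open>M\<close> vanishes whenever \<open>X\<close> is in the cemetery.
\<close>

definition MF ::
  "(real \<Rightarrow> 'w \<Rightarrow> 'e::topological_space option) \<Rightarrow> (real \<Rightarrow> 'w \<Rightarrow> 'w) \<Rightarrow> ('e option \<Rightarrow> 'w measure) \<Rightarrow>
   (real \<Rightarrow> 'w \<Rightarrow> real) set"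
where
  "MF X \<theta> P =
     {M. multiplicative_functional X \<theta> P M \<and>
         openin (fine_topology X P) (permanent_points P M) \<and>
         (\<forall>\<omega> t. 0 \<le> t \<and> lifetime X \<omega> = ereal t \<longrightarrow> M t \<omega> = 0)}"

definition subprocess_transition ::
  "(real \<Rightarrow> 'w \<Rightarrow> 'e::topological_space option) \<Rightarrow> ('e option \<Rightarrow> 'w measure) \<Rightarrow> (real \<Rightarrow> 'w \<Rightarrow> real) \<Rightarrow>
   real \<Rightarrow> ('e \<Rightarrow> ennreal) \<Rightarrow> 'e \<Rightarrow> ennreal"
where
  "subprocess_transition X P M t f x =
     (\<integral>\<^sup>+\<omega>. case_option 0 f (X t \<omega>) * ennreal (M t \<omega>) \<partial>completion (P (Some x)))"

text \<open>
  The set \<open>permanent_points P M\<close>, that is \<open>E\<^sub>M\<close>, need not be Borel, so \<open>m\<close> is completed before it is restricted.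
\<close>

definition subprocess_measure ::
  "'e::topological_space measure \<Rightarrow> ('e option \<Rightarrow> 'w measure) \<Rightarrow> (real \<Rightarrow> 'w \<Rightarrow> real) \<Rightarrow> 'e measure"
where
  "subprocess_measure m P M = restrict_space (completion m) (permanent_points P M)"

definition subprocess_form ::
  "'e::topological_space measure \<Rightarrow> (real \<Rightarrow> 'w \<Rightarrow> 'e option) \<Rightarrow> ('e option \<Rightarrow> 'w measure) \<Rightarrow>
   (real \<Rightarrow> 'w \<Rightarrow> real) \<Rightarrow> ('e \<Rightarrow> real) set \<Rightarrow> (('e \<Rightarrow> real) \<Rightarrow> ('e \<Rightarrow> real) \<Rightarrow> real) \<Rightarrow> bool"
where
  "subprocess_form m X P M FM EM \<longleftrightarrow>
     dirichlet_form (subprocess_measure m P M) FM EM \<and>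
     (\<exists>T. form_semigroup (subprocess_measure m P M) FM EM T \<and>
        (\<forall>t\<ge>0. \<forall>f\<in>L2 (subprocess_measure m P M). f \<in> borel_measurable borel \<and> (\<forall>x. 0 \<le> f x) \<longrightarrow>
           (AE x in subprocess_measure m P M.
              enn2ereal (subprocess_transition X P M t (\<lambda>y. ennreal (f y)) x) = ereal (T t f x))))"

text \<open>
  If \<open>m(E - E\<^sub>M) = 0\<close>, then \<open>L\<^sup>2(E, m)\<close> and \<open>L\<^sup>2(E\<^sub>M, m)\<close> are identified by restriction. Membership in a domain
  \<open>FM \<subseteq> L\<^sup>2(E\<^sub>M, m)\<close> and the values of a form on it do not depend on values outside \<open>E\<^sub>M\<close>; hence regarding the
  form as one on \<open>L\<^sup>2(E, m)\<close> leaves its values alone and turns the domain into the following one.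
\<close>

definition domain_on_E :: "'e measure \<Rightarrow> ('e \<Rightarrow> real) set \<Rightarrow> ('e \<Rightarrow> real) set" where
  "domain_on_E m FM = {f \<in> L2 m. f \<in> FM}"

end

theory Submission
  imports Defs
begin

text \<open>
  Since \<open>M \<le> 1\<close>, killing by \<open>M\<close> decreases the transition function, and hence the \<open>L\<^sup>2\<close>-semigroup on nonnegative
  functions; this is the domination. Passing from \<open>L\<^sup>2(E\<^sub>M, m)\<close> to \<open>L\<^sup>2(E, m)\<close> is a matter of choosing Borel
  representatives. Quasi-regularity then follows from domination: a Dirichlet form \<open>(E', F')\<close>
  that is dominated by a quasi-regular form \<open>(E, F)\<close> on the same \<open>L\<^sup>2\<close>-space is quasi-regular
  (\<open>dominated_quasi_regular\<close>). The reasons are as follows.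

  Domination gives \<open>G' \<le> G\<close> for the resolvents. Comparing the approximating forms \<open>\<beta> (u - \<beta> G\<^sub>\<beta> u, v)\<close> of \<open>E\<close> and
  \<open>E'\<close> yields \<open>F' \<subseteq> F\<close> and the order ideal property: if \<open>0 \<le> g \<le> f\<close> with \<open>g \<in> F\<close> and \<open>f \<in> F'\<close>, then \<open>g \<in> F'\<close>, with a
  bound on the energy of \<open>g\<close> (\<open>order_ideal\<close>). If \<open>f\<^sub>n \<rightarrow> f\<close> in \<open>F\<close>, where \<open>f \<ge> 0\<close> is in \<open>F'\<close> and \<open>f\<^sub>n\<close> vanishes off a
  member of an \<open>E\<close>-nest, then \<open>min f f\<^sub>n\<^sup>+\<close> lies in \<open>F'\<close>, vanishes off the same set, is bounded in energy and
  tends to \<open>f\<close> in \<open>L\<^sup>2\<close>. Convex combinations converge in energy, so that every \<open>E\<close>-nest is an \<open>E'\<close>-nest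
  (\<open>dominated_nest\<close>). In particular there is an \<open>E'\<close>-nest of compact sets, and \<open>E\<close>-quasi-continuous functions are
  \<open>E'\<close>-quasi-continuous. Every \<open>u \<in> F\<close> has an \<open>E\<close>-quasi-continuous version (\<open>qc_version_exists\<close>), so every
  \<open>u \<in> F'\<close> has an \<open>E'\<close>-quasi-continuous one.

  For the separation of points let \<open>h' = G'\<^sub>1 \<phi>\<close> with \<open>\<phi> > 0\<close>. For large \<open>n\<close> the set where a quasi-continuous version of \<open>h'\<close> is
  at least \<open>1/n\<close> has a complement of small \<open>E'\<close>-capacity, because \<open>(h' - 1/n)\<^sup>+\<close> tends to \<open>h'\<close>; so this version is positive
  off an \<open>E'\<close>-polar set. If \<open>u\<^sub>n\<close> separate points for \<open>E\<close>, the functions \<open>min h' (\<plusminus> u\<^sub>n - q)\<^sup>+\<close> with rational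
  \<open>q \<ge> 0\<close> belong to \<open>F'\<close> by the ideal property and separate points where \<open>h' > 0\<close>.

  Capacity is handled through one reference function \<open>h = G\<^sub>1 \<phi>\<close>: an increasing sequence of closed sets is a nest iff
  \<open>h\<close> is approximated by functions \<open>0 \<le> g \<le> h\<close> that vanish off the sets (\<open>nest_iff_thick\<close>). Weak compactness
  is replaced throughout by the elementary \<open>L2_approx_imp_Q_approx\<close>.
\<close>

section \<open>Square integrable functions\<close>

lemma abs_le_mult_self: "\<bar>a\<bar> \<le> \<bar>b\<bar> \<Longrightarrow> a * a \<le> b * b" for a b :: real
  by (simp add: abs_le_square_iff power2_eq_square)

lemma L2_measurable: "f \<in> L2 \<mu> \<Longrightarrow> f \<in> borel_measurable \<mu>"
  by (simp add: L2_def)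

lemma L2_sq_integrable: "f \<in> L2 \<mu> \<Longrightarrow> integrable \<mu> (\<lambda>x. f x * f x)"
  by (simp add: L2_def power2_eq_square)

lemma L2_I:
  "f \<in> borel_measurable \<mu> \<Longrightarrow> integrable \<mu> (\<lambda>x. f x * f x) \<Longrightarrow> f \<in> L2 \<mu>"
  by (simp add: L2_def power2_eq_square)

lemma L2_mult_integrable:
  assumes "f \<in> L2 \<mu>" "g \<in> L2 \<mu>"
  shows "integrable \<mu> (\<lambda>x. f x * g x)"
proof (rule Bochner_Integration.integrable_bound)
  show "integrable \<mu> (\<lambda>x. f x * f x + g x * g x)"
    using assms by (intro Bochner_Integration.integrable_add L2_sq_integrable)
  show "(\<lambda>x. f x * g x) \<in> borel_measurable \<mu>"
    using assms by (intro borel_measurable_times L2_measurable)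
  have "\<bar>a * b\<bar> \<le> a * a + b * b" for a b :: real
  proof -
    have "2 * \<bar>a * b\<bar> \<le> a * a + b * b"
      using sum_squares_bound[of "\<bar>a\<bar>" "\<bar>b\<bar>"] by (simp add: abs_mult power2_eq_square)
    moreover have "0 \<le> \<bar>a * b\<bar>" by simp
    ultimately show ?thesis by linarith
  qed
  then show "AE x in \<mu>. norm (f x * g x) \<le> norm (f x * f x + g x * g x)"
    by (simp add: sum_squares_ge_zero)
qed

lemma L2_dominated:
  assumes "f \<in> borel_measurable \<mu>" "g \<in> L2 \<mu>" "AE x in \<mu>. \<bar>f x\<bar> \<le> \<bar>g x\<bar>"
  shows "f \<in> L2 \<mu>"
proof (rule L2_I[OF assms(1)])
  show "integrable \<mu> (\<lambda>x. f x * f x)"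
  proof (rule Bochner_Integration.integrable_bound[OF L2_sq_integrable[OF assms(2)]])
    show "AE x in \<mu>. norm (f x * f x) \<le> norm (g x * g x)"
      using assms(3) by eventually_elim (simp add: abs_le_mult_self)
  qed (use assms(1) in measurable)
qed

lemma L2_lin:
  assumes "f \<in> L2 \<mu>" "g \<in> L2 \<mu>"
  shows "(\<lambda>x. a * f x + b * g x) \<in> L2 \<mu>"
proof (rule L2_I)
  note [measurable] = L2_measurable[OF assms(1)] L2_measurable[OF assms(2)]
  show "(\<lambda>x. a * f x + b * g x) \<in> borel_measurable \<mu>" by measurable
  have "integrable \<mu> (\<lambda>x. (a*a) * (f x * f x) + (b*b) * (g x * g x) + (2*a*b) * (f x * g x))"
    using assms by (intro Bochner_Integration.integrable_add integrable_mult_right L2_mult_integrable)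
  then show "integrable \<mu> (\<lambda>x. (a * f x + b * g x) * (a * f x + b * g x))"
    by (simp add: algebra_simps)
qed

lemma L2_add: "f \<in> L2 \<mu> \<Longrightarrow> g \<in> L2 \<mu> \<Longrightarrow> (\<lambda>x. f x + g x) \<in> L2 \<mu>"
  using L2_lin[of f \<mu> g 1 1] by simp

lemma L2_diff: "f \<in> L2 \<mu> \<Longrightarrow> g \<in> L2 \<mu> \<Longrightarrow> (\<lambda>x. f x - g x) \<in> L2 \<mu>"
  using L2_lin[of f \<mu> g 1 "-1"] by simp

lemma L2_scale: "f \<in> L2 \<mu> \<Longrightarrow> (\<lambda>x. c * f x) \<in> L2 \<mu>"
  using L2_lin[of f \<mu> f c 0] by simp

lemma L2_inner_commute: "L2_inner \<mu> f g = L2_inner \<mu> g f"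
  by (simp add: L2_inner_def mult.commute)

lemma L2_inner_add_left:
  "f \<in> L2 \<mu> \<Longrightarrow> g \<in> L2 \<mu> \<Longrightarrow> h \<in> L2 \<mu> \<Longrightarrow>
    L2_inner \<mu> (\<lambda>x. f x + g x) h = L2_inner \<mu> f h + L2_inner \<mu> g h"
  by (simp add: L2_inner_def distrib_right L2_mult_integrable)

lemma L2_inner_diff_left:
  "f \<in> L2 \<mu> \<Longrightarrow> g \<in> L2 \<mu> \<Longrightarrow> h \<in> L2 \<mu> \<Longrightarrow>
    L2_inner \<mu> (\<lambda>x. f x - g x) h = L2_inner \<mu> f h - L2_inner \<mu> g h"
  by (simp add: L2_inner_def left_diff_distrib L2_mult_integrable)

lemma L2_inner_scale_left: "L2_inner \<mu> (\<lambda>x. c * f x) h = c * L2_inner \<mu> f h"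
  by (simp add: L2_inner_def mult.assoc)

lemma L2_inner_add_right:
  "f \<in> L2 \<mu> \<Longrightarrow> g \<in> L2 \<mu> \<Longrightarrow> h \<in> L2 \<mu> \<Longrightarrow>
    L2_inner \<mu> h (\<lambda>x. f x + g x) = L2_inner \<mu> h f + L2_inner \<mu> h g"
  by (simp add: L2_inner_def distrib_left L2_mult_integrable)

lemma L2_inner_diff_right:
  "f \<in> L2 \<mu> \<Longrightarrow> g \<in> L2 \<mu> \<Longrightarrow> h \<in> L2 \<mu> \<Longrightarrow>
    L2_inner \<mu> h (\<lambda>x. f x - g x) = L2_inner \<mu> h f - L2_inner \<mu> h g"
  by (simp add: L2_inner_def right_diff_distrib L2_mult_integrable)

lemma L2_inner_scale_right: "L2_inner \<mu> h (\<lambda>x. c * f x) = c * L2_inner \<mu> h f"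
  by (simp add: L2_inner_def mult.left_commute)

lemma L2_inner_cong_AE:
  assumes "f \<in> borel_measurable \<mu>" "f' \<in> borel_measurable \<mu>" "g \<in> borel_measurable \<mu>"
    "g' \<in> borel_measurable \<mu>" "AE x in \<mu>. f x = f' x" "AE x in \<mu>. g x = g' x"
  shows "L2_inner \<mu> f g = L2_inner \<mu> f' g'"
  unfolding L2_inner_def
proof (rule integral_cong_AE)
  show "AE x in \<mu>. f x * g x = f' x * g' x"
    using assms(5,6) by eventually_elim simp
qed (use assms in measurable)

lemma L2_inner_nonneg: "AE x in \<mu>. 0 \<le> f x * g x \<Longrightarrow> 0 \<le> L2_inner \<mu> f g"
  unfolding L2_inner_def by (rule integral_nonneg_AE)

lemma L2_inner_self_nonneg: "0 \<le> L2_inner \<mu> f f"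
  by (simp add: L2_inner_nonneg)

lemma L2_inner_mono:
  assumes "f \<in> L2 \<mu>" "g \<in> L2 \<mu>" "f' \<in> L2 \<mu>" "g' \<in> L2 \<mu>"
    "AE x in \<mu>. f x * g x \<le> f' x * g' x"
  shows "L2_inner \<mu> f g \<le> L2_inner \<mu> f' g'"
  unfolding L2_inner_def using assms
  by (intro integral_mono_AE L2_mult_integrable)

lemma L2_inner_le_half_squares:
  assumes "f \<in> L2 \<mu>" "g \<in> L2 \<mu>"
  shows "2 * \<bar>L2_inner \<mu> f g\<bar> \<le> L2_inner \<mu> f f + L2_inner \<mu> g g"
proof -
  have "L2_inner \<mu> (\<lambda>x. f x + g x) (\<lambda>x. f x + g x) =
      L2_inner \<mu> f f + 2 * L2_inner \<mu> f g + L2_inner \<mu> g g"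
    using assms by (simp add: L2_inner_add_left L2_inner_add_right L2_add L2_inner_commute[of \<mu> g f])
  moreover have "L2_inner \<mu> (\<lambda>x. f x - g x) (\<lambda>x. f x - g x) =
      L2_inner \<mu> f f - 2 * L2_inner \<mu> f g + L2_inner \<mu> g g"
    using assms by (simp add: L2_inner_diff_left L2_inner_diff_right L2_diff L2_inner_commute[of \<mu> g f])
  ultimately show ?thesis
    using L2_inner_self_nonneg[of \<mu> "\<lambda>x. f x + g x"] L2_inner_self_nonneg[of \<mu> "\<lambda>x. f x - g x"]
    by linarith
qed

lemma L2_sq_add_le:
  assumes "f \<in> L2 \<mu>" "g \<in> L2 \<mu>"
  shows "L2_inner \<mu> (\<lambda>x. f x + g x) (\<lambda>x. f x + g x) \<le> 2 * L2_inner \<mu> f f + 2 * L2_inner \<mu> g g"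
  using L2_inner_le_half_squares[OF assms] assms
  by (simp add: L2_inner_add_left L2_inner_add_right L2_add L2_inner_commute[of \<mu> g f])

lemma L2_sq_mono:
  assumes "f \<in> L2 \<mu>" "g \<in> L2 \<mu>" "AE x in \<mu>. \<bar>f x\<bar> \<le> \<bar>g x\<bar>"
  shows "L2_inner \<mu> f f \<le> L2_inner \<mu> g g"
proof (rule L2_inner_mono[OF assms(1,1,2,2)])
  show "AE x in \<mu>. f x * f x \<le> g x * g x"
    using assms(3) by eventually_elim (rule abs_le_mult_self)
qed

lemma L2_sq_eq_0_AE:
  assumes "f \<in> L2 \<mu>" "L2_inner \<mu> f f \<le> 0"
  shows "AE x in \<mu>. f x = 0"
proof -
  have "(\<integral>x. f x * f x \<partial>\<mu>) = 0"
    using assms(2) L2_inner_self_nonneg[of \<mu> f] unfolding L2_inner_def by linarith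
  then have "AE x in \<mu>. f x * f x = 0"
    using integral_nonneg_eq_0_iff_AE[OF L2_sq_integrable[OF assms(1)]] by simp
  then show ?thesis by simp
qed

lemma L2_dominated_convergence:
  fixes f :: "nat \<Rightarrow> 'a \<Rightarrow> real"
  assumes meas: "\<And>n. f n \<in> borel_measurable \<mu>" "u \<in> borel_measurable \<mu>" and g: "g \<in> L2 \<mu>"
    and lim: "AE x in \<mu>. (\<lambda>n. f n x) \<longlonglongrightarrow> u x"
    and dom: "\<And>n. AE x in \<mu>. \<bar>f n x - u x\<bar> \<le> \<bar>g x\<bar>"
  shows "(\<lambda>n. L2_inner \<mu> (\<lambda>x. f n x - u x) (\<lambda>x. f n x - u x)) \<longlonglongrightarrow> 0"
proof -
  have "(\<lambda>n. \<integral>x. (f n x - u x) * (f n x - u x) \<partial>\<mu>) \<longlonglongrightarrow> (\<integral>x. 0 \<partial>\<mu>)"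
  proof (rule integral_dominated_convergence[where w="\<lambda>x. g x * g x"])
    show "integrable \<mu> (\<lambda>x. g x * g x)" by (rule L2_sq_integrable[OF g])
    show "AE x in \<mu>. (\<lambda>n. (f n x - u x) * (f n x - u x)) \<longlonglongrightarrow> 0"
      using lim
    proof eventually_elim
      case (elim x)
      then have "(\<lambda>n. f n x - u x) \<longlonglongrightarrow> 0" using LIM_zero by blast
      then show ?case using tendsto_mult_zero by blast
    qed
    show "AE x in \<mu>. norm ((f n x - u x) * (f n x - u x)) \<le> g x * g x" for n
      using dom[of n]
      by eventually_elim (simp add: abs_le_mult_self)
  qed (use meas in measurable)
  then show ?thesis by (simp add: L2_inner_def)
qed

section \<open>Coercive closed forms\<close>

locale closed_form =
  fixes \<mu> :: "'a measure" and F :: "('a \<Rightarrow> real) set" and E :: "('a \<Rightarrow> real) \<Rightarrow> ('a \<Rightarrow> real) \<Rightarrow> real"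
  assumes coercive_closed: "coercive_closed_form \<mu> F E"
begin

abbreviation B :: "real \<Rightarrow> ('a \<Rightarrow> real) \<Rightarrow> ('a \<Rightarrow> real) \<Rightarrow> real" where
  "B \<equiv> shifted_form \<mu> E"

abbreviation Q :: "('a \<Rightarrow> real) \<Rightarrow> real" where
  "Q u \<equiv> B 1 u u"

lemma bilinear: "bilinear_form \<mu> F E"
  using coercive_closed by (simp add: coercive_closed_form_def)

lemma F_L2: "u \<in> F \<Longrightarrow> u \<in> L2 \<mu>"
  using bilinear by (auto simp: bilinear_form_def)

lemma F_measurable: "u \<in> F \<Longrightarrow> u \<in> borel_measurable \<mu>"
  by (intro L2_measurable F_L2)

lemma F_zero: "(\<lambda>x. 0) \<in> F"
  using bilinear by (simp add: bilinear_form_def)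

lemma F_lin: "u \<in> F \<Longrightarrow> v \<in> F \<Longrightarrow> (\<lambda>x. a * u x + b * v x) \<in> F"
  using bilinear by (simp add: bilinear_form_def)

lemma F_add: "u \<in> F \<Longrightarrow> v \<in> F \<Longrightarrow> (\<lambda>x. u x + v x) \<in> F"
  using F_lin[of u v 1 1] by simp

lemma F_diff: "u \<in> F \<Longrightarrow> v \<in> F \<Longrightarrow> (\<lambda>x. u x - v x) \<in> F"
  using F_lin[of u v 1 "-1"] by simp

lemma F_scale: "u \<in> F \<Longrightarrow> (\<lambda>x. c * u x) \<in> F"
  using F_lin[of u u c 0] by simp

lemma F_AE_cong: "u \<in> F \<Longrightarrow> v \<in> L2 \<mu> \<Longrightarrow> AE x in \<mu>. u x = v x \<Longrightarrow> v \<in> F"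
  using bilinear unfolding bilinear_form_def by blast

lemma B_lin_left:
  assumes "u \<in> F" "v \<in> F" "w \<in> F"
  shows "B \<alpha> (\<lambda>x. a * u x + b * v x) w = a * B \<alpha> u w + b * B \<alpha> v w"
proof -
  have "E (\<lambda>x. a * u x + b * v x) w = a * E u w + b * E v w"
    using bilinear assms unfolding bilinear_form_def by blast
  then show ?thesis
    using assms
    by (simp add: shifted_form_def L2_inner_add_left L2_inner_scale_left L2_scale F_L2 algebra_simps)
qed

lemma B_lin_right:
  assumes "u \<in> F" "v \<in> F" "w \<in> F"
  shows "B \<alpha> w (\<lambda>x. a * u x + b * v x) = a * B \<alpha> w u + b * B \<alpha> w v"
proof -
  have "E w (\<lambda>x. a * u x + b * v x) = a * E w u + b * E w v"
    using bilinear assms unfolding bilinear_form_def by blast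
  then show ?thesis
    using assms
    by (simp add: shifted_form_def L2_inner_add_right L2_inner_scale_right L2_scale F_L2 algebra_simps)
qed

lemma B_bilinear:
  assumes "u \<in> F" "v \<in> F" "w \<in> F"
  shows "B \<alpha> (\<lambda>x. u x + v x) w = B \<alpha> u w + B \<alpha> v w"
    "B \<alpha> (\<lambda>x. u x - v x) w = B \<alpha> u w - B \<alpha> v w"
    "B \<alpha> w (\<lambda>x. u x + v x) = B \<alpha> w u + B \<alpha> w v"
    "B \<alpha> w (\<lambda>x. u x - v x) = B \<alpha> w u - B \<alpha> w v"
  using B_lin_left[OF assms, of \<alpha> 1 1] B_lin_left[OF assms, of \<alpha> 1 "-1"]
    B_lin_right[OF assms, of \<alpha> 1 1] B_lin_right[OF assms, of \<alpha> 1 "-1"] by simp_all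

lemma B_scale_left: "u \<in> F \<Longrightarrow> w \<in> F \<Longrightarrow> B \<alpha> (\<lambda>x. c * u x) w = c * B \<alpha> u w"
  using B_lin_left[of u u w \<alpha> c 0] by simp

lemma B_scale_right: "u \<in> F \<Longrightarrow> w \<in> F \<Longrightarrow> B \<alpha> w (\<lambda>x. c * u x) = c * B \<alpha> w u"
  using B_lin_right[of u u w \<alpha> c 0] by simp

lemma B_shift: "B \<alpha> u v = B \<beta> u v + (\<alpha> - \<beta>) * L2_inner \<mu> u v"
  by (simp add: shifted_form_def algebra_simps)

lemma B_AE_cong:
  assumes "u \<in> F" "v \<in> F" "AE x in \<mu>. u x = v x" "w \<in> F"
  shows "B \<alpha> u w = B \<alpha> v w" "B \<alpha> w u = B \<alpha> w v"
proof -
  have "E u w = E v w" "E w u = E w v"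
    using bilinear assms F_L2 unfolding bilinear_form_def by blast+
  moreover have "L2_inner \<mu> u w = L2_inner \<mu> v w" "L2_inner \<mu> w u = L2_inner \<mu> w v"
    using assms by (auto intro!: L2_inner_cong_AE F_measurable)
  ultimately show "B \<alpha> u w = B \<alpha> v w" "B \<alpha> w u = B \<alpha> w v"
    by (simp_all add: shifted_form_def)
qed

lemma Q_AE_cong: "u \<in> F \<Longrightarrow> v \<in> F \<Longrightarrow> AE x in \<mu>. u x = v x \<Longrightarrow> Q u = Q v"
  using B_AE_cong(1)[of u v u 1] B_AE_cong(2)[of u v v 1] by simp

lemma F_complete:
  assumes "\<And>n. u n \<in> F"
    and "\<And>\<epsilon>. 0 < \<epsilon> \<Longrightarrow> \<exists>N. \<forall>i\<ge>N. \<forall>j\<ge>N. Q (\<lambda>x. u i x - u j x) < \<epsilon>"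
  shows "\<exists>v\<in>F. (\<lambda>n. Q (\<lambda>x. u n x - v x)) \<longlonglongrightarrow> 0"
proof -
  have "\<forall>u :: nat \<Rightarrow> 'a \<Rightarrow> real. (\<forall>n. u n \<in> F) \<and>
      (\<forall>\<epsilon>>0. \<exists>N. \<forall>i\<ge>N. \<forall>j\<ge>N. Q (\<lambda>x. u i x - u j x) < \<epsilon>) \<longrightarrow>
      (\<exists>v\<in>F. (\<lambda>n. Q (\<lambda>x. u n x - v x)) \<longlonglongrightarrow> 0)"
    using coercive_closed[unfolded coercive_closed_form_def] by (elim conjE)
  then show ?thesis using assms by blast
qed

lemma E_diag_nonneg: "u \<in> F \<Longrightarrow> 0 \<le> B 0 u u"
  using coercive_closed by (simp add: coercive_closed_form_def shifted_form_def)

lemma Q_eq: "Q u = B 0 u u + L2_inner \<mu> u u"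
  by (simp add: shifted_form_def)

lemma L2_sq_le_Q: "u \<in> F \<Longrightarrow> L2_inner \<mu> u u \<le> Q u"
  using E_diag_nonneg[of u] by (simp add: Q_eq)

lemma Q_nonneg: "u \<in> F \<Longrightarrow> 0 \<le> Q u"
  using L2_sq_le_Q[of u] L2_inner_self_nonneg[of \<mu> u] by linarith

lemma Q_scale: "u \<in> F \<Longrightarrow> Q (\<lambda>x. c * u x) = c\<^sup>2 * Q u"
  by (simp add: B_scale_left B_scale_right F_scale power2_eq_square)

lemma Q_parallelogram:
  assumes "u \<in> F" "v \<in> F"
  shows "Q (\<lambda>x. u x + v x) + Q (\<lambda>x. u x - v x) = 2 * Q u + 2 * Q v"
  using assms by (simp add: B_bilinear F_add F_diff)

lemma Q_add_le: "u \<in> F \<Longrightarrow> v \<in> F \<Longrightarrow> Q (\<lambda>x. u x + v x) \<le> 2 * Q u + 2 * Q v"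
  using Q_parallelogram[of u v] Q_nonneg[OF F_diff, of u v] by linarith

lemma Q_diff_le: "u \<in> F \<Longrightarrow> v \<in> F \<Longrightarrow> Q (\<lambda>x. u x - v x) \<le> 2 * Q u + 2 * Q v"
  using Q_parallelogram[of u v] Q_nonneg[OF F_add, of u v] by linarith

lemma Q_diff_commute: "u \<in> F \<Longrightarrow> v \<in> F \<Longrightarrow> Q (\<lambda>x. u x - v x) = Q (\<lambda>x. v x - u x)"
  by (simp add: B_bilinear F_diff)

text \<open>
  The sector condition in additive form. All later estimates only ask for some bound, so that the
  weights \<open>1/4\<close> and \<open>c\<close> spare the square roots.
\<close>

lemma sector: "\<exists>c\<ge>0. \<forall>u\<in>F. \<forall>v\<in>F. \<bar>B 1 u v\<bar> \<le> Q u / 4 + c * Q v"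
proof -
  obtain K where K: "\<And>u v. u \<in> F \<Longrightarrow> v \<in> F \<Longrightarrow> \<bar>B 1 u v\<bar> \<le> K * sqrt (Q u) * sqrt (Q v)"
    using coercive_closed unfolding coercive_closed_form_def by blast
  have "\<bar>B 1 u v\<bar> \<le> Q u / 4 + K\<^sup>2 * Q v" if u: "u \<in> F" and v: "v \<in> F" for u v
  proof -
    define a b where "a = sqrt (Q u)" and "b = sqrt (Q v)"
    have ab: "a\<^sup>2 = Q u" "b\<^sup>2 = Q v"
      using u v Q_nonneg by (simp_all add: a_def b_def)
    have "0 \<le> (a / 2 - K * b)\<^sup>2" by simp
    then have "K * a * b \<le> a\<^sup>2 / 4 + K\<^sup>2 * b\<^sup>2"
      by (simp add: power2_diff power_divide power_mult_distrib algebra_simps)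
    then have "K * a * b \<le> Q u / 4 + K\<^sup>2 * Q v" by (simp only: ab)
    then show ?thesis
      using K[OF u v] unfolding a_def[symmetric] b_def[symmetric] by linarith
  qed
  then show ?thesis
    by (intro exI[of _ "K\<^sup>2"]) auto
qed

text \<open>
  A Banach--Saks argument: a convex set \<open>D \<subseteq> F\<close> that is bounded for \<open>Q\<close> and meets every \<open>L\<^sup>2\<close>-neighbourhood
  of \<open>u\<close> also meets every \<open>Q\<close>-neighbourhood of \<open>u\<close>. Among the elements of \<open>D\<close> within \<open>L\<^sup>2\<close>-distance
  \<open>1/n\<close> of \<open>u\<close> almost minimize \<open>Q\<close>; by the parallelogram law the minimizers form a Cauchy sequence.
\<close>

lemma L2_approx_imp_Q_approx:
  assumes D: "D \<subseteq> F" and mid: "\<And>v w. v \<in> D \<Longrightarrow> w \<in> D \<Longrightarrow> (\<lambda>x. 1/2 * v x + 1/2 * w x) \<in> D"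
    and u: "u \<in> L2 \<mu>"
    and approx: "\<And>\<epsilon>. 0 < \<epsilon> \<Longrightarrow> \<exists>w\<in>D. L2_inner \<mu> (\<lambda>x. w x - u x) (\<lambda>x. w x - u x) \<le> \<epsilon> \<and> Q w \<le> C"
  shows "u \<in> F \<and> (\<forall>\<epsilon>>0. \<exists>w\<in>D. Q (\<lambda>x. u x - w x) < \<epsilon>) \<and> Q u \<le> 2 * C"
proof -
  define d where "d w = L2_inner \<mu> (\<lambda>x. w x - u x) (\<lambda>x. w x - u x)" for w
  define S where "S n = {w \<in> D. d w \<le> 1 / real (Suc n) \<and> Q w \<le> C}" for n
  define a where "a n = Inf (Q ` S n)" for n
  have S_F: "w \<in> F" if "w \<in> S n" for w n
    using that D by (auto simp: S_def)
  have S_ne: "S n \<noteq> {}" for n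
    using approx[of "1 / real (Suc n)"] by (auto simp: S_def d_def)
  have S_anti: "S j \<subseteq> S i" if "i \<le> j" for i j
    using that frac_le[of 1 1 "real (Suc i)" "real (Suc j)"] by (force simp: S_def)
  have bdd: "bdd_below (Q ` S n)" for n
    using S_F Q_nonneg by (intro bdd_belowI[of _ 0]) auto
  have a_le: "a n \<le> Q w" if "w \<in> S n" for w n
    unfolding a_def using bdd that by (intro cInf_lower) auto
  have a_mono: "a i \<le> a j" if "i \<le> j" for i j
    unfolding a_def using S_anti[OF that] S_ne bdd
    by (intro cInf_superset_mono) auto
  have a_C: "a n \<le> C" for n
  proof -
    obtain w where "w \<in> S n" using S_ne by blast
    then show ?thesis using a_le[of w n] by (auto simp: S_def)
  qed
  have "\<exists>w. w \<in> S n \<and> Q w < a n + 1 / real (Suc n)" for n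
  proof -
    have "Inf (Q ` S n) < a n + 1 / real (Suc n)" by (simp add: a_def)
    then show ?thesis
      using cInf_less_iff[of "Q ` S n"] S_ne bdd by fastforce
  qed
  then obtain w where w: "\<And>n. w n \<in> S n" "\<And>n. Q (w n) < a n + 1 / real (Suc n)"
    by metis
  have wF: "w n \<in> F" and wD: "w n \<in> D" and wd: "d (w n) \<le> 1 / real (Suc n)" and wC: "Q (w n) \<le> C" for n
    using w(1)[of n] S_F by (auto simp: S_def)
  have mid_S: "(\<lambda>x. 1/2 * v x + 1/2 * v' x) \<in> S n" if v: "v \<in> S n" "v' \<in> S n" for v v' n
  proof -
    have F: "v \<in> F" "v' \<in> F" using that S_F by auto
    have L: "(\<lambda>x. v x - u x) \<in> L2 \<mu>" "(\<lambda>x. v' x - u x) \<in> L2 \<mu>"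
      using F u by (auto intro: L2_diff F_L2)
    have "d (\<lambda>x. 1/2 * v x + 1/2 * v' x) =
        L2_inner \<mu> (\<lambda>x. 1/2 * ((v x - u x) + (v' x - u x))) (\<lambda>x. 1/2 * ((v x - u x) + (v' x - u x)))"
      unfolding d_def by (rule arg_cong2[where f="L2_inner \<mu>"]) (auto simp: field_simps)
    also have "\<dots> \<le> 1/4 * (2 * d v + 2 * d v')"
      unfolding L2_inner_scale_left L2_inner_scale_right using L2_sq_add_le[OF L] by (simp add: d_def)
    also have "\<dots> \<le> 1 / real (Suc n)"
      using v by (simp add: S_def)
    finally have 1: "d (\<lambda>x. 1/2 * v x + 1/2 * v' x) \<le> 1 / real (Suc n)" .
    have "Q (\<lambda>x. 1/2 * v x + 1/2 * v' x) = 1/4 * Q (\<lambda>x. v x + v' x)"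
      using Q_scale[OF F_add[OF F], of "1/2"] by (simp add: algebra_simps add_divide_distrib power2_eq_square)
    also have "\<dots> \<le> C"
      using Q_add_le[OF F] v by (simp add: S_def)
    finally show ?thesis using 1 mid v by (simp add: S_def)
  qed
  have diff: "Q (\<lambda>x. w i x - w j x) \<le> 2 * (a j - a i) + 4 / real (Suc i)" if "i \<le> j" for i j
  proof -
    have "w j \<in> S i" using w(1) S_anti[OF that] by blast
    then have "a i \<le> Q (\<lambda>x. 1/2 * w i x + 1/2 * w j x)"
      using w(1) by (intro a_le mid_S)
    also have "\<dots> = 1/4 * Q (\<lambda>x. w i x + w j x)"
      using Q_scale[OF F_add[OF wF wF], of "1/2" i j] by (simp add: algebra_simps add_divide_distrib power2_eq_square)
    finally have "4 * a i \<le> Q (\<lambda>x. w i x + w j x)" by simp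
    moreover have "1 / real (Suc j) \<le> 1 / real (Suc i)"
      using that by (simp add: frac_le)
    moreover have "4 / real (Suc i) = 4 * (1 / real (Suc i))" by simp
    ultimately show ?thesis
      using Q_parallelogram[OF wF wF, of i j] w(2)[of i] w(2)[of j] by argo
  qed
  have "convergent a"
    using a_mono a_C incseq_convergent[of a C] by (metis convergent_def incseq_def)
  then have cauchy: "Cauchy a" by (rule convergent_Cauchy)
  have "\<exists>N. \<forall>i\<ge>N. \<forall>j\<ge>N. Q (\<lambda>x. w i x - w j x) < \<epsilon>" if "0 < \<epsilon>" for \<epsilon>
  proof -
    obtain N1 where N1: "\<And>i j. i \<ge> N1 \<Longrightarrow> j \<ge> N1 \<Longrightarrow> \<bar>a i - a j\<bar> < \<epsilon> / 4"
      using CauchyD[OF cauchy, of "\<epsilon> / 4"] \<open>0 < \<epsilon>\<close> by auto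
    obtain N2 where N2: "8 / \<epsilon> < real N2" using reals_Archimedean2 by blast
    have ord: "Q (\<lambda>x. w i x - w j x) < \<epsilon>" if "i \<le> j" "i \<ge> max N1 N2" for i j
    proof -
      have "8 / \<epsilon> < real (Suc i)" using N2 that by linarith
      then have "4 / real (Suc i) < \<epsilon> / 2" using \<open>0 < \<epsilon>\<close> by (simp add: field_simps)
      moreover have "a j - a i < \<epsilon> / 4" 
        using abs_ge_minus_self[of "a i - a j"] N1[of i j] that by simp
      moreover have "r < \<epsilon>" if "r \<le> 2 * s + q" "q < \<epsilon> / 2" "s < \<epsilon> / 4" for r s q :: real
        using that by linarith
      ultimately show ?thesis using diff[OF that(1)] by blast
    qed
    have "Q (\<lambda>x. w i x - w j x) < \<epsilon>" if "i \<ge> max N1 N2" "j \<ge> max N1 N2" for i j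
      using ord[of i j] ord[of j i] that Q_diff_commute[OF wF wF, of i j] by (cases "i \<le> j") auto
    then show ?thesis by blast
  qed
  then obtain v where v: "v \<in> F" "(\<lambda>n. Q (\<lambda>x. w n x - v x)) \<longlonglongrightarrow> 0"
    using F_complete[of w] wF by blast
  have uv: "AE x in \<mu>. v x - u x = 0"
  proof (rule L2_sq_eq_0_AE)
    show "(\<lambda>x. v x - u x) \<in> L2 \<mu>" by (rule L2_diff[OF F_L2[OF v(1)] u])
    have "L2_inner \<mu> (\<lambda>x. v x - u x) (\<lambda>x. v x - u x) \<le> 2 * Q (\<lambda>x. w n x - v x) + 2 * (1 / real (Suc n))" for n
    proof -
      have L: "(\<lambda>x. v x - w n x) \<in> L2 \<mu>" "(\<lambda>x. w n x - u x) \<in> L2 \<mu>"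
        using v(1) u wF by (auto intro: L2_diff F_L2)
      have "L2_inner \<mu> (\<lambda>x. v x - u x) (\<lambda>x. v x - u x) \<le>
          2 * L2_inner \<mu> (\<lambda>x. v x - w n x) (\<lambda>x. v x - w n x) + 2 * d (w n)"
        using L2_sq_add_le[OF L] by (simp add: d_def)
      also have "L2_inner \<mu> (\<lambda>x. v x - w n x) (\<lambda>x. v x - w n x) \<le> Q (\<lambda>x. w n x - v x)"
        using L2_sq_le_Q[OF F_diff[OF v(1) wF]] Q_diff_commute[OF v(1) wF] by simp
      finally show ?thesis using wd[of n] by simp
    qed
    moreover have "(\<lambda>n. 2 * Q (\<lambda>x. w n x - v x) + 2 * (1 / real (Suc n))) \<longlonglongrightarrow> 2 * 0 + 2 * 0"
      using v(2) LIMSEQ_inverse_real_of_nat by (intro tendsto_intros) (simp_all add: inverse_eq_divide)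
    ultimately show "L2_inner \<mu> (\<lambda>x. v x - u x) (\<lambda>x. v x - u x) \<le> 0"
      by (intro LIMSEQ_le_const) auto
  qed
  then have uv': "AE x in \<mu>. v x = u x" by simp
  have uF: "u \<in> F" by (rule F_AE_cong[OF v(1) u uv'])
  have Q_eq': "Q (\<lambda>x. w n x - v x) = Q (\<lambda>x. u x - w n x)" for n
    using Q_AE_cong[OF F_diff[OF wF v(1)] F_diff[OF wF uF]] uv' Q_diff_commute[OF uF wF] by simp
  have lim: "(\<lambda>n. Q (\<lambda>x. u x - w n x)) \<longlonglongrightarrow> 0" using v(2) by (simp add: Q_eq')
  have "\<exists>w\<in>D. Q (\<lambda>x. u x - w x) < \<epsilon>" if "0 < \<epsilon>" for \<epsilon>
  proof -
    have "\<forall>\<^sub>F n in sequentially. Q (\<lambda>x. u x - w n x) < \<epsilon>"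
      using order_tendstoD(2)[OF lim that] .
    then show ?thesis using wD by (auto simp: eventually_sequentially)
  qed
  moreover have "Q u \<le> 2 * C"
  proof (rule field_le_epsilon)
    fix \<epsilon> :: real assume "0 < \<epsilon>"
    then have "\<forall>\<^sub>F n in sequentially. Q (\<lambda>x. u x - w n x) < \<epsilon> / 2"
      by (intro order_tendstoD(2)[OF lim]) simp
    then obtain n where "Q (\<lambda>x. u x - w n x) < \<epsilon> / 2" by (auto simp: eventually_sequentially)
    moreover have "Q u \<le> 2 * Q (\<lambda>x. u x - w n x) + 2 * Q (w n)"
      using Q_add_le[OF F_diff[OF uF wF[of n]] wF[of n]] by simp
    ultimately show "Q u \<le> 2 * C + \<epsilon>" using wC[of n] by linarith
  qed
  ultimately show ?thesis using uF by blast
qed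

lemma Q_lower_semicontinuous:
  assumes w: "\<And>n. w n \<in> F" and C: "\<And>n. Q (w n) \<le> C" and u: "u \<in> L2 \<mu>"
    and lim: "(\<lambda>n. L2_inner \<mu> (\<lambda>x. w n x - u x) (\<lambda>x. w n x - u x)) \<longlonglongrightarrow> 0"
  shows "u \<in> F \<and> Q u \<le> 2 * C"
proof -
  have "\<exists>v\<in>F. L2_inner \<mu> (\<lambda>x. v x - u x) (\<lambda>x. v x - u x) \<le> \<epsilon> \<and> Q v \<le> C" if e: "0 < \<epsilon>" for \<epsilon>
  proof -
    obtain N where "L2_inner \<mu> (\<lambda>x. w N x - u x) (\<lambda>x. w N x - u x) < \<epsilon>"
      using order_tendstoD(2)[OF lim e] by (auto simp: eventually_sequentially)
    then show ?thesis using w C less_imp_le by blast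
  qed
  then show ?thesis
    using L2_approx_imp_Q_approx[of F u C] F_lin u by blast
qed

end

section \<open>Lattice operations on a Dirichlet space\<close>

locale dirichlet = closed_form +
  assumes dirichlet: "dirichlet_form \<mu> F E"
begin

text \<open>Applied to \<open>u / c\<close>, the Markovian property concerns the truncation of \<open>u\<close> at the level \<open>c\<close>.\<close>

lemma truncation:
  assumes u: "u \<in> F" and c: "0 < c"
  defines "w \<equiv> \<lambda>x. min (max (u x) 0) c"
  shows "w \<in> F" "B 0 (\<lambda>x. u x + w x) (\<lambda>x. u x - w x) \<ge> 0" "B 0 (\<lambda>x. u x - w x) (\<lambda>x. u x + w x) \<ge> 0"
proof -
  define v where "v = (\<lambda>x. (1/c) * u x)"
  have vF: "v \<in> F" unfolding v_def by (rule F_scale[OF u])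
  have u_eq: "u = (\<lambda>x. c * v x)" using c by (simp add: v_def)
  have w_eq: "w = (\<lambda>x. c * unit_contraction v x)"
  proof
    fix x
    show "w x = c * unit_contraction v x"
    proof (cases "u x \<le> 0")
      case True
      then have "u x / c \<le> 0" using c by (simp add: divide_le_0_iff)
      then show ?thesis using True c by (simp add: w_def unit_contraction_def v_def)
    next
      case False
      then have "u x / c \<ge> 0" using c by simp
      then show ?thesis using False c
        by (cases "u x \<le> c") (simp_all add: w_def unit_contraction_def v_def min_def max_def field_simps)
    qed
  qed
  have D: "unit_contraction v \<in> F"
    "0 \<le> E (\<lambda>x. v x + unit_contraction v x) (\<lambda>x. v x - unit_contraction v x)"
    "0 \<le> E (\<lambda>x. v x - unit_contraction v x) (\<lambda>x. v x + unit_contraction v x)"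
    using dirichlet vF by (auto simp: dirichlet_form_def)
  show wF: "w \<in> F" unfolding w_eq by (rule F_scale[OF D(1)])
  have eqs: "(\<lambda>x. u x + w x) = (\<lambda>x. c * (v x + unit_contraction v x))"
    "(\<lambda>x. u x - w x) = (\<lambda>x. c * (v x - unit_contraction v x))"
    by (auto simp: u_eq w_eq algebra_simps)
  have F: "(\<lambda>x. v x + unit_contraction v x) \<in> F" "(\<lambda>x. v x - unit_contraction v x) \<in> F"
    using vF D(1) by (auto intro: F_add F_diff)
  have D': "0 \<le> B 0 (\<lambda>x. v x + unit_contraction v x) (\<lambda>x. v x - unit_contraction v x)"
    "0 \<le> B 0 (\<lambda>x. v x - unit_contraction v x) (\<lambda>x. v x + unit_contraction v x)"
    using D by (simp_all add: shifted_form_def)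
  show "B 0 (\<lambda>x. u x + w x) (\<lambda>x. u x - w x) \<ge> 0" "B 0 (\<lambda>x. u x - w x) (\<lambda>x. u x + w x) \<ge> 0"
    unfolding eqs B_scale_left[OF F(1) F_scale[OF F(2)]] B_scale_right[OF F(2) F(1)]
      B_scale_left[OF F(2) F_scale[OF F(1)]] B_scale_right[OF F(1) F(2)]
    using c D' by simp_all
qed

lemma truncation_Q_le:
  assumes u: "u \<in> F" and c: "0 < c"
  shows "Q (\<lambda>x. min (max (u x) 0) c) \<le> Q u"
proof -
  define w where "w = (\<lambda>x. min (max (u x) 0) c)"
  have w: "w \<in> F" using truncation[OF u c] by (simp add: w_def)
  have "B 0 (\<lambda>x. u x + w x) (\<lambda>x. u x - w x) \<ge> 0" "B 0 (\<lambda>x. u x - w x) (\<lambda>x. u x + w x) \<ge> 0"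
    using truncation[OF u c] by (simp_all add: w_def)
  then have "B 0 w w \<le> B 0 u u"
    using u w by (simp add: B_bilinear F_add F_diff)
  moreover have "L2_inner \<mu> w w \<le> L2_inner \<mu> u u"
    using u w c by (intro L2_sq_mono F_L2) (auto simp: w_def)
  ultimately show ?thesis unfolding Q_eq w_def by linarith
qed

lemma truncation_tendsto_pos_part:
  assumes u: "u \<in> F"
  defines "w \<equiv> \<lambda>n x. min (max (u x) 0) (real (Suc n))" and "p \<equiv> \<lambda>x. max (u x) 0"
  shows "(\<lambda>n. L2_inner \<mu> (\<lambda>x. w n x - p x) (\<lambda>x. w n x - p x)) \<longlonglongrightarrow> 0"
proof (rule L2_dominated_convergence[where g=u])
  note [measurable] = F_measurable[OF u]
  show "w n \<in> borel_measurable \<mu>" for n unfolding w_def by measurable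
  show "p \<in> borel_measurable \<mu>" unfolding p_def by measurable
  show "u \<in> L2 \<mu>" by (rule F_L2[OF u])
  have "(\<lambda>n. w n x) \<longlonglongrightarrow> p x" for x
  proof (rule tendsto_eventually)
    obtain N where "max (u x) 0 < real N" using reals_Archimedean2 by blast
    then show "\<forall>\<^sub>F n in sequentially. w n x = p x"
      by (intro eventually_sequentiallyI[of N]) (auto simp: w_def p_def)
  qed
  then show "AE x in \<mu>. (\<lambda>n. w n x) \<longlonglongrightarrow> p x" by simp
  show "AE x in \<mu>. \<bar>w n x - p x\<bar> \<le> \<bar>u x\<bar>" for n
    by (auto simp: w_def p_def)
qed

lemma pos_part:
  assumes u: "u \<in> F"
  shows "(\<lambda>x. max (u x) 0) \<in> F" "Q (\<lambda>x. max (u x) 0) \<le> 2 * Q u"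
proof -
  have L: "(\<lambda>x. max (u x) 0) \<in> L2 \<mu>"
    using F_measurable[OF u] by (intro L2_dominated[OF _ F_L2[OF u]]) auto
  have "(\<lambda>x. max (u x) 0) \<in> F \<and> Q (\<lambda>x. max (u x) 0) \<le> 2 * Q u"
    using truncation(1)[OF u] truncation_Q_le[OF u]
    by (intro Q_lower_semicontinuous[OF _ _ L truncation_tendsto_pos_part[OF u]]) auto
  then show "(\<lambda>x. max (u x) 0) \<in> F" "Q (\<lambda>x. max (u x) 0) \<le> 2 * Q u" by auto
qed

lemma max_F:
  assumes u: "u \<in> F" and v: "v \<in> F"
  shows "(\<lambda>x. max (u x) (v x)) \<in> F" "Q (\<lambda>x. max (u x) (v x)) \<le> 10 * Q u + 8 * Q v"
proof -
  have eq: "(\<lambda>x. max (u x) (v x)) = (\<lambda>x. u x + max (v x - u x) 0)" by (auto simp: max_def)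
  note d = F_diff[OF v u]
  show "(\<lambda>x. max (u x) (v x)) \<in> F" unfolding eq by (intro F_add u pos_part d)
  show "Q (\<lambda>x. max (u x) (v x)) \<le> 10 * Q u + 8 * Q v"
    unfolding eq using Q_add_le[OF u pos_part(1)[OF d]] pos_part(2)[OF d] Q_diff_le[OF v u] by linarith
qed

lemma min_F:
  assumes u: "u \<in> F" and v: "v \<in> F"
  shows "(\<lambda>x. min (u x) (v x)) \<in> F" "Q (\<lambda>x. min (u x) (v x)) \<le> 10 * Q u + 8 * Q v"
proof -
  have eq: "(\<lambda>x. min (u x) (v x)) = (\<lambda>x. u x - max (u x - v x) 0)" by (auto simp: max_def)
  note d = F_diff[OF u v]
  show "(\<lambda>x. min (u x) (v x)) \<in> F" unfolding eq by (intro F_diff u pos_part d)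
  show "Q (\<lambda>x. min (u x) (v x)) \<le> 10 * Q u + 8 * Q v"
    unfolding eq using Q_diff_le[OF u pos_part(1)[OF d]] pos_part(2)[OF d] Q_diff_le[OF u v] by linarith
qed

lemma abs_F:
  assumes u: "u \<in> F"
  shows "(\<lambda>x. \<bar>u x\<bar>) \<in> F" "Q (\<lambda>x. \<bar>u x\<bar>) \<le> 18 * Q u"
proof -
  have eq: "(\<lambda>x. \<bar>u x\<bar>) = (\<lambda>x. max (u x) ((-1) * u x))" by auto
  show "(\<lambda>x. \<bar>u x\<bar>) \<in> F" unfolding eq by (intro max_F F_scale u)
  show "Q (\<lambda>x. \<bar>u x\<bar>) \<le> 18 * Q u"
    unfolding eq using max_F(2)[OF u F_scale[OF u, of "-1"]] Q_scale[OF u, of "-1"] by simp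
qed

lemma excess_F:
  assumes u: "u \<in> F" and c: "0 \<le> c"
  shows "(\<lambda>x. max (u x - c) 0) \<in> F" "Q (\<lambda>x. max (u x - c) 0) \<le> 6 * Q u"
proof -
  have "(\<lambda>x. max (u x - c) 0) \<in> F \<and> Q (\<lambda>x. max (u x - c) 0) \<le> 6 * Q u"
  proof (cases "c = 0")
    case True
    then show ?thesis using pos_part[OF u] Q_nonneg[OF u] by simp
  next
    case False
    then have c: "0 < c" using c by simp
    have eq: "(\<lambda>x. max (u x - c) 0) = (\<lambda>x. max (u x) 0 - min (max (u x) 0) c)"
      using c by (auto simp: max_def min_def)
    show ?thesis
      unfolding eq
      using F_diff[OF pos_part(1)[OF u] truncation(1)[OF u c]] pos_part(2)[OF u]
        truncation_Q_le[OF u c] Q_diff_le[OF pos_part(1)[OF u] truncation(1)[OF u c]]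
      by auto
  qed
  then show "(\<lambda>x. max (u x - c) 0) \<in> F" "Q (\<lambda>x. max (u x - c) 0) \<le> 6 * Q u" by auto
qed

end

section \<open>Resolvents\<close>

context closed_form
begin

text \<open>
  The graph of \<open>G\<^sub>\<alpha>\<close>. Stating facts about the graph avoids choosing representatives of the resolvent.
\<close>

definition resolvent :: "real \<Rightarrow> ('a \<Rightarrow> real) \<Rightarrow> ('a \<Rightarrow> real) \<Rightarrow> bool" where
  "resolvent \<alpha> f g \<longleftrightarrow> g \<in> F \<and> (\<forall>u\<in>F. B \<alpha> g u = L2_inner \<mu> f u)"

lemma resolvent_F: "resolvent \<alpha> f g \<Longrightarrow> g \<in> F"
  by (simp add: resolvent_def)

lemma resolvent_eq: "resolvent \<alpha> f g \<Longrightarrow> u \<in> F \<Longrightarrow> B \<alpha> g u = L2_inner \<mu> f u"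
  by (simp add: resolvent_def)

lemma resolvent_lin:
  assumes "resolvent \<alpha> f g" "resolvent \<alpha> f' g'" "f \<in> L2 \<mu>" "f' \<in> L2 \<mu>"
  shows "resolvent \<alpha> (\<lambda>x. a * f x + b * f' x) (\<lambda>x. a * g x + b * g' x)"
  using assms
  by (simp add: resolvent_def F_lin B_lin_left L2_inner_add_left L2_inner_scale_left L2_scale F_L2)

lemma resolvent_diff:
  assumes "resolvent \<alpha> f g" "resolvent \<alpha> f' g'" "f \<in> L2 \<mu>" "f' \<in> L2 \<mu>"
  shows "resolvent \<alpha> (\<lambda>x. f x - f' x) (\<lambda>x. g x - g' x)"
  using resolvent_lin[OF assms, of 1 "-1"] by simp

lemma resolvent_scale: "resolvent \<alpha> f g \<Longrightarrow> f \<in> L2 \<mu> \<Longrightarrow> resolvent \<alpha> (\<lambda>x. c * f x) (\<lambda>x. c * g x)"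
  using resolvent_lin[of \<alpha> f g f g c 0] by simp

lemma resolvent_E:
  "resolvent \<alpha> f g \<Longrightarrow> f \<in> L2 \<mu> \<Longrightarrow> u \<in> F \<Longrightarrow> B 0 g u = L2_inner \<mu> (\<lambda>x. f x - \<alpha> * g x) u"
  using B_shift[of 0 g u \<alpha>]
  by (simp add: resolvent_eq L2_inner_diff_left L2_inner_scale_left L2_scale F_L2 resolvent_F)

lemma resolvent_contraction:
  assumes r: "resolvent \<alpha> f g" and f: "f \<in> L2 \<mu>" and \<alpha>: "0 < \<alpha>"
  shows "L2_inner \<mu> (\<lambda>x. \<alpha> * g x) (\<lambda>x. \<alpha> * g x) \<le> L2_inner \<mu> f f"
proof -
  define p where "p = (\<lambda>x. \<alpha> * g x)"
  note g = resolvent_F[OF r]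
  have p: "p \<in> F" unfolding p_def by (rule F_scale[OF g])
  have "0 \<le> B 0 g p" using E_diag_nonneg[OF g] \<alpha> by (simp add: p_def B_scale_right g)
  also have "\<dots> = L2_inner \<mu> f p - L2_inner \<mu> p p"
    using resolvent_E[OF r f p] f p by (simp add: p_def[symmetric] L2_inner_diff_left F_L2)
  finally show ?thesis
    using L2_inner_le_half_squares[OF f F_L2[OF p]] unfolding p_def[symmetric] by linarith
qed

lemma resolvent_unique:
  assumes "resolvent \<alpha> f g" "resolvent \<alpha> f' g'" "f \<in> L2 \<mu>" "f' \<in> L2 \<mu>" "0 < \<alpha>"
    and ff: "AE x in \<mu>. f x = f' x"
  shows "AE x in \<mu>. g x = g' x"
proof -
  have r: "resolvent \<alpha> (\<lambda>x. f x - f' x) (\<lambda>x. g x - g' x)"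
    by (rule resolvent_diff[OF assms(1-4)])
  have "L2_inner \<mu> (\<lambda>x. f x - f' x) (\<lambda>x. f x - f' x) = L2_inner \<mu> (\<lambda>x. 0) (\<lambda>x. 0)"
    using assms ff by (intro L2_inner_cong_AE L2_measurable L2_diff) (auto intro: L2_measurable[OF F_L2[OF F_zero]] F_L2 F_zero)
  then have "L2_inner \<mu> (\<lambda>x. \<alpha> * (g x - g' x)) (\<lambda>x. \<alpha> * (g x - g' x)) \<le> 0"
    using resolvent_contraction[OF r L2_diff[OF assms(3,4)] \<open>0 < \<alpha>\<close>] by (simp add: L2_inner_def)
  then have "AE x in \<mu>. \<alpha> * (g x - g' x) = 0"
    using assms(1,2) by (intro L2_sq_eq_0_AE L2_scale F_L2 F_diff resolvent_F)
  then show ?thesis using \<open>0 < \<alpha>\<close> by simp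
qed

lemma resolvent_1_bounded:
  assumes r: "resolvent 1 f g" and f: "f \<in> L2 \<mu>"
  shows "Q g \<le> L2_inner \<mu> f f"
proof -
  note g = resolvent_F[OF r]
  have "Q g = L2_inner \<mu> f g" using resolvent_eq[OF r g] .
  then show ?thesis
    using L2_inner_le_half_squares[OF f F_L2[OF g]] L2_sq_le_Q[OF g] by linarith
qed

text \<open>
  For \<open>u \<in> F\<close> the functions \<open>\<beta> G\<^sub>\<beta> u\<close> stay bounded and converge to \<open>u\<close> at rate \<open>1/\<beta>\<close> in \<open>L\<^sup>2\<close>, because
  \<open>E (\<beta> G\<^sub>\<beta> u) v = \<beta> (u - \<beta> G\<^sub>\<beta> u, v)\<close> is tested with \<open>v = \<beta> G\<^sub>\<beta> u\<close> and with \<open>v = u\<close>.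
\<close>

lemma resolvent_approx:
  "\<exists>C\<ge>0. \<forall>\<beta>>0. \<forall>u\<in>F. \<forall>g. resolvent \<beta> u g \<longrightarrow>
     Q (\<lambda>x. \<beta> * g x) \<le> C * Q u \<and>
     \<beta> * L2_inner \<mu> (\<lambda>x. u x - \<beta> * g x) (\<lambda>x. u x - \<beta> * g x) \<le> C * Q u"
proof -
  obtain c where c: "0 \<le> c" "\<And>u v. u \<in> F \<Longrightarrow> v \<in> F \<Longrightarrow> \<bar>B 1 u v\<bar> \<le> Q u / 4 + c * Q v"
    using sector by blast
  have "Q (\<lambda>x. \<beta> * g x) \<le> (2 * c + 4) * Q u \<and>
      \<beta> * L2_inner \<mu> (\<lambda>x. u x - \<beta> * g x) (\<lambda>x. u x - \<beta> * g x) \<le> (2 * c + 4) * Q u"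
    if \<beta>: "0 < \<beta>" and u: "u \<in> F" and r: "resolvent \<beta> u g" for \<beta> u g
  proof -
    define p where "p = (\<lambda>x. \<beta> * g x)"
    define d where "d = (\<lambda>x. u x - p x)"
    note g = resolvent_F[OF r]
    have p: "p \<in> F" unfolding p_def by (rule F_scale[OF g])
    have d: "d \<in> F" unfolding d_def by (rule F_diff[OF u p])
    have Ep: "B 0 p v = \<beta> * L2_inner \<mu> d v" if "v \<in> F" for v
      using resolvent_E[OF r F_L2[OF u] that] that by (simp add: d_def p_def B_scale_left g)
    have "L2_inner \<mu> d u = L2_inner \<mu> d p + L2_inner \<mu> d d"
      using u p d by (simp add: d_def[symmetric] L2_inner_add_right[symmetric] F_L2) (simp add: d_def)
    then have 1: "B 0 p u = B 0 p p + \<beta> * L2_inner \<mu> d d"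
      using Ep[OF u] Ep[OF p] by (simp add: distrib_left)
    have 2: "L2_inner \<mu> p p \<le> L2_inner \<mu> u u"
      using resolvent_contraction[OF r F_L2[OF u] \<beta>] by (simp add: p_def)
    have 3: "B 0 p u = B 1 p u - L2_inner \<mu> p u"
      by (simp add: shifted_form_def)
    have "B 0 p u \<le> Q p / 4 + c * Q u + Q u"
      using 3 c(2)[OF p u] L2_inner_le_half_squares[OF F_L2[OF p] F_L2[OF u]] 2 L2_sq_le_Q[OF u]
      by linarith
    moreover have "Q p = B 0 p p + L2_inner \<mu> p p" by (rule Q_eq)
    moreover have "0 \<le> B 0 p p" by (rule E_diag_nonneg[OF p])
    moreover have "0 \<le> \<beta> * L2_inner \<mu> d d" using \<beta> L2_inner_self_nonneg[of \<mu> d] by simp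
    moreover have "0 \<le> c * Q u" using c(1) Q_nonneg[OF u] by simp
    moreover have "0 \<le> Q u" by (rule Q_nonneg[OF u])
    ultimately have "Q p \<le> 2 * (c * Q u) + 4 * Q u \<and> \<beta> * L2_inner \<mu> d d \<le> 2 * (c * Q u) + 4 * Q u"
      using 1 2 L2_sq_le_Q[OF u] by linarith
    then show ?thesis by (simp add: p_def d_def algebra_simps)
  qed
  then show ?thesis using c(1) by (intro exI[of _ "2 * c + 4"]) auto
qed

end

locale dirichlet_semigroup = dirichlet +
  assumes semigroup: "\<exists>T. form_semigroup \<mu> F E T"
begin

lemma resolvent_exists:
  assumes "0 < \<alpha>" "f \<in> L2 \<mu>"
  obtains g where "resolvent \<alpha> f g"
  using semigroup assms unfolding form_semigroup_def resolvent_def by blast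

lemma resolvent_tendsto:
  assumes f: "f \<in> L2 \<mu>" and g: "\<And>n. resolvent (real (Suc n)) f (g n)"
  shows "(\<lambda>n. L2_inner \<mu> (\<lambda>x. real (Suc n) * g n x - f x) (\<lambda>x. real (Suc n) * g n x - f x)) \<longlonglongrightarrow> 0"
proof (rule LIMSEQ_I)
  fix \<epsilon> :: real assume \<epsilon>: "0 < \<epsilon>"
  obtain C where C: "0 \<le> C" "\<And>\<beta> u g. 0 < \<beta> \<Longrightarrow> u \<in> F \<Longrightarrow> resolvent \<beta> u g \<Longrightarrow>
     \<beta> * L2_inner \<mu> (\<lambda>x. u x - \<beta> * g x) (\<lambda>x. u x - \<beta> * g x) \<le> C * Q u"
    using resolvent_approx by blast
  have "\<exists>u\<in>F. (\<integral>x. (f x - u x)\<^sup>2 \<partial>\<mu>) < \<epsilon> / 16"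
    using coercive_closed f \<epsilon> unfolding coercive_closed_form_def by (meson zero_less_divide_iff zero_less_numeral)
  then obtain u where u: "u \<in> F" "L2_inner \<mu> (\<lambda>x. f x - u x) (\<lambda>x. f x - u x) < \<epsilon> / 16"
    by (auto simp: L2_inner_def power2_eq_square)
  obtain N where N: "16 * (C * Q u) / \<epsilon> < real N" using reals_Archimedean2 by blast
  have "L2_inner \<mu> (\<lambda>x. real (Suc n) * g n x - f x) (\<lambda>x. real (Suc n) * g n x - f x) < \<epsilon>" if n: "n \<ge> N" for n
  proof -
    define \<beta> where "\<beta> = real (Suc n)"
    have \<beta>: "0 < \<beta>" by (simp add: \<beta>_def)
    obtain k where k: "resolvent \<beta> u k" using resolvent_exists[OF \<beta> F_L2[OF u(1)]] .
    define a where "a = (\<lambda>x. \<beta> * (g n x - k x))"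
    define b where "b = (\<lambda>x. \<beta> * k x - u x)"
    define e where "e = (\<lambda>x. u x - f x)"
    have aL: "a \<in> L2 \<mu>" and bL: "b \<in> L2 \<mu>" and eL: "e \<in> L2 \<mu>"
      using F_L2[OF resolvent_F[OF g[of n]]] F_L2[OF resolvent_F[OF k]] F_L2[OF u(1)] f
      by (auto simp: a_def b_def e_def intro!: L2_scale L2_diff)
    have e: "L2_inner \<mu> e e < \<epsilon> / 16"
      using u(2) by (simp add: e_def L2_inner_def algebra_simps)
    have "L2_inner \<mu> a a \<le> L2_inner \<mu> (\<lambda>x. f x - u x) (\<lambda>x. f x - u x)"
      using resolvent_contraction[OF resolvent_diff[OF g[of n, folded \<beta>_def] k f F_L2[OF u(1)]]] \<beta> f u(1)
      by (simp add: a_def L2_diff F_L2)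
    then have a: "L2_inner \<mu> a a < \<epsilon> / 16" using u(2) by simp
    have "16 * (C * Q u) / \<epsilon> < \<beta>" using N n by (simp add: \<beta>_def)
    then have "C * Q u < \<beta> * (\<epsilon> / 16)" using \<epsilon> by (simp add: field_simps)
    moreover have "\<beta> * L2_inner \<mu> b b \<le> C * Q u"
      using C(2)[OF \<beta> u(1) k] by (simp add: b_def L2_inner_def algebra_simps)
    ultimately have "\<beta> * L2_inner \<mu> b b < \<beta> * (\<epsilon> / 16)" by simp
    then have b: "L2_inner \<mu> b b < \<epsilon> / 16" using \<beta> by simp
    have "L2_inner \<mu> (\<lambda>x. (a x + b x) + e x) (\<lambda>x. (a x + b x) + e x) < \<epsilon>"
      using L2_sq_add_le[OF L2_add[OF aL bL] eL] L2_sq_add_le[OF aL bL] a b e \<epsilon> by linarith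
    then show ?thesis by (simp add: a_def b_def e_def \<beta>_def algebra_simps)
  qed
  then show "\<exists>N. \<forall>n\<ge>N. norm (L2_inner \<mu> (\<lambda>x. real (Suc n) * g n x - f x) (\<lambda>x. real (Suc n) * g n x - f x) - 0) < \<epsilon>"
    by (intro exI[of _ N]) (simp only: diff_0_right real_norm_def abs_of_nonneg[OF L2_inner_self_nonneg], blast)
qed

end

context closed_form
begin

lemma B_continuous_left:
  assumes v: "v \<in> F" and \<epsilon>: "0 < \<epsilon>"
  shows "\<exists>\<delta>>0. \<forall>d\<in>F. Q d < \<delta> \<longrightarrow> \<bar>B 0 d v\<bar> < \<epsilon>"
proof -
  obtain c where c: "0 \<le> c" "\<And>u v. u \<in> F \<Longrightarrow> v \<in> F \<Longrightarrow> \<bar>B 1 u v\<bar> \<le> Q u / 4 + c * Q v"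
    using sector by blast
  define k where "k = (c + 1) * (Q v + 1)"
  have k: "0 < k" using c(1) Q_nonneg[OF v] by (simp add: k_def)
  define s where "s = \<epsilon> / (2 * k)"
  have s: "0 < s" using \<epsilon> k by (simp add: s_def)
  have "\<bar>B 0 d v\<bar> < \<epsilon>" if d: "d \<in> F" "Q d < s * (\<epsilon> / 2)" for d
  proof -
    have sv: "(\<lambda>x. s * v x) \<in> F" by (rule F_scale[OF v])
    have "s * \<bar>B 0 d v\<bar> = \<bar>B 0 d (\<lambda>x. s * v x)\<bar>"
      using s by (simp add: B_scale_right[OF v d(1)] abs_mult)
    also have "\<dots> = \<bar>B 1 d (\<lambda>x. s * v x) - L2_inner \<mu> d (\<lambda>x. s * v x)\<bar>"
      by (simp add: shifted_form_def)
    also have "\<dots> \<le> Q d + c * (s\<^sup>2 * Q v) + s\<^sup>2 * Q v"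
      using c(2)[OF d(1) sv] L2_inner_le_half_squares[OF F_L2[OF d(1)] F_L2[OF sv]]
        L2_sq_le_Q[OF d(1)] L2_sq_le_Q[OF sv] Q_nonneg[OF d(1)] Q_nonneg[OF sv]
      by (simp add: Q_scale v)
    also have "\<dots> = Q d + s\<^sup>2 * ((c + 1) * Q v)" by (simp add: algebra_simps)
    also have "\<dots> \<le> Q d + s\<^sup>2 * k"
      using c(1) by (simp add: k_def algebra_simps)
    also have "s\<^sup>2 * k = s * (\<epsilon> / 2)" using k by (simp add: s_def power2_eq_square)
    also have "Q d + s * (\<epsilon> / 2) < s * \<epsilon>" using d(2) by simp
    finally show ?thesis using s by simp
  qed
  then show ?thesis using s \<epsilon> by (intro exI[of _ "s * (\<epsilon> / 2)"]) auto
qed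

end

context dirichlet
begin

lemma truncation_pairing:
  assumes u: "u \<in> F" and c: "0 < c"
  defines "w \<equiv> \<lambda>x. min (max (u x) 0) c"
  shows "0 \<le> B 0 u (\<lambda>x. u x - w x)"
proof -
  have w: "w \<in> F" and ge: "0 \<le> B 0 (\<lambda>x. u x + w x) (\<lambda>x. u x - w x)"
    using truncation[OF u c] by (simp_all add: w_def)
  note d = F_diff[OF u w]
  have "B 0 (\<lambda>x. u x + w x) (\<lambda>x. u x - w x) + B 0 (\<lambda>x. u x - w x) (\<lambda>x. u x - w x)
      = 2 * B 0 u (\<lambda>x. u x - w x)"
    using u w d by (simp add: B_bilinear(1,2))
  then show ?thesis using ge E_diag_nonneg[OF d] by linarith
qed

text \<open>
  Test the equation for \<open>g\<close> with \<open>g - min g\<^sup>+ n\<close>, where the energy is nonnegative by the Markovian property, and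
  let \<open>n \<rightarrow> \<infinity>\<close>: what remains is \<open>(f - \<alpha> g, - g\<^sup>-) \<ge> 0\<close>, which forces \<open>g\<^sup>- = 0\<close>.
\<close>

lemma resolvent_pos:
  assumes r: "resolvent \<alpha> f g" and f: "f \<in> L2 \<mu>" and \<alpha>: "0 < \<alpha>" and nn: "AE x in \<mu>. 0 \<le> f x"
  shows "AE x in \<mu>. 0 \<le> g x"
proof -
  note g = resolvent_F[OF r]
  define w where "w n x = min (max (g x) 0) (real (Suc n))" for n x
  define p where "p x = max (g x) 0" for x
  define k where "k x = f x - \<alpha> * g x" for x
  have wF: "w n \<in> F" for n using truncation(1)[OF g] by (simp add: w_def[abs_def])
  have kL: "k \<in> L2 \<mu>" using f g by (simp add: k_def[abs_def] L2_diff L2_scale F_L2)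
  have pF: "p \<in> F" using pos_part[OF g] by (simp add: p_def[abs_def])
  note [measurable] = F_measurable[OF g] F_measurable[OF pF] F_measurable[OF wF] L2_measurable[OF kL]
  have "(\<lambda>n. \<integral>x. k x * (g x - w n x) \<partial>\<mu>) \<longlonglongrightarrow> (\<integral>x. k x * (g x - p x) \<partial>\<mu>)"
  proof (rule integral_dominated_convergence[where w="\<lambda>x. \<bar>k x * g x\<bar>"])
    show "integrable \<mu> (\<lambda>x. \<bar>k x * g x\<bar>)" using L2_mult_integrable[OF kL F_L2[OF g]] by simp
    have "(\<lambda>n. k x * (g x - w n x)) \<longlonglongrightarrow> k x * (g x - p x)" for x
    proof (rule tendsto_eventually)
      obtain N where "max (g x) 0 < real N" using reals_Archimedean2 by blast
      then show "\<forall>\<^sub>F n in sequentially. k x * (g x - w n x) = k x * (g x - p x)"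
        by (intro eventually_sequentiallyI[of N]) (auto simp: w_def p_def)
    qed
    then show "AE x in \<mu>. (\<lambda>n. k x * (g x - w n x)) \<longlonglongrightarrow> k x * (g x - p x)" by simp
    have "\<bar>k x * (g x - w n x)\<bar> \<le> \<bar>k x * g x\<bar>" for n x
      unfolding abs_mult by (intro mult_left_mono) (auto simp: w_def)
    then show "AE x in \<mu>. norm (k x * (g x - w n x)) \<le> \<bar>k x * g x\<bar>" for n by simp
  qed measurable
  moreover have "0 \<le> (\<integral>x. k x * (g x - w n x) \<partial>\<mu>)" for n
    using truncation_pairing[OF g, of "real (Suc n)"] resolvent_E[OF r f F_diff[OF g wF], of n]
    by (simp add: w_def k_def L2_inner_def)
  ultimately have "0 \<le> (\<integral>x. k x * (g x - p x) \<partial>\<mu>)"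
    by (intro LIMSEQ_le_const) auto
  then have "0 \<le> L2_inner \<mu> k (\<lambda>x. g x - p x)" by (simp add: L2_inner_def)
  also have "\<dots> \<le> L2_inner \<mu> (\<lambda>x. (- \<alpha>) * (g x - p x)) (\<lambda>x. g x - p x)"
  proof (rule L2_inner_mono)
    show "AE x in \<mu>. k x * (g x - p x) \<le> - \<alpha> * (g x - p x) * (g x - p x)"
      using nn
    proof eventually_elim
      case (elim x)
      then have 1: "f x * (g x - p x) \<le> 0" by (intro mult_nonneg_nonpos) (auto simp: p_def)
      have 2: "g x * (g x - p x) = (g x - p x) * (g x - p x)" by (auto simp: p_def max_def)
      have 3: "k x * (g x - p x) = f x * (g x - p x) - \<alpha> * (g x * (g x - p x))"
        by (simp add: k_def algebra_simps)
      show ?case unfolding 3 2 using 1 by (simp add: mult.assoc)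
    qed
  qed (intro kL L2_scale L2_diff F_L2 g pF)+
  also have "\<dots> = - \<alpha> * L2_inner \<mu> (\<lambda>x. g x - p x) (\<lambda>x. g x - p x)" by (rule L2_inner_scale_left)
  finally have "L2_inner \<mu> (\<lambda>x. g x - p x) (\<lambda>x. g x - p x) \<le> 0"
    using \<alpha> by (simp add: mult_le_0_iff)
  then have "AE x in \<mu>. g x - p x = 0"
    using g pF by (intro L2_sq_eq_0_AE L2_diff F_L2)
  then show ?thesis by eventually_elim (auto simp: p_def)
qed

lemma resolvent_mono:
  assumes "resolvent \<alpha> f g" "resolvent \<alpha> f' g'" "f \<in> L2 \<mu>" "f' \<in> L2 \<mu>" "0 < \<alpha>"
    and "AE x in \<mu>. f x \<le> f' x"
  shows "AE x in \<mu>. g x \<le> g' x"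
  using resolvent_pos[OF resolvent_diff[OF assms(2,1,4,3)] L2_diff[OF assms(4,3)] assms(5)] assms(6)
  by simp

text \<open>The same test with the truncation at the level \<open>1\<close> shows that \<open>g\<close> equals its truncation.\<close>

lemma resolvent_1_le_1:
  assumes r: "resolvent 1 f g" and f: "f \<in> L2 \<mu>" and bd: "AE x in \<mu>. 0 \<le> f x \<and> f x \<le> 1"
  shows "AE x in \<mu>. g x \<le> 1"
proof -
  note g = resolvent_F[OF r]
  define w where "w x = min (max (g x) 0) 1" for x
  have wF: "w \<in> F" using truncation(1)[OF g, of 1] by (simp add: w_def[abs_def])
  note d = F_diff[OF g wF]
  have "0 \<le> B 0 g (\<lambda>x. g x - w x)"
    using truncation_pairing[OF g, of 1] by (simp add: w_def)
  also have "\<dots> = L2_inner \<mu> (\<lambda>x. f x - 1 * g x) (\<lambda>x. g x - w x)"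
    by (rule resolvent_E[OF r f d])
  also have "\<dots> \<le> L2_inner \<mu> (\<lambda>x. (- 1) * (g x - w x)) (\<lambda>x. g x - w x)"
  proof (rule L2_inner_mono)
    show "AE x in \<mu>. (f x - 1 * g x) * (g x - w x) \<le> - 1 * (g x - w x) * (g x - w x)"
      using bd
    proof eventually_elim
      case (elim x)
      have "(f x - w x) * (g x - w x) \<le> 0"
      proof (cases "g x \<le> w x")
        case True
        then have "g x < 0 \<or> g x = w x" by (auto simp: w_def min_def max_def split: if_splits)
        then show ?thesis using elim True by (auto simp: w_def mult_nonneg_nonpos)
      next
        case False
        then have "w x = 1" by (auto simp: w_def min_def max_def split: if_splits)
        then show ?thesis using elim False by (auto intro!: mult_nonpos_nonneg)
      qed
      then show ?case by (simp add: algebra_simps)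
    qed
  qed (use f F_L2[OF g] F_L2[OF wF] in \<open>simp_all add: L2_diff L2_scale\<close>)
  also have "\<dots> = - L2_inner \<mu> (\<lambda>x. g x - w x) (\<lambda>x. g x - w x)"
    by (simp only: L2_inner_scale_left)
  finally have "AE x in \<mu>. g x - w x = 0"
    by (intro L2_sq_eq_0_AE F_L2 d) simp
  then show ?thesis by eventually_elim (auto simp: w_def)
qed

end

context dirichlet_semigroup
begin

text \<open>
  Functions with disjoint supports have nonpositive energy: for \<open>\<beta> G\<^sub>\<beta> u\<close> in place of \<open>u\<close> this is
  positivity of the resolvent. As \<open>{w. E w v \<le> 0}\<close> is convex, the bounded \<open>L\<^sup>2\<close>-approximation by \<open>\<beta> G\<^sub>\<beta> u\<close>
  improves to one in energy that stays in this set.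
\<close>

lemma disjoint_energy_nonpos:
  assumes u: "u \<in> F" and v: "v \<in> F" and nn: "AE x in \<mu>. 0 \<le> u x" "AE x in \<mu>. 0 \<le> v x"
    and disj: "AE x in \<mu>. u x * v x = 0"
  shows "B 0 u v \<le> 0"
proof -
  define D where "D = {w \<in> F. B 0 w v \<le> 0}"
  obtain C where C: "0 \<le> C" "\<And>\<beta> u g. 0 < \<beta> \<Longrightarrow> u \<in> F \<Longrightarrow> resolvent \<beta> u g \<Longrightarrow> Q (\<lambda>x. \<beta> * g x) \<le> C * Q u"
    using resolvent_approx by blast
  have "\<exists>g. resolvent (real (Suc n)) u g" for n
    using resolvent_exists[of "real (Suc n)" u] F_L2[OF u] by auto
  then obtain g where g: "\<And>n. resolvent (real (Suc n)) u (g n)" by metis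
  define w where "w n x = real (Suc n) * g n x" for n x
  have wF: "w n \<in> F" for n
    unfolding w_def[abs_def] by (intro F_scale resolvent_F[OF g])
  have wD: "w n \<in> D" for n
  proof -
    have "0 \<le> L2_inner \<mu> (w n) v"
    proof (rule L2_inner_nonneg)
      show "AE x in \<mu>. 0 \<le> w n x * v x"
        using nn(2) resolvent_pos[OF g[of n] F_L2[OF u] _ nn(1)] by (auto simp: w_def)
    qed
    moreover have "L2_inner \<mu> u v = 0"
      unfolding L2_inner_def using integral_cong_AE[of "\<lambda>x. u x * v x" \<mu> "\<lambda>x. 0"] disj F_measurable[OF u] F_measurable[OF v]
      by simp
    moreover have "B 0 (w n) v = real (Suc n) * B 0 (g n) v"
      unfolding w_def[abs_def] by (rule B_scale_left[OF resolvent_F[OF g] v])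
    moreover have "B 0 (g n) v = L2_inner \<mu> u v - L2_inner \<mu> (w n) v"
      using resolvent_E[OF g F_L2[OF u] v, of n] u v wF[of n]
      by (simp add: w_def[abs_def] L2_inner_diff_left F_L2)
    ultimately have "B 0 (w n) v \<le> 0" by (simp add: mult_nonneg_nonpos)
    then show ?thesis using wF by (simp add: D_def)
  qed
  have lim: "(\<lambda>n. L2_inner \<mu> (\<lambda>x. w n x - u x) (\<lambda>x. w n x - u x)) \<longlonglongrightarrow> 0"
    using resolvent_tendsto[OF F_L2[OF u] g] by (simp add: w_def)
  have "u \<in> F \<and> (\<forall>\<epsilon>>0. \<exists>w\<in>D. Q (\<lambda>x. u x - w x) < \<epsilon>) \<and> Q u \<le> 2 * (C * Q u)"
  proof (rule L2_approx_imp_Q_approx)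
    show "D \<subseteq> F" by (auto simp: D_def)
    show "(\<lambda>x. 1/2 * v x + 1/2 * w x) \<in> D" if "v \<in> D" "w \<in> D" for v w
      using that v B_lin_left[of v w _ 0 "1/2" "1/2"] F_lin[of v w "1/2" "1/2"] by (simp add: D_def)
    show "u \<in> L2 \<mu>" by (rule F_L2[OF u])
    fix \<epsilon> :: real assume "0 < \<epsilon>"
    then obtain N where N: "L2_inner \<mu> (\<lambda>x. w N x - u x) (\<lambda>x. w N x - u x) < \<epsilon>"
      using order_tendstoD(2)[OF lim] by (auto simp: eventually_sequentially)
    have "Q (w N) \<le> C * Q u"
      using C(2)[OF _ u g, of N] by (simp add: w_def[abs_def])
    then show "\<exists>w\<in>D. L2_inner \<mu> (\<lambda>x. w x - u x) (\<lambda>x. w x - u x) \<le> \<epsilon> \<and> Q w \<le> C * Q u"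
      using N wD[of N] by (intro bexI[of _ "w N"]) auto
  qed
  then have approx: "\<And>\<epsilon>. 0 < \<epsilon> \<Longrightarrow> \<exists>w\<in>D. Q (\<lambda>x. u x - w x) < \<epsilon>" by blast
  show ?thesis
  proof (rule field_le_epsilon)
    fix \<epsilon> :: real assume \<epsilon>: "0 < \<epsilon>"
    obtain \<delta> where \<delta>: "0 < \<delta>" "\<And>d. d \<in> F \<Longrightarrow> Q d < \<delta> \<Longrightarrow> \<bar>B 0 d v\<bar> < \<epsilon>"
      using B_continuous_left[OF v \<epsilon>] by blast
    obtain w where w: "w \<in> F" "B 0 w v \<le> 0" "Q (\<lambda>x. u x - w x) < \<delta>"
      using approx[OF \<delta>(1)] by (auto simp: D_def)
    then show "B 0 u v \<le> 0 + \<epsilon>"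
      using \<delta>(2)[OF F_diff[OF u w(1)]] B_bilinear(2)[OF u w(1) v, of 0] by simp
  qed
qed

end

section \<open>Potentials\<close>

context dirichlet_semigroup
begin

text \<open>
  Cutting off at a 1-potential \<open>h\<close> does not increase the energy by more than a constant factor, since
  \<open>E\<^sub>1 (min u h) (u - min u h) \<ge> 0\<close>.
\<close>

lemma min_potential:
  "\<exists>C\<ge>0. \<forall>f h u. f \<in> L2 \<mu> \<longrightarrow> (AE x in \<mu>. 0 \<le> f x) \<longrightarrow> resolvent 1 f h \<longrightarrow> u \<in> F \<longrightarrow>
     Q (\<lambda>x. min (u x) (h x)) \<le> C * Q u"
proof -
  obtain c where c: "0 \<le> c" "\<And>u v. u \<in> F \<Longrightarrow> v \<in> F \<Longrightarrow> \<bar>B 1 u v\<bar> \<le> Q u / 4 + c * Q v"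
    using sector by blast
  have "Q (\<lambda>x. min (u x) (h x)) \<le> 2 * c * Q u"
    if f: "f \<in> L2 \<mu>" "AE x in \<mu>. 0 \<le> f x" and r: "resolvent 1 f h" and u: "u \<in> F" for f h u
  proof -
    note h = resolvent_F[OF r]
    define w where "w = (\<lambda>x. min (u x) (h x))"
    define p where "p = (\<lambda>x. max (u x - h x) 0)"
    define q where "q = (\<lambda>x. max (h x - u x) 0)"
    have F: "w \<in> F" "p \<in> F" "q \<in> F"
      unfolding w_def p_def q_def using u h by (auto intro!: min_F pos_part F_diff)
    have w1: "w = (\<lambda>x. h x - q x)" and w2: "w = (\<lambda>x. u x - p x)"
      by (auto simp: w_def p_def q_def)
    have "B 0 q p \<le> 0"
      by (rule disjoint_energy_nonpos[OF F(3,2)]) (auto simp: p_def q_def max_def)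
    moreover have "L2_inner \<mu> q p = 0"
    proof -
      have "(\<lambda>x. q x * p x) = (\<lambda>x. 0)" by (auto simp: p_def q_def max_def)
      then show ?thesis by (simp only: L2_inner_def) simp
    qed
    ultimately have "B 1 q p \<le> 0" by (simp add: shifted_form_def)
    moreover have "0 \<le> B 1 h p"
      unfolding resolvent_eq[OF r F(2)] using f(2) by (intro L2_inner_nonneg) (auto simp: p_def)
    moreover have "B 1 w p = B 1 h p - B 1 q p"
      unfolding w1 by (rule B_bilinear(2)[OF h F(3,2)])
    moreover have "Q w = B 1 w u - B 1 w p"
      using B_bilinear(4)[OF u F(2,1), of 1] by (simp add: w2)
    moreover have "0 \<le> c * Q u" using c(1) Q_nonneg[OF u] by simp
    ultimately have "Q w \<le> 2 * (c * Q u)"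
      using c(2)[OF F(1) u] by linarith
    then show ?thesis by (simp add: w_def mult.assoc)
  qed
  then show ?thesis using c(1) by (intro exI[of _ "2 * c"]) auto
qed

end

text \<open>The 1-potential \<open>h\<close> of a strictly positive function serves as the reference for capacities.\<close>

locale reference = dirichlet_semigroup +
  fixes \<phi> h :: "'a \<Rightarrow> real"
  assumes \<phi>_L2: "\<phi> \<in> L2 \<mu>" and \<phi>_pos: "AE x in \<mu>. 0 < \<phi> x" and \<phi>_le_1: "AE x in \<mu>. \<phi> x \<le> 1"
    and resolvent_h: "resolvent 1 \<phi> h"
begin

lemma \<phi>_nonneg: "AE x in \<mu>. 0 \<le> \<phi> x"
  using \<phi>_pos by eventually_elim simp

lemma h_F: "h \<in> F"
  by (rule resolvent_F[OF resolvent_h])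

lemma h_nonneg: "AE x in \<mu>. 0 \<le> h x"
  by (rule resolvent_pos[OF resolvent_h \<phi>_L2 _ \<phi>_nonneg]) simp

lemma h_le_1: "AE x in \<mu>. h x \<le> 1"
  using \<phi>_nonneg \<phi>_le_1 by (intro resolvent_1_le_1[OF resolvent_h \<phi>_L2]) auto

text \<open>
  Potentials of functions that are dominated by a multiple of \<open>\<phi>\<close> are dense in \<open>F\<close>: they contain
  \<open>Q\<close>-bounded approximations in \<open>L\<^sup>2\<close> of \<open>\<beta> G\<^sub>\<beta> u = G\<^sub>1 (\<beta> u - (\<beta> - 1) \<beta> G\<^sub>\<beta> u)\<close>.
\<close>

lemma bounded_potentials_dense:
  assumes u: "u \<in> F" and \<epsilon>: "0 < \<epsilon>"
  shows "\<exists>f g c. 0 \<le> c \<and> f \<in> L2 \<mu> \<and> (AE x in \<mu>. \<bar>f x\<bar> \<le> c * \<phi> x) \<and> resolvent 1 f g \<and> Q (\<lambda>x. u x - g x) < \<epsilon>"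
proof -
  define D where
    "D = {g. \<exists>f c. 0 \<le> c \<and> f \<in> L2 \<mu> \<and> (AE x in \<mu>. \<bar>f x\<bar> \<le> c * \<phi> x) \<and> resolvent 1 f g}"
  obtain C where C: "0 \<le> C" "\<And>\<beta> u g. 0 < \<beta> \<Longrightarrow> u \<in> F \<Longrightarrow> resolvent \<beta> u g \<Longrightarrow> Q (\<lambda>x. \<beta> * g x) \<le> C * Q u"
    using resolvent_approx by blast
  have "\<exists>g. resolvent (real (Suc n)) u g" for n
    using resolvent_exists[of "real (Suc n)" u] F_L2[OF u] by auto
  then obtain g where g: "\<And>n. resolvent (real (Suc n)) u (g n)" by metis
  define w where "w n x = real (Suc n) * g n x" for n x
  have wF: "w n \<in> F" for n
    unfolding w_def[abs_def] by (intro F_scale resolvent_F[OF g])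
  have lim: "(\<lambda>n. L2_inner \<mu> (\<lambda>x. w n x - u x) (\<lambda>x. w n x - u x)) \<longlonglongrightarrow> 0"
    using resolvent_tendsto[OF F_L2[OF u] g] by (simp add: w_def)
  have "u \<in> F \<and> (\<forall>\<epsilon>>0. \<exists>w\<in>D. Q (\<lambda>x. u x - w x) < \<epsilon>) \<and> Q u \<le> 2 * (2 + 2 * (C * Q u))"
  proof (rule L2_approx_imp_Q_approx)
    show "D \<subseteq> F" by (auto simp: D_def resolvent_F)
    show "u \<in> L2 \<mu>" by (rule F_L2[OF u])
    show "(\<lambda>x. 1/2 * v x + 1/2 * w x) \<in> D" if vw: "v \<in> D" "w \<in> D" for v w
    proof -
      obtain f c f' c' where
        f: "0 \<le> c" "f \<in> L2 \<mu>" "AE x in \<mu>. \<bar>f x\<bar> \<le> c * \<phi> x" "resolvent 1 f v" and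
        f': "0 \<le> c'" "f' \<in> L2 \<mu>" "AE x in \<mu>. \<bar>f' x\<bar> \<le> c' * \<phi> x" "resolvent 1 f' w"
        using vw by (auto simp: D_def)
      have "AE x in \<mu>. \<bar>1/2 * f x + 1/2 * f' x\<bar> \<le> (c + c') * \<phi> x"
        using f(3) f'(3) by eventually_elim (auto simp: algebra_simps)
      then show ?thesis
        unfolding D_def using f f' resolvent_lin[OF f(4) f'(4) f(2) f'(2), of "1/2" "1/2"]
          L2_lin[OF f(2) f'(2), of "1/2" "1/2"]
        by (intro CollectI exI[of _ "\<lambda>x. 1/2 * f x + 1/2 * f' x"] exI[of _ "c + c'"]) auto
    qed
    fix \<epsilon> :: real assume \<epsilon>: "0 < \<epsilon>"
    then obtain n where n: "L2_inner \<mu> (\<lambda>x. w n x - u x) (\<lambda>x. w n x - u x) < \<epsilon> / 4"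
      using order_tendstoD(2)[OF lim, of "\<epsilon> / 4"] by (auto simp: eventually_sequentially)
    define \<beta> where "\<beta> = real (Suc n)"
    define f where "f x = \<beta> * u x - (\<beta> - 1) * w n x" for x
    have fL: "f \<in> L2 \<mu>" unfolding f_def[abs_def]
      by (intro L2_diff L2_scale F_L2 u wF)
    have rf: "resolvent 1 f (w n)"
      unfolding resolvent_def
    proof (intro conjI ballI wF)
      fix v assume v: "v \<in> F"
      have "B 1 (w n) v = \<beta> * B \<beta> (g n) v + (1 - \<beta>) * L2_inner \<mu> (w n) v"
        using B_shift[of 1 "w n" v \<beta>] B_scale_left[OF resolvent_F[OF g] v, of \<beta> \<beta> n]
        by (simp add: w_def[abs_def] \<beta>_def)
      also have "\<dots> = L2_inner \<mu> f v"
        unfolding f_def[abs_def]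
          L2_inner_diff_left[OF L2_scale[OF F_L2[OF u]] L2_scale[OF F_L2[OF wF]] F_L2[OF v]] L2_inner_scale_left
        using resolvent_eq[OF g[of n] v] by (simp add: \<beta>_def algebra_simps)
      finally show "B 1 (w n) v = L2_inner \<mu> f v" .
    qed
    define t where "t k x = max (- (real k * \<phi> x)) (min (f x) (real k * \<phi> x))" for k x
    note [measurable] = L2_measurable[OF fL] L2_measurable[OF \<phi>_L2]
    have t_meas: "t k \<in> borel_measurable \<mu>" for k unfolding t_def[abs_def] by measurable
    have t_bd: "AE x in \<mu>. \<bar>t k x\<bar> \<le> real k * \<phi> x \<and> \<bar>t k x\<bar> \<le> \<bar>f x\<bar> \<and> \<bar>t k x - f x\<bar> \<le> \<bar>f x\<bar>" for k
      using \<phi>_pos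
    proof eventually_elim
      case (elim x)
      then have "0 \<le> real k * \<phi> x" by simp
      then show ?case by (auto simp: t_def)
    qed
    have tL: "t k \<in> L2 \<mu>" for k
      using t_bd[of k] by (intro L2_dominated[OF t_meas fL]) auto
    have "(\<lambda>k. L2_inner \<mu> (\<lambda>x. t k x - f x) (\<lambda>x. t k x - f x)) \<longlonglongrightarrow> 0"
    proof (rule L2_dominated_convergence[where g=f])
      show "AE x in \<mu>. (\<lambda>k. t k x) \<longlonglongrightarrow> f x"
        using \<phi>_pos
      proof eventually_elim
        case (elim x)
        obtain N where N: "\<bar>f x\<bar> / \<phi> x < real N" using reals_Archimedean2 by blast
        show ?case
        proof (rule tendsto_eventually, rule eventually_sequentiallyI)
          fix k assume "N \<le> k"
          then have "\<bar>f x\<bar> / \<phi> x < real k" using N by linarith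
          then have "\<bar>f x\<bar> < real k * \<phi> x" using elim by (simp add: field_simps)
          then show "t k x = f x" by (auto simp: t_def)
        qed
      qed
      show "AE x in \<mu>. \<bar>t k x - f x\<bar> \<le> \<bar>f x\<bar>" for k using t_bd[of k] by eventually_elim simp
    qed (use fL t_meas L2_measurable in auto)
    then have "\<forall>\<^sub>F k in sequentially. L2_inner \<mu> (\<lambda>x. t k x - f x) (\<lambda>x. t k x - f x) < min 1 (\<epsilon> / 4)"
      using \<epsilon> by (intro order_tendstoD(2)) auto
    then obtain k where k: "L2_inner \<mu> (\<lambda>x. t k x - f x) (\<lambda>x. t k x - f x) < min 1 (\<epsilon> / 4)"
      by (auto simp: eventually_sequentially)
    obtain v where v: "resolvent 1 (t k) v" using resolvent_exists[OF _ tL, of 1 k] by auto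
    note vF = resolvent_F[OF v]
    have vw: "Q (\<lambda>x. v x - w n x) < min 1 (\<epsilon> / 4)"
      using resolvent_1_bounded[OF resolvent_diff[OF v rf tL fL] L2_diff[OF tL fL]] k by linarith
    have "L2_inner \<mu> (\<lambda>x. v x - u x) (\<lambda>x. v x - u x) \<le> \<epsilon>"
      using L2_sq_add_le[OF F_L2[OF F_diff[OF vF wF]] F_L2[OF F_diff[OF wF u]], of n n]
        L2_sq_le_Q[OF F_diff[OF vF wF], of n] vw n by simp
    moreover have "Q v \<le> 2 + 2 * (C * Q u)"
      using Q_add_le[OF F_diff[OF vF wF[of n]] wF[of n]] vw C(2)[OF _ u g, of n] by (simp add: w_def[abs_def])
    moreover have "v \<in> D"
      unfolding D_def using v tL[of k] t_bd[of k] by (auto intro!: exI[of _ "t k"] exI[of _ "real k"])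
    ultimately show "\<exists>w\<in>D. L2_inner \<mu> (\<lambda>x. w x - u x) (\<lambda>x. w x - u x) \<le> \<epsilon> \<and> Q w \<le> 2 + 2 * (C * Q u)"
      by blast
  qed
  then show ?thesis using \<epsilon> unfolding D_def by blast
qed

section \<open>Capacity\<close>

text \<open>
  \<open>thick A \<epsilon>\<close> says that the complement of \<open>A\<close> has small capacity: \<open>h - g\<close> is a competitor in the
  variational problem for the \<open>h\<close>-capacity of the complement.
\<close>

definition thick :: "'a set \<Rightarrow> real \<Rightarrow> bool" where
  "thick A \<epsilon> \<longleftrightarrow> (\<exists>g\<in>F. (AE x in \<mu>. 0 \<le> g x \<and> g x \<le> h x) \<and> (AE x in \<mu>. x \<notin> A \<longrightarrow> g x = 0) \<and>
     Q (\<lambda>x. h x - g x) \<le> \<epsilon>)"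

lemma thick_mono: "thick A \<epsilon> \<Longrightarrow> A \<subseteq> A' \<Longrightarrow> \<epsilon> \<le> \<epsilon>' \<Longrightarrow> thick A' \<epsilon>'"
  unfolding thick_def by (elim bexE conjE, intro bexI conjI) (auto elim: eventually_mono)

lemma thick_Int:
  assumes "thick A \<epsilon>" "thick A' \<epsilon>"
  shows "thick (A \<inter> A') (18 * \<epsilon>)"
proof -
  obtain g where g: "g \<in> F" "AE x in \<mu>. 0 \<le> g x \<and> g x \<le> h x" "AE x in \<mu>. x \<notin> A \<longrightarrow> g x = 0"
    "Q (\<lambda>x. h x - g x) \<le> \<epsilon>" using assms(1) by (auto simp: thick_def)
  obtain g' where g': "g' \<in> F" "AE x in \<mu>. 0 \<le> g' x \<and> g' x \<le> h x" "AE x in \<mu>. x \<notin> A' \<longrightarrow> g' x = 0"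
    "Q (\<lambda>x. h x - g' x) \<le> \<epsilon>" using assms(2) by (auto simp: thick_def)
  have eq: "(\<lambda>x. h x - min (g x) (g' x)) = (\<lambda>x. max (h x - g x) (h x - g' x))" by auto
  show ?thesis unfolding thick_def
  proof (intro bexI[of _ "\<lambda>x. min (g x) (g' x)"] conjI)
    show "(\<lambda>x. min (g x) (g' x)) \<in> F" using g g' by (intro min_F)
    show "AE x in \<mu>. 0 \<le> min (g x) (g' x) \<and> min (g x) (g' x) \<le> h x"
      using g(2) g'(2) by eventually_elim auto
    show "AE x in \<mu>. x \<notin> A \<inter> A' \<longrightarrow> min (g x) (g' x) = 0"
      using g(2,3) g'(2,3) by eventually_elim (auto simp: min_def)
    show "Q (\<lambda>x. h x - min (g x) (g' x)) \<le> 18 * \<epsilon>"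
      unfolding eq using max_F(2)[OF F_diff[OF h_F g(1)] F_diff[OF h_F g'(1)]] g(4) g'(4) by linarith
  qed
qed

text \<open>
  Peeling off the first term turns the remaining sequence into one with \<open>\<delta>/16\<close> in place of \<open>\<delta>\<close>; the constant
  satisfies \<open>10 + 8 * 20/16 = 20\<close>, where \<open>10\<close> and \<open>8\<close> come from \<open>max_F\<close>.
\<close>

lemma Q_Max_le:
  assumes "\<And>n. b n \<in> F" "\<And>n. Q (b n) \<le> \<delta> / 16 ^ n"
  shows "(\<lambda>x. Max ((\<lambda>n. b n x) ` {..N})) \<in> F \<and> Q (\<lambda>x. Max ((\<lambda>n. b n x) ` {..N})) \<le> 20 * \<delta>"
  using assms
proof (induction N arbitrary: b \<delta>)
  case 0
  have "Q (b 0) \<le> \<delta>" using 0(2)[of 0] by simp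
  moreover have "0 \<le> Q (b 0)" using 0(1) by (rule Q_nonneg)
  ultimately show ?case using 0(1) by simp
next
  case (Suc N)
  define M where "M = (\<lambda>x. Max ((\<lambda>n. b (Suc n) x) ` {..N}))"
  have M: "M \<in> F \<and> Q M \<le> 20 * (\<delta> / 16)"
    unfolding M_def
  proof (rule Suc.IH)
    show "Q (b (Suc n)) \<le> \<delta> / 16 / 16 ^ n" for n using Suc.prems(2)[of "Suc n"] by simp
  qed (rule Suc.prems)
  have eq: "(\<lambda>x. Max ((\<lambda>n. b n x) ` {..Suc N})) = (\<lambda>x. max (b 0 x) (M x))"
    by (simp add: M_def atMost_Suc_eq_insert_0 image_image)
  have "Q (b 0) \<le> \<delta>" using Suc.prems(2)[of 0] by simp
  moreover have "0 \<le> Q (b 0)" using Suc.prems(1) by (rule Q_nonneg)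
  ultimately show ?case
    unfolding eq using max_F[OF Suc.prems(1)[of 0] conjunct1[OF M]] M by auto
qed

text \<open>
  Countable subadditivity of capacity. The lattice operations cost constant factors, which nested
  maxima accumulate; the geometric weights absorb them.
\<close>

lemma thick_INT:
  assumes A: "\<And>n. thick (A n) (\<delta> / 16 ^ n)"
  shows "thick (\<Inter>n. A n) (40 * \<delta>)"
proof -
  obtain g where g: "\<And>n. g n \<in> F" "\<And>n. AE x in \<mu>. 0 \<le> g n x \<and> g n x \<le> h x"
    "\<And>n. AE x in \<mu>. x \<notin> A n \<longrightarrow> g n x = 0" "\<And>n. Q (\<lambda>x. h x - g n x) \<le> \<delta> / 16 ^ n"
  proof -
    have "\<forall>n. \<exists>g. g \<in> F \<and> (AE x in \<mu>. 0 \<le> g x \<and> g x \<le> h x) \<and> (AE x in \<mu>. x \<notin> A n \<longrightarrow> g x = 0) \<and>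
        Q (\<lambda>x. h x - g x) \<le> \<delta> / 16 ^ n"
      using A unfolding thick_def by blast
    from choice[OF this] show ?thesis using that by blast
  qed
  have AE_bounds: "AE x in \<mu>. \<forall>n. 0 \<le> g n x \<and> g n x \<le> h x"
    using g(2) by (simp add: AE_all_countable)
  have AE_zero: "AE x in \<mu>. \<forall>n. x \<notin> A n \<longrightarrow> g n x = 0"
    using g(3) by (simp add: AE_all_countable)
  define b where "b n x = h x - g n x" for n x
  have bF: "b n \<in> F" for n unfolding b_def[abs_def] by (rule F_diff[OF h_F g(1)])
  have bQ: "Q (b n) \<le> \<delta> / 16 ^ n" for n using g(4) by (simp add: b_def[abs_def])
  define s where "s N x = Max ((\<lambda>n. b n x) ` {..N})" for N x
  have s: "s N \<in> F" "Q (s N) \<le> 20 * \<delta>" for N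
    using Q_Max_le[OF bF bQ, of N] by (simp_all add: s_def[abs_def])
  define t where "t x = lim (\<lambda>N. s N x)" for x
  have t: "AE x in \<mu>. (\<lambda>N. s N x) \<longlonglongrightarrow> t x \<and> (\<forall>n. b n x \<le> t x) \<and> 0 \<le> t x \<and> t x \<le> h x \<and> (\<forall>N. \<bar>s N x - t x\<bar> \<le> \<bar>h x\<bar>)"
    using AE_bounds
  proof eventually_elim
    case (elim x)
    then have b: "0 \<le> b n x" "b n x \<le> h x" for n by (auto simp: b_def)
    have inc: "incseq (\<lambda>N. s N x)"
      unfolding s_def by (intro incseq_SucI Max_mono) auto
    have s_le: "s N x \<le> h x" for N unfolding s_def using b by (intro Max.boundedI) auto
    have b_s: "b n x \<le> s n x" for n unfolding s_def by (intro Max_ge) auto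
    obtain l where l: "(\<lambda>N. s N x) \<longlonglongrightarrow> l" "\<forall>N. s N x \<le> l"
      using incseq_convergent[OF inc, of "h x"] s_le by auto
    have tl: "t x = l" unfolding t_def using l(1) by (rule limI)
    have "t x \<le> h x" unfolding tl by (rule LIMSEQ_le_const2[OF l(1)]) (use s_le in auto)
    moreover have b_t: "b n x \<le> t x" for n using b_s[of n] l(2) tl by (metis order_trans)
    moreover have s_nonneg: "0 \<le> s N x" for N using b(1)[of N] b_s[of N] by linarith
    moreover have s_t: "s N x \<le> t x" for N using l(2) tl by simp
    moreover have "\<bar>s N x - t x\<bar> \<le> \<bar>h x\<bar>" for N
      using \<open>t x \<le> h x\<close> s_nonneg[of N] s_t[of N] by linarith
    moreover have "0 \<le> t x" using b(1)[of 0] b_t[of 0] by linarith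
    ultimately show ?case using l(1) tl by blast
  qed
  have t_meas: "t \<in> borel_measurable \<mu>"
    unfolding t_def[abs_def] by (intro borel_measurable_lim_metric F_measurable s)
  have tL: "t \<in> L2 \<mu>"
  proof (rule L2_dominated[OF t_meas F_L2[OF h_F]])
    show "AE x in \<mu>. \<bar>t x\<bar> \<le> \<bar>h x\<bar>" using t by eventually_elim auto
  qed
  have "(\<lambda>N. L2_inner \<mu> (\<lambda>x. s N x - t x) (\<lambda>x. s N x - t x)) \<longlonglongrightarrow> 0"
  proof (rule L2_dominated_convergence[OF F_measurable[OF s(1)] t_meas F_L2[OF h_F]])
    show "AE x in \<mu>. (\<lambda>N. s N x) \<longlonglongrightarrow> t x" using t by eventually_elim simp
    show "AE x in \<mu>. \<bar>s N x - t x\<bar> \<le> \<bar>h x\<bar>" for N using t by eventually_elim blast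
  qed
  then have tF: "t \<in> F" "Q t \<le> 2 * (20 * \<delta>)"
    using Q_lower_semicontinuous[OF s tL] by auto
  show ?thesis unfolding thick_def
  proof (intro bexI[of _ "\<lambda>x. h x - t x"] conjI)
    show "(\<lambda>x. h x - t x) \<in> F" by (rule F_diff[OF h_F tF(1)])
    show "AE x in \<mu>. 0 \<le> h x - t x \<and> h x - t x \<le> h x" using t by eventually_elim simp
    show "AE x in \<mu>. x \<notin> (\<Inter>n. A n) \<longrightarrow> h x - t x = 0"
      using t AE_zero
    proof eventually_elim
      case (elim x)
      show ?case
      proof
        assume "x \<notin> (\<Inter>n. A n)"
        then obtain n where "g n x = 0" using elim(2) by auto
        then have "h x \<le> t x" using elim(1) by (auto simp: b_def dest: spec[of _ n])
        then show "h x - t x = 0" using elim(1) by auto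
      qed
    qed
    show "Q (\<lambda>x. h x - (h x - t x)) \<le> 40 * \<delta>" using tF(2) by simp
  qed
qed

text \<open>
  Chebyshev's inequality for capacity: as \<open>h \<le> 1\<close>, the function \<open>h - min (\<bar>u\<bar> / l) h\<close> vanishes where \<open>\<bar>u\<bar> > l\<close>.
\<close>

lemma thick_level_set:
  "\<exists>C>0. \<forall>u\<in>F. \<forall>l>0. thick {x. \<bar>u x\<bar> \<le> l} (C * Q u / l\<^sup>2)"
proof -
  obtain C where C: "0 \<le> C" "\<And>u. u \<in> F \<Longrightarrow> Q (\<lambda>x. min (u x) (h x)) \<le> C * Q u"
    using min_potential \<phi>_L2 \<phi>_nonneg resolvent_h by blast
  have "thick {x. \<bar>u x\<bar> \<le> l} ((18 * C + 1) * Q u / l\<^sup>2)" if u: "u \<in> F" and l: "0 < l" for u l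
  proof -
    define a where "a x = (1/l) * \<bar>u x\<bar>" for x
    define m where "m x = min (a x) (h x)" for x
    have aF: "a \<in> F" unfolding a_def[abs_def] by (intro F_scale abs_F u)
    have mF: "m \<in> F" unfolding m_def[abs_def] by (intro min_F aF h_F)
    have "Q a = (1/l)\<^sup>2 * Q (\<lambda>x. \<bar>u x\<bar>)"
      unfolding a_def[abs_def] by (rule Q_scale[OF abs_F(1)[OF u]])
    also have "\<dots> \<le> (1/l)\<^sup>2 * (18 * Q u)"
      by (intro mult_left_mono abs_F(2) u) simp
    finally have Qa: "Q a \<le> (1/l)\<^sup>2 * (18 * Q u)" .
    show ?thesis unfolding thick_def
    proof (intro bexI[of _ "\<lambda>x. h x - m x"] conjI)
      show "(\<lambda>x. h x - m x) \<in> F" by (rule F_diff[OF h_F mF])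
      have "0 \<le> a x" for x using l by (simp add: a_def)
      then show "AE x in \<mu>. 0 \<le> h x - m x \<and> h x - m x \<le> h x"
        using h_nonneg by (auto simp: m_def)
      show "AE x in \<mu>. x \<notin> {x. \<bar>u x\<bar> \<le> l} \<longrightarrow> h x - m x = 0"
        using h_le_1
      proof eventually_elim
        case (elim x)
        have "1 \<le> a x" if "l < \<bar>u x\<bar>" using l that by (simp add: a_def field_simps)
        then show ?case using elim by (auto simp: m_def)
      qed
      have "Q m \<le> C * Q a" using C(2)[OF aF] by (simp add: m_def[abs_def])
      also have "\<dots> \<le> C * ((1/l)\<^sup>2 * (18 * Q u))" using Qa C(1) by (rule mult_left_mono)
      also have "\<dots> \<le> (18 * C + 1) * Q u / l\<^sup>2"
        using Q_nonneg[OF u] l by (simp add: field_simps)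
      finally show "Q (\<lambda>x. h x - (h x - m x)) \<le> (18 * C + 1) * Q u / l\<^sup>2" by simp
    qed
  qed
  then show ?thesis using C(1) by (intro exI[of _ "18 * C + 1"]) auto
qed

end

context closed_form
begin

definition supported :: "'a set \<Rightarrow> ('a \<Rightarrow> real) set" where
  "supported A = {f \<in> F. AE x in \<mu>. x \<notin> A \<longrightarrow> f x = 0}"

lemma supported_F: "f \<in> supported A \<Longrightarrow> f \<in> F"
  by (simp add: supported_def)

lemma supported_lin:
  assumes "incseq A" "f \<in> supported (A i)" "g \<in> supported (A j)"
  shows "(\<lambda>x. a * f x + b * g x) \<in> supported (A (max i j))"
proof -
  have sub: "A i \<subseteq> A (max i j)" "A j \<subseteq> A (max i j)"
    using incseqD[OF assms(1)] by simp_all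
  have "AE x in \<mu>. x \<notin> A i \<longrightarrow> f x = 0" "AE x in \<mu>. x \<notin> A j \<longrightarrow> g x = 0"
    using assms by (auto simp: supported_def)
  then have "AE x in \<mu>. x \<notin> A (max i j) \<longrightarrow> a * f x + b * g x = 0"
    by eventually_elim (use sub in auto)
  then show ?thesis using assms by (simp add: supported_def F_lin)
qed

end

context reference
begin

lemma thick_AE_mono:
  assumes "thick A \<epsilon>" "AE x in \<mu>. x \<in> A \<longrightarrow> x \<in> A'"
  shows "thick A' \<epsilon>"
proof -
  obtain g where g: "g \<in> F" "AE x in \<mu>. 0 \<le> g x \<and> g x \<le> h x" "AE x in \<mu>. x \<notin> A \<longrightarrow> g x = 0"
    "Q (\<lambda>x. h x - g x) \<le> \<epsilon>" using assms(1) by (auto simp: thick_def)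
  have "AE x in \<mu>. x \<notin> A' \<longrightarrow> g x = 0" using g(3) assms(2) by eventually_elim auto
  then show ?thesis using g unfolding thick_def by blast
qed

text \<open>Bounded approximation of \<open>h\<close> in \<open>L\<^sup>2\<close> suffices, as the admissible functions form a convex set.\<close>

lemma thick_of_L2_approx:
  assumes A: "incseq A"
    and approx: "\<And>\<epsilon>. 0 < \<epsilon> \<Longrightarrow> \<exists>n. \<exists>w\<in>supported (A n). (AE x in \<mu>. 0 \<le> w x \<and> w x \<le> h x) \<and>
      L2_inner \<mu> (\<lambda>x. w x - h x) (\<lambda>x. w x - h x) \<le> \<epsilon> \<and> Q w \<le> C"
    and \<epsilon>: "0 < \<epsilon>"
  shows "\<exists>n. thick (A n) \<epsilon>"
proof -
  define D where "D = {g. (AE x in \<mu>. 0 \<le> g x \<and> g x \<le> h x) \<and> (\<exists>n. g \<in> supported (A n))}"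
  have "h \<in> F \<and> (\<forall>\<epsilon>>0. \<exists>w\<in>D. Q (\<lambda>x. h x - w x) < \<epsilon>) \<and> Q h \<le> 2 * C"
  proof (rule L2_approx_imp_Q_approx)
    show "D \<subseteq> F" by (auto simp: D_def supported_F)
    show "h \<in> L2 \<mu>" by (rule F_L2[OF h_F])
    show "(\<lambda>x. 1/2 * v x + 1/2 * w x) \<in> D" if vw: "v \<in> D" "w \<in> D" for v w
    proof -
      obtain i j where "v \<in> supported (A i)" "w \<in> supported (A j)" using vw by (auto simp: D_def)
      then have 1: "(\<lambda>x. 1/2 * v x + 1/2 * w x) \<in> supported (A (max i j))"
        by (rule supported_lin[OF A])
      have "AE x in \<mu>. 0 \<le> v x \<and> v x \<le> h x" "AE x in \<mu>. 0 \<le> w x \<and> w x \<le> h x"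
        using vw by (auto simp: D_def)
      then have "AE x in \<mu>. 0 \<le> 1/2 * v x + 1/2 * w x \<and> 1/2 * v x + 1/2 * w x \<le> h x"
        by eventually_elim auto
      then show ?thesis using 1 unfolding D_def by blast
    qed
    show "\<exists>w\<in>D. L2_inner \<mu> (\<lambda>x. w x - h x) (\<lambda>x. w x - h x) \<le> \<epsilon> \<and> Q w \<le> C" if "0 < \<epsilon>" for \<epsilon>
      using approx[OF that] unfolding D_def by blast
  qed
  then obtain g where "g \<in> D" "Q (\<lambda>x. h x - g x) < \<epsilon>" using \<epsilon> by blast
  then show ?thesis unfolding thick_def D_def supported_def by (auto intro: less_imp_le)
qed

lemma supported_dense_imp_thick:
  assumes A: "incseq A" and dense: "form_dense \<mu> F E (\<Union>n. supported (A n))" and \<epsilon>: "0 < \<epsilon>"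
  shows "\<exists>n. thick (A n) \<epsilon>"
proof (rule thick_of_L2_approx[OF A _ \<epsilon>])
  fix \<epsilon> :: real assume "0 < \<epsilon>"
  then have "0 < min 1 \<epsilon>" by simp
  then obtain f n where f: "f \<in> supported (A n)" "Q (\<lambda>x. h x - f x) < min 1 \<epsilon>"
    using dense h_F unfolding form_dense_def by blast
  note fF = supported_F[OF f(1)]
  define w where "w x = min (h x) (max (f x) 0)" for x
  have pF: "(\<lambda>x. max (f x) 0) \<in> F" by (rule pos_part[OF fF])
  have wF: "w \<in> F" unfolding w_def[abs_def] by (rule min_F(1)[OF h_F pF])
  have "AE x in \<mu>. x \<notin> A n \<longrightarrow> f x = 0" using f(1) by (simp add: supported_def)
  then have "AE x in \<mu>. x \<notin> A n \<longrightarrow> w x = 0"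
    using h_nonneg by eventually_elim (auto simp: w_def)
  then have "w \<in> supported (A n)" using wF by (simp add: supported_def)
  moreover have "AE x in \<mu>. 0 \<le> w x \<and> w x \<le> h x"
    using h_nonneg by eventually_elim (auto simp: w_def)
  moreover have "L2_inner \<mu> (\<lambda>x. w x - h x) (\<lambda>x. w x - h x) \<le> \<epsilon>"
  proof -
    have "L2_inner \<mu> (\<lambda>x. w x - h x) (\<lambda>x. w x - h x) \<le> L2_inner \<mu> (\<lambda>x. h x - f x) (\<lambda>x. h x - f x)"
    proof (rule L2_sq_mono)
      show "AE x in \<mu>. \<bar>w x - h x\<bar> \<le> \<bar>h x - f x\<bar>"
        using h_nonneg by eventually_elim (auto simp: w_def)
    qed (intro F_L2 F_diff wF h_F fF)+
    then show ?thesis using L2_sq_le_Q[OF F_diff[OF h_F fF]] f(2) by linarith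
  qed
  moreover have "Q w \<le> 10 * Q h + 16 * (2 * Q h + 2)"
  proof -
    have "Q w \<le> 10 * Q h + 8 * (2 * Q f)"
      unfolding w_def[abs_def] using min_F(2)[OF h_F pF] pos_part(2)[OF fF] by linarith
    moreover have "Q f \<le> 2 * Q h + 2 * Q (\<lambda>x. h x - f x)"
      using Q_diff_le[OF h_F F_diff[OF h_F fF]] by simp
    moreover have "Q (\<lambda>x. h x - f x) < 1" using f(2) by simp
    ultimately show ?thesis by argo
  qed
  ultimately show "\<exists>n. \<exists>w\<in>supported (A n). (AE x in \<mu>. 0 \<le> w x \<and> w x \<le> h x) \<and>
      L2_inner \<mu> (\<lambda>x. w x - h x) (\<lambda>x. w x - h x) \<le> \<epsilon> \<and> Q w \<le> 10 * Q h + 16 * (2 * Q h + 2)"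
    by blast
qed

text \<open>
  Seen from the capacity, \<open>h\<close> is bounded away from zero on large sets: \<open>(h - 1/n)\<^sup>+\<close> approximates \<open>h\<close>.
\<close>

lemma thick_superlevel_set:
  assumes \<epsilon>: "0 < \<epsilon>"
  shows "\<exists>n. thick {x. 1 / real (Suc n) \<le> h x} \<epsilon>"
proof (rule thick_of_L2_approx[OF _ _ \<epsilon>])
  show "incseq (\<lambda>n. {x. 1 / real (Suc n) \<le> h x})"
  proof (rule incseq_SucI, safe)
    fix n x assume "1 / real (Suc n) \<le> h x"
    moreover have "1 / real (Suc (Suc n)) \<le> 1 / real (Suc n)" by (intro divide_left_mono) auto
    ultimately show "1 / real (Suc (Suc n)) \<le> h x" by linarith
  qed
  define w where "w n x = max (h x - 1 / real (Suc n)) 0" for n x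
  have wF: "w n \<in> F" "Q (w n) \<le> 6 * Q h" for n
    unfolding w_def[abs_def] by (intro excess_F h_F; simp)+
  have w_bd: "AE x in \<mu>. 0 \<le> w n x \<and> w n x \<le> h x" for n
    using h_nonneg by eventually_elim (auto simp: w_def)
  have w_supp: "w n \<in> supported {x. 1 / real (Suc n) \<le> h x}" for n
    using wF by (auto simp: supported_def w_def)
  have lim: "(\<lambda>n. L2_inner \<mu> (\<lambda>x. w n x - h x) (\<lambda>x. w n x - h x)) \<longlonglongrightarrow> 0"
  proof (rule L2_dominated_convergence[OF F_measurable[OF wF(1)] F_measurable[OF h_F] F_L2[OF h_F]])
    have "(\<lambda>n. w n x) \<longlonglongrightarrow> max (h x - 0) 0" for x
      unfolding w_def by (intro tendsto_max tendsto_diff tendsto_const LIMSEQ_inverse_real_of_nat[unfolded inverse_eq_divide])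
    then show "AE x in \<mu>. (\<lambda>n. w n x) \<longlonglongrightarrow> h x"
      using h_nonneg by (auto elim!: eventually_mono) (metis max.absorb1)
    show "AE x in \<mu>. \<bar>w n x - h x\<bar> \<le> \<bar>h x\<bar>" for n
      using w_bd[of n] by eventually_elim auto
  qed
  fix \<epsilon> :: real assume "0 < \<epsilon>"
  then have "\<forall>\<^sub>F n in sequentially. L2_inner \<mu> (\<lambda>x. w n x - h x) (\<lambda>x. w n x - h x) < \<epsilon>"
    by (rule order_tendstoD(2)[OF lim])
  then obtain n where "L2_inner \<mu> (\<lambda>x. w n x - h x) (\<lambda>x. w n x - h x) \<le> \<epsilon>"
    by (auto simp: eventually_sequentially intro: less_imp_le)
  then show "\<exists>n. \<exists>w\<in>supported {x. 1 / real (Suc n) \<le> h x}. (AE x in \<mu>. 0 \<le> w x \<and> w x \<le> h x) \<and>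
      L2_inner \<mu> (\<lambda>x. w x - h x) (\<lambda>x. w x - h x) \<le> \<epsilon> \<and> Q w \<le> 6 * Q h"
    using w_supp[of n] w_bd[of n] wF(2)[of n] by blast
qed

text \<open>
  If \<open>g\<close> is close to \<open>h\<close> and \<open>0 \<le> v \<le> c h\<close>, then \<open>min v (c g)\<close> is close to \<open>v\<close> in \<open>L\<^sup>2\<close>, bounded in energy, and
  vanishes where \<open>g\<close> does.
\<close>

lemma potential_approx_supported:
  assumes A: "incseq A" and thick: "\<And>\<epsilon>. 0 < \<epsilon> \<Longrightarrow> \<exists>n. thick (A n) \<epsilon>"
    and f: "f \<in> L2 \<mu>" "AE x in \<mu>. 0 \<le> f x \<and> f x \<le> c * \<phi> x" and c: "0 \<le> c"
    and v: "resolvent 1 f v" and \<epsilon>: "0 < \<epsilon>"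
  shows "\<exists>w\<in>(\<Union>n. supported (A n)). Q (\<lambda>x. v x - w x) < \<epsilon>"
proof -
  note vF = resolvent_F[OF v]
  have v0: "AE x in \<mu>. 0 \<le> v x"
    using f(2) by (intro resolvent_pos[OF v f(1)]) (auto elim: eventually_mono)
  have vh: "AE x in \<mu>. v x \<le> c * h x"
    using f(2) by (intro resolvent_mono[OF v resolvent_scale[OF resolvent_h \<phi>_L2] f(1) L2_scale[OF \<phi>_L2]])
      (auto elim: eventually_mono)
  have "v \<in> F \<and> (\<forall>\<epsilon>>0. \<exists>w\<in>(\<Union>n. supported (A n)). Q (\<lambda>x. v x - w x) < \<epsilon>) \<and>
      Q v \<le> 2 * (10 * Q v + 8 * (c\<^sup>2 * (2 * Q h + 2)))"
  proof (rule L2_approx_imp_Q_approx)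
    show "(\<Union>n. supported (A n)) \<subseteq> F" by (auto simp: supported_F)
    show "v \<in> L2 \<mu>" by (rule F_L2[OF vF])
    show "(\<lambda>x. 1/2 * u x + 1/2 * w x) \<in> (\<Union>n. supported (A n))"
      if uw: "u \<in> (\<Union>n. supported (A n))" "w \<in> (\<Union>n. supported (A n))" for u w
    proof -
      obtain i j where "u \<in> supported (A i)" "w \<in> supported (A j)" using uw by blast
      from supported_lin[OF A this, of "1/2" "1/2"] show ?thesis by blast
    qed
    fix \<epsilon> :: real assume \<epsilon>: "0 < \<epsilon>"
    define \<delta> where "\<delta> = min 1 (\<epsilon> / (c\<^sup>2 + 1))"
    have c1: "0 < c\<^sup>2 + 1" by (simp add: add_nonneg_pos)
    have \<delta>: "0 < \<delta>" "\<delta> \<le> 1" and "\<delta> \<le> \<epsilon> / (c\<^sup>2 + 1)" using \<epsilon> c1 by (auto simp: \<delta>_def)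
    then have \<delta>c: "c\<^sup>2 * \<delta> \<le> \<epsilon>"
      using c1 by (simp add: pos_le_divide_eq algebra_simps)
    obtain n g where g: "g \<in> F" "AE x in \<mu>. 0 \<le> g x \<and> g x \<le> h x" "AE x in \<mu>. x \<notin> A n \<longrightarrow> g x = 0"
      "Q (\<lambda>x. h x - g x) \<le> \<delta>"
      using thick[OF \<delta>(1)] unfolding thick_def by blast
    define w where "w x = min (v x) (c * g x)" for x
    have cgF: "(\<lambda>x. c * g x) \<in> F" by (rule F_scale[OF g(1)])
    have wF: "w \<in> F" unfolding w_def[abs_def] by (rule min_F(1)[OF vF cgF])
    have "AE x in \<mu>. x \<notin> A n \<longrightarrow> w x = 0"
      using g(3) v0 by eventually_elim (auto simp: w_def)
    then have "w \<in> (\<Union>n. supported (A n))" using wF by (auto simp: supported_def)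
    moreover have "L2_inner \<mu> (\<lambda>x. w x - v x) (\<lambda>x. w x - v x) \<le> \<epsilon>"
    proof -
      have "L2_inner \<mu> (\<lambda>x. w x - v x) (\<lambda>x. w x - v x) \<le>
          L2_inner \<mu> (\<lambda>x. c * (h x - g x)) (\<lambda>x. c * (h x - g x))"
      proof (rule L2_sq_mono)
        show "AE x in \<mu>. \<bar>w x - v x\<bar> \<le> \<bar>c * (h x - g x)\<bar>"
          using vh g(2)
        proof eventually_elim
          case (elim x)
          have "0 \<le> c * (h x - g x)" using c elim by (intro mult_nonneg_nonneg) auto
          then show ?case using elim by (auto simp: w_def algebra_simps)
        qed
      qed (intro F_L2 F_scale F_diff wF vF h_F g)+
      also have "\<dots> = c\<^sup>2 * L2_inner \<mu> (\<lambda>x. h x - g x) (\<lambda>x. h x - g x)"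
        unfolding L2_inner_scale_left L2_inner_scale_right by (simp add: power2_eq_square)
      also have "\<dots> \<le> c\<^sup>2 * \<delta>"
        using L2_sq_le_Q[OF F_diff[OF h_F g(1)]] g(4) by (intro mult_left_mono) auto
      finally show ?thesis using \<delta>c by linarith
    qed
    moreover have "Q w \<le> 10 * Q v + 8 * (c\<^sup>2 * (2 * Q h + 2))"
    proof -
      have "Q g \<le> 2 * Q h + 2 * Q (\<lambda>x. h x - g x)"
        using Q_diff_le[OF h_F F_diff[OF h_F g(1)]] by simp
      then have "Q g \<le> 2 * Q h + 2" using g(4) \<delta>(2) by linarith
      then have "c\<^sup>2 * Q g \<le> c\<^sup>2 * (2 * Q h + 2)" by (intro mult_left_mono) auto
      then show ?thesis
        unfolding w_def[abs_def] using min_F(2)[OF vF cgF] Q_scale[OF g(1), of c] by linarith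
    qed
    ultimately show "\<exists>w\<in>(\<Union>n. supported (A n)). L2_inner \<mu> (\<lambda>x. w x - v x) (\<lambda>x. w x - v x) \<le> \<epsilon> \<and>
        Q w \<le> 10 * Q v + 8 * (c\<^sup>2 * (2 * Q h + 2))" by blast
  qed
  then show ?thesis using \<epsilon> by blast
qed

lemma thick_imp_supported_dense:
  assumes A: "incseq A" and thick: "\<And>\<epsilon>. 0 < \<epsilon> \<Longrightarrow> \<exists>n. thick (A n) \<epsilon>"
  shows "form_dense \<mu> F E (\<Union>n. supported (A n))"
  unfolding form_dense_def
proof (intro conjI ballI allI impI)
  show "(\<Union>n. supported (A n)) \<subseteq> F" by (auto simp: supported_F)
  fix u and \<epsilon> :: real assume u: "u \<in> F" and \<epsilon>: "0 < \<epsilon>"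
  then have e: "0 < \<epsilon> / 16" by simp
  obtain f g c where f: "0 \<le> c" "f \<in> L2 \<mu>" "AE x in \<mu>. \<bar>f x\<bar> \<le> c * \<phi> x" "resolvent 1 f g"
    "Q (\<lambda>x. u x - g x) < \<epsilon> / 16"
    using bounded_potentials_dense[OF u e] by blast
  note gF = resolvent_F[OF f(4)]
  define p q where "p x = max (f x) 0" and "q x = max (- f x) 0" for x
  note [measurable] = L2_measurable[OF f(2)]
  have "p \<in> borel_measurable \<mu>" "q \<in> borel_measurable \<mu>"
    unfolding p_def[abs_def] q_def[abs_def] by measurable
  then have pL: "p \<in> L2 \<mu>" and qL: "q \<in> L2 \<mu>"
    by (auto intro!: L2_dominated[OF _ f(2)] simp: p_def q_def)
  have pb: "AE x in \<mu>. 0 \<le> p x \<and> p x \<le> c * \<phi> x" and qb: "AE x in \<mu>. 0 \<le> q x \<and> q x \<le> c * \<phi> x"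
    using f(3) by (eventually_elim; auto simp: p_def q_def)+
  obtain g1 where r1: "resolvent 1 p g1" by (rule resolvent_exists[OF zero_less_one pL])
  obtain g2 where r2: "resolvent 1 q g2" by (rule resolvent_exists[OF zero_less_one qL])
  note r = r1 r2
  note gF' = resolvent_F[OF r(1)] resolvent_F[OF r(2)]
  have g_eq: "AE x in \<mu>. g x = g1 x - g2 x"
    by (rule resolvent_unique[OF f(4) resolvent_diff[OF r pL qL] f(2) L2_diff[OF pL qL]])
      (auto simp: p_def q_def max_def)
  obtain w1 i where w1: "w1 \<in> supported (A i)" "Q (\<lambda>x. g1 x - w1 x) < \<epsilon> / 16"
    using potential_approx_supported[OF A thick pL pb f(1) r(1) e] by blast
  obtain w2 j where w2: "w2 \<in> supported (A j)" "Q (\<lambda>x. g2 x - w2 x) < \<epsilon> / 16"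
    using potential_approx_supported[OF A thick qL qb f(1) r(2) e] by blast
  note wF = supported_F[OF w1(1)] supported_F[OF w2(1)]
  define w where "w x = 1 * w1 x + (-1) * w2 x" for x
  have w: "w \<in> supported (A (max i j))"
    unfolding w_def[abs_def] by (rule supported_lin[OF A w1(1) w2(1)])
  have dF: "(\<lambda>x. g1 x - w1 x) \<in> F" "(\<lambda>x. g2 x - w2 x) \<in> F" using gF' wF by (auto intro: F_diff)
  have "Q (\<lambda>x. g x - w x) = Q (\<lambda>x. (g1 x - w1 x) - (g2 x - w2 x))"
    using g_eq by (intro Q_AE_cong F_diff gF gF' wF supported_F[OF w]) (auto simp: w_def)
  also have "\<dots> < \<epsilon> / 4"
    using Q_diff_le[OF dF] w1(2) w2(2) by linarith
  finally have "Q (\<lambda>x. (u x - g x) + (g x - w x)) < \<epsilon>"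
    using Q_add_le[OF F_diff[OF u gF] F_diff[OF gF supported_F[OF w]]] f(5) \<epsilon> by linarith
  then show "\<exists>v\<in>(\<Union>n. supported (A n)). Q (\<lambda>x. u x - v x) < \<epsilon>"
    using w by (intro bexI[of _ w]) auto
qed

end

section \<open>Quasi-continuity\<close>

locale topological_reference = reference \<mu> F E \<phi> h
  for \<mu> :: "'a::topological_space measure" and F E \<phi> h
begin

text \<open>
  The single function \<open>h\<close> decides whether a sequence is a nest, because the potentials dominated by its multiples
  span a dense subspace.
\<close>

lemma nest_iff_thick:
  "nest \<mu> F E C \<longleftrightarrow> incseq C \<and> (\<forall>n. closed (C n)) \<and> (\<forall>\<epsilon>>0. \<exists>n. thick (C n) \<epsilon>)"
  unfolding nest_def
  using supported_dense_imp_thick[of C] thick_imp_supported_dense[of C]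
  by (auto simp: supported_def)

lemma nest_of_thick_sequence:
  assumes "\<And>n. closed (S n)" "\<And>n. thick (S n) (1 / real (Suc n))"
  shows "nest \<mu> F E (\<lambda>n. \<Union>i\<le>n. S i)"
  unfolding nest_iff_thick
proof (intro conjI allI impI)
  show "incseq (\<lambda>n. \<Union>i\<le>n. S i)" by (intro incseq_SucI UN_mono) auto
  show "closed (\<Union>i\<le>n. S i)" for n using assms(1) by (intro closed_UN) auto
  fix \<epsilon> :: real assume "0 < \<epsilon>"
  then obtain n where "1 / real (Suc n) < \<epsilon>" using nat_approx_posE by blast
  then have "thick (\<Union>i\<le>n. S i) \<epsilon>" by (intro thick_mono[OF assms(2)[of n]]) auto
  then show "\<exists>n. thick (\<Union>i\<le>n. S i) \<epsilon>" ..
qed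

lemma common_continuity_set:
  assumes v: "\<And>n :: nat. quasi_continuous \<mu> F E (v n)" and \<epsilon>: "0 < \<epsilon>"
  shows "\<exists>S. closed S \<and> thick S \<epsilon> \<and>
    (\<forall>n. continuous_on S (\<lambda>x. real_of_ereal (v n x)) \<and> (\<forall>x\<in>S. \<bar>v n x\<bar> \<noteq> \<infinity>))"
proof -
  have "\<exists>S. closed S \<and> thick S (\<epsilon> / 40 / 16 ^ n) \<and>
      continuous_on S (\<lambda>x. real_of_ereal (v n x)) \<and> (\<forall>x\<in>S. \<bar>v n x\<bar> \<noteq> \<infinity>)" for n
  proof -
    obtain C where C: "nest \<mu> F E C" "\<And>k x. x \<in> C k \<Longrightarrow> \<bar>v n x\<bar> \<noteq> \<infinity>" "\<And>k. continuous_on (C k) (v n)"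
      using v[of n] by (auto simp: quasi_continuous_def)
    have "0 < \<epsilon> / 40 / 16 ^ n" using \<epsilon> by simp
    then obtain k where k: "thick (C k) (\<epsilon> / 40 / 16 ^ n)" using C(1) unfolding nest_iff_thick by blast
    have "continuous_on (v n ` C k) real_of_ereal"
      using C(2)[of _ k] by (intro continuous_on_subset[OF continuous_on_real]) fastforce
    then have "continuous_on (C k) (\<lambda>x. real_of_ereal (v n x))"
      using continuous_on_compose[OF C(3)[of k]] by (simp add: comp_def)
    moreover have "closed (C k)" using C(1) by (simp add: nest_def)
    ultimately show ?thesis using C(2) k by (intro exI[of _ "C k"] conjI ballI) auto
  qed
  then have "\<exists>S. \<forall>n. closed (S n) \<and> thick (S n) (\<epsilon> / 40 / 16 ^ n) \<and>
      continuous_on (S n) (\<lambda>x. real_of_ereal (v n x)) \<and> (\<forall>x\<in>S n. \<bar>v n x\<bar> \<noteq> \<infinity>)"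
    by (intro choice allI)
  then obtain S where S_all: "\<forall>n. closed (S n) \<and> thick (S n) (\<epsilon> / 40 / 16 ^ n) \<and>
      continuous_on (S n) (\<lambda>x. real_of_ereal (v n x)) \<and> (\<forall>x\<in>S n. \<bar>v n x\<bar> \<noteq> \<infinity>)" ..
  then have S: "\<And>n. closed (S n)" "\<And>n. thick (S n) (\<epsilon> / 40 / 16 ^ n)"
      "\<And>n. continuous_on (S n) (\<lambda>x. real_of_ereal (v n x))" "\<And>n x. x \<in> S n \<Longrightarrow> \<bar>v n x\<bar> \<noteq> \<infinity>"
    by simp_all
  have "closed (\<Inter>n. S n)" using S(1) by (intro closed_INT) auto
  moreover have "thick (\<Inter>n. S n) \<epsilon>" using thick_INT[OF S(2)] by simp
  moreover have "continuous_on (\<Inter>n. S n) (\<lambda>x. real_of_ereal (v n x))" for n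
    by (rule continuous_on_subset[OF S(3)]) auto
  ultimately show ?thesis using S(4) by (intro exI[of _ "\<Inter>n. S n"] conjI allI ballI) auto
qed

lemma quasi_continuousI:
  assumes r: "\<And>\<epsilon>. 0 < \<epsilon> \<Longrightarrow> \<exists>S. closed S \<and> thick S \<epsilon> \<and> continuous_on S r"
  shows "quasi_continuous \<mu> F E (\<lambda>x. ereal (r x))"
proof -
  have "\<forall>n. \<exists>S. closed S \<and> thick S (1 / real (Suc n)) \<and> continuous_on S r"
    using r by simp
  from choice[OF this] obtain S where
    S: "\<And>n. closed (S n)" "\<And>n. thick (S n) (1 / real (Suc n))" "\<And>n. continuous_on (S n) r"
    by blast
  have "continuous_on (\<Union>i\<le>n. S i) (\<lambda>x. ereal (r x))" for n
    using S by (intro continuous_on_ereal continuous_on_closed_Union) auto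
  then show ?thesis
    using nest_of_thick_sequence[OF S(1,2)] unfolding quasi_continuous_def by (intro exI conjI) auto
qed

text \<open>
  Choose \<open>d n \<in> D\<close> converging to \<open>u\<close> so fast that, by Chebyshev's inequality, the versions of \<open>d n\<close> converge
  uniformly on closed sets with complements of arbitrarily small capacity.
\<close>

lemma qc_version_exists:
  assumes D: "form_dense \<mu> F E D" and qc: "\<And>u. u \<in> D \<Longrightarrow> \<exists>v. qc_version \<mu> F E u v" and u: "u \<in> F"
  shows "\<exists>r. qc_version \<mu> F E u (\<lambda>x. ereal (r x))"
proof -
  \<comment> \<open>At the level \<open>1/2\<^sup>n\<close> Chebyshev's inequality costs \<open>4\<^sup>n\<close>. This leaves \<open>1/64\<^sup>n\<close>, below the weights \<open>1/16\<^sup>n\<close>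
    of \<open>thick_INT\<close>.\<close>
  have "\<forall>n. \<exists>d. d \<in> D \<and> Q (\<lambda>x. u x - d x) < 1 / 256 ^ n"
  proof
    fix n :: nat
    have "(0 :: real) < 1 / 256 ^ n" by simp
    then show "\<exists>d. d \<in> D \<and> Q (\<lambda>x. u x - d x) < 1 / 256 ^ n"
      using D u unfolding form_dense_def by blast
  qed
  from choice[OF this] obtain d where d: "\<And>n. d n \<in> D" "\<And>n::nat. Q (\<lambda>x. u x - d n x) < 1 / 256 ^ n"
    by blast
  have dF: "d n \<in> F" for n using d(1) D by (auto simp: form_dense_def)
  have "\<forall>n. \<exists>v. qc_version \<mu> F E (d n) v" using qc d(1) by blast
  from choice[OF this] obtain v where v: "\<And>n. qc_version \<mu> F E (d n) (v n)" by blast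
  have d_lim: "(\<lambda>n. \<integral>x. norm ((d n x - u x) * (d n x - u x)) \<partial>\<mu>) \<longlonglongrightarrow> 0"
  proof (rule tendsto_sandwich)
    have mult_norm_diff: "\<bar>(a - b) * (a - b)\<bar> = (b - a) * (b - a)" for a b :: real
      unfolding abs_mult_self_eq abs_mult by (simp add: algebra_simps)
    have eq: "(\<integral>x. norm ((d n x - u x) * (d n x - u x)) \<partial>\<mu>) = L2_inner \<mu> (\<lambda>x. u x - d n x) (\<lambda>x. u x - d n x)" for n
      unfolding L2_inner_def
      by (intro Bochner_Integration.integral_cong) (simp_all add: mult_norm_diff)
    show "\<forall>\<^sub>F n in sequentially. 0 \<le> (\<integral>x. norm ((d n x - u x) * (d n x - u x)) \<partial>\<mu>)" by simp
    show "\<forall>\<^sub>F n in sequentially. (\<integral>x. norm ((d n x - u x) * (d n x - u x)) \<partial>\<mu>) \<le> 1 / 256 ^ n"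
      unfolding eq using L2_sq_le_Q[OF F_diff[OF u dF]] d(2) by (intro always_eventually allI) (meson less_imp_le order_trans)
    show "(\<lambda>n. 1 / 256 ^ n :: real) \<longlonglongrightarrow> 0"
      using LIMSEQ_power_zero[of "1/256 :: real"] by (simp add: power_one_over)
  qed simp
  have "\<exists>s. strict_mono s \<and> (AE x in \<mu>. (\<lambda>n. (d (s n) x - u x) * (d (s n) x - u x)) \<longlonglongrightarrow> 0)"
    using tendsto_L1_AE_subseq[OF _ d_lim] L2_sq_integrable[OF F_L2[OF F_diff[OF dF u]]] by blast
  then obtain s :: "nat \<Rightarrow> nat" where s: "strict_mono s"
    and s_lim: "AE x in \<mu>. (\<lambda>n. (d (s n) x - u x) * (d (s n) x - u x)) \<longlonglongrightarrow> 0" by blast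
  define e where "e n = d (s n)" for n
  define \<rho> where "\<rho> n x = real_of_ereal (v (s n) x)" for n x
  have eF: "e n \<in> F" for n by (simp add: e_def dF)
  have v_qc: "quasi_continuous \<mu> F E (v (s n))" for n
    using v by (simp add: qc_version_def)
  have \<rho>_AE: "AE x in \<mu>. \<forall>n. \<rho> n x = e n x"
    unfolding AE_all_countable
  proof
    fix n show "AE x in \<mu>. \<rho> n x = e n x"
      using v[of "s n"] by (auto simp: qc_version_def \<rho>_def e_def)
  qed
  have e_Q: "Q (\<lambda>x. u x - e n x) \<le> 1 / 256 ^ n" for n
  proof -
    have "(1 :: real) / 256 ^ s n \<le> 1 / 256 ^ n"
      using strict_mono_imp_increasing[OF s, of n] by (intro divide_left_mono power_increasing) auto
    then show ?thesis using d(2)[of "s n"] by (simp add: e_def)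
  qed
  have step_Q: "Q (\<lambda>x. e (Suc n) x - e n x) \<le> 4 / 256 ^ n" for n
  proof -
    have "Q (\<lambda>x. (u x - e n x) - (u x - e (Suc n) x)) \<le> 2 * (1 / 256 ^ n) + 2 * (1 / 256 ^ Suc n)"
      using Q_diff_le[OF F_diff[OF u eF] F_diff[OF u eF], of n "Suc n"] e_Q[of n] e_Q[of "Suc n"] by linarith
    also have "\<dots> \<le> 4 / 256 ^ n" by (simp add: field_simps)
    finally show ?thesis by simp
  qed
  obtain C where C: "0 < C" "\<And>u l. u \<in> F \<Longrightarrow> 0 < l \<Longrightarrow> thick {x. \<bar>u x\<bar> \<le> l} (C * Q u / l\<^sup>2)"
    using thick_level_set by blast
  define A where "A n = {x. \<bar>\<rho> (Suc n) x - \<rho> n x\<bar> \<le> 1 / 2 ^ n}" for n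
  have A_thick: "thick (A n) (4 * C / 64 ^ n)" for n
  proof -
    have "C * Q (\<lambda>x. e (Suc n) x - e n x) / (1 / 2 ^ n)\<^sup>2 \<le> C * (4 / 256 ^ n) / (1 / 2 ^ n)\<^sup>2"
      using C(1) step_Q by (intro divide_right_mono mult_left_mono) auto
    also have "\<dots> = 4 * C / 64 ^ n"
    proof -
      have "(256 :: real) ^ n = 64 ^ n * (2 ^ n * 2 ^ n)" by (simp flip: power_mult_distrib)
      then show ?thesis by (simp add: power2_eq_square)
    qed
    finally have 1: "thick {x. \<bar>e (Suc n) x - e n x\<bar> \<le> 1 / 2 ^ n} (4 * C / 64 ^ n)"
      by (intro thick_mono[OF C(2)[OF F_diff[OF eF eF], of "1 / 2 ^ n" "Suc n" n]]) auto
    show ?thesis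
      by (rule thick_AE_mono[OF 1]) (use \<rho>_AE in \<open>auto simp: A_def elim!: eventually_mono\<close>)
  qed
  define r where "r x = lim (\<lambda>n. \<rho> n x)" for x
  have "AE x in \<mu>. r x = u x"
    using s_lim \<rho>_AE
  proof eventually_elim
    case (elim x)
    have "(\<lambda>n. sqrt ((d (s n) x - u x) * (d (s n) x - u x))) \<longlonglongrightarrow> sqrt 0"
      by (rule tendsto_real_sqrt[OF elim(1)])
    then have "(\<lambda>n. \<bar>d (s n) x - u x\<bar>) \<longlonglongrightarrow> 0" by simp
    then have "(\<lambda>n. d (s n) x - u x) \<longlonglongrightarrow> 0" by (rule tendsto_rabs_zero_cancel)
    then have "(\<lambda>n. e n x) \<longlonglongrightarrow> u x" unfolding e_def by (rule LIM_zero_cancel)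
    then show "r x = u x" using elim(2) by (auto simp: r_def intro: limI)
  qed
  moreover have "quasi_continuous \<mu> F E (\<lambda>x. ereal (r x))"
  proof (rule quasi_continuousI)
    fix \<epsilon> :: real assume \<epsilon>: "0 < \<epsilon>"
    obtain S0 where S0: "closed S0" "thick S0 (\<epsilon> / 18)" "\<And>n. continuous_on S0 (\<rho> n)"
      using common_continuity_set[of "\<lambda>n. v (s n)" "\<epsilon> / 18"] v_qc \<epsilon> unfolding \<rho>_def by auto
    have "(\<lambda>n. 4 * C * (1 / 64) ^ n) \<longlonglongrightarrow> 4 * C * 0"
      by (intro tendsto_mult_left LIMSEQ_power_zero) simp
    then have "\<forall>\<^sub>F n in sequentially. 4 * C * (1 / 64) ^ n < \<epsilon> / 720"
      using \<epsilon> by (intro order_tendstoD(2)) auto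
    \<comment> \<open>\<open>720 = 40 * 18\<close>: the losses in \<open>thick_INT\<close> and \<open>thick_Int\<close>.\<close>
    then obtain N where N: "4 * C / 64 ^ N < \<epsilon> / 720"
      by (auto simp: eventually_sequentially power_one_over)
    have "thick (A (N + i)) (\<epsilon> / 720 / 16 ^ i)" for i
    proof (rule thick_mono[OF A_thick])
      have "4 * C / 64 ^ (N + i) = 4 * C / 64 ^ N / 64 ^ i" by (simp add: power_add)
      also have "\<dots> \<le> \<epsilon> / 720 / 64 ^ i" using N by (intro divide_right_mono) auto
      also have "\<dots> \<le> \<epsilon> / 720 / 16 ^ i"
        using \<epsilon> by (intro divide_left_mono power_mono) auto
      finally show "4 * C / 64 ^ (N + i) \<le> \<epsilon> / 720 / 16 ^ i" .
    qed simp
    then have "thick (\<Inter>i. A (N + i)) (\<epsilon> / 18)" using thick_INT[of "\<lambda>i. A (N + i)" "\<epsilon> / 720"] by simp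
    then have thick_S: "thick (S0 \<inter> (\<Inter>i. A (N + i))) \<epsilon>" using thick_Int[OF S0(2)] by simp
    define S where "S = S0 \<inter> (\<Inter>i. A (N + i))"
    have S_eq: "S = (\<Inter>i. {x \<in> S0. \<bar>\<rho> (Suc (N + i)) x - \<rho> (N + i) x\<bar> \<le> 1 / 2 ^ (N + i)})"
      by (auto simp: S_def A_def)
    have "closed S" unfolding S_eq using S0
      by (intro closed_INT ballI continuous_on_closed_Collect_le continuous_intros) auto
    moreover have "continuous_on S r"
    proof -
      define b where "b i x = \<rho> (Suc (N + i)) x - \<rho> (N + i) x" for i x
      have "uniform_limit S (\<lambda>n x. \<Sum>i<n. b i x) (\<lambda>x. \<Sum>i. b i x) sequentially"
      proof (rule Weierstrass_m_test)
        show "norm (b i x) \<le> (1 / 2) ^ i" if x: "x \<in> S" for i x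
        proof -
          have "\<bar>b i x\<bar> \<le> 1 / 2 ^ (N + i)" using x by (auto simp: S_def A_def b_def)
          also have "\<dots> \<le> 1 / 2 ^ i" by (intro divide_left_mono power_increasing) auto
          finally show ?thesis by (simp add: power_one_over)
        qed
        show "summable (\<lambda>i. (1 / 2 :: real) ^ i)" by (intro summable_geometric) simp
      qed
      moreover have sum_b: "(\<Sum>i<n. b i x) = \<rho> (N + n) x - \<rho> N x" for n x
        using sum_lessThan_telescope[of "\<lambda>i. \<rho> (N + i) x" n] by (simp add: b_def)
      ultimately have "uniform_limit S (\<lambda>n x. \<rho> (N + n) x - \<rho> N x) (\<lambda>x. \<Sum>i. b i x) sequentially"
        by simp
      moreover have "uniform_limit S (\<lambda>n x. \<rho> N x) (\<lambda>x. \<rho> N x) sequentially"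
        by (rule uniform_limit_const)
      ultimately have "uniform_limit S (\<lambda>n x. (\<rho> (N + n) x - \<rho> N x) + \<rho> N x) (\<lambda>x. (\<Sum>i. b i x) + \<rho> N x) sequentially"
        by (rule uniform_limit_add)
      then
      have unif: "uniform_limit S (\<lambda>n x. \<rho> (N + n) x) (\<lambda>x. (\<Sum>i. b i x) + \<rho> N x) sequentially"
        by simp
      have "r x = (\<Sum>i. b i x) + \<rho> N x" if x: "x \<in> S" for x
      proof -
        have "(\<lambda>n. \<rho> (N + n) x) \<longlonglongrightarrow> (\<Sum>i. b i x) + \<rho> N x"
          by (rule tendsto_uniform_limitI[OF unif x])
        then have "(\<lambda>n. \<rho> n x) \<longlonglongrightarrow> (\<Sum>i. b i x) + \<rho> N x"
          by (subst (asm) add.commute) (rule LIMSEQ_offset)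
        then show ?thesis unfolding r_def by (rule limI)
      qed
      moreover have "continuous_on S (\<lambda>x. (\<Sum>i. b i x) + \<rho> N x)"
      proof (rule uniform_limit_theorem[OF _ unif])
        show "\<forall>\<^sub>F n in sequentially. continuous_on S (\<rho> (N + n))"
          by (intro always_eventually allI continuous_on_subset[OF S0(3)]) (simp add: S_def)
      qed simp
      ultimately show ?thesis by (simp cong: continuous_on_cong)
    qed
    ultimately show "\<exists>S. closed S \<and> thick S \<epsilon> \<and> continuous_on S r"
      using thick_S unfolding S_def by blast
  qed
  ultimately show ?thesis unfolding qc_version_def by auto
qed

end

section \<open>Domination\<close>

context closed_form
begin

lemma resolvent_energy:
  assumes r: "resolvent \<beta> u g" and u: "u \<in> L2 \<mu>" and v: "v \<in> F"
  shows "B 0 (\<lambda>x. \<beta> * g x) v = \<beta> * L2_inner \<mu> (\<lambda>x. u x - \<beta> * g x) v"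
  using resolvent_E[OF r u v] v by (simp add: B_scale_left resolvent_F[OF r])

lemma resolvent_energy_self_le:
  assumes r: "resolvent \<beta> u g" and u: "u \<in> L2 \<mu>" and \<beta>: "0 < \<beta>"
  shows "B 0 (\<lambda>x. \<beta> * g x) (\<lambda>x. \<beta> * g x) \<le> \<beta> * L2_inner \<mu> (\<lambda>x. u x - \<beta> * g x) u"
proof -
  have p: "(\<lambda>x. \<beta> * g x) \<in> F" by (rule F_scale[OF resolvent_F[OF r]])
  define d where "d = (\<lambda>x. u x - \<beta> * g x)"
  have d: "d \<in> L2 \<mu>" unfolding d_def by (rule L2_diff[OF u F_L2[OF p]])
  have "L2_inner \<mu> d u = L2_inner \<mu> d (\<lambda>x. \<beta> * g x) + L2_inner \<mu> d d"
    unfolding d_def[symmetric] using L2_inner_add_right[OF F_L2[OF p] d d] by (simp add: d_def)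
  then have "L2_inner \<mu> d (\<lambda>x. \<beta> * g x) \<le> L2_inner \<mu> d u"
    using L2_inner_self_nonneg[of \<mu> d] by linarith
  then show ?thesis
    unfolding resolvent_energy[OF r u p] d_def[symmetric] using \<beta> by simp
qed

end

locale dominated_forms =
  big: dirichlet_semigroup \<mu> F E + small: dirichlet_semigroup \<mu> F' E'
  for \<mu> :: "'a measure" and F E F' E' +
  assumes dominated: "dominated_form \<mu> F' E' F E"
begin

lemma resolvent_dominated:
  assumes r: "big.resolvent \<alpha> f g" and r': "small.resolvent \<alpha> f g'" and f: "f \<in> L2 \<mu>"
    and nn: "AE x in \<mu>. 0 \<le> f x" and \<alpha>: "0 < \<alpha>"
  shows "AE x in \<mu>. g' x \<le> g x"
proof -
  obtain T' T where T: "form_semigroup \<mu> F' E' T'" "form_semigroup \<mu> F E T"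
    and le: "\<And>t. 0 \<le> t \<Longrightarrow> AE x in \<mu>. T' t f x \<le> T t f x"
    using dominated f nn unfolding dominated_form_def by blast
  obtain k where k: "big.resolvent \<alpha> f k"
    "\<And>u. u \<in> L2 \<mu> \<Longrightarrow> ((\<lambda>t. exp (- \<alpha> * t) * L2_inner \<mu> (T t f) u) has_integral L2_inner \<mu> k u) {0..}"
    using T(2) \<alpha> f unfolding form_semigroup_def big.resolvent_def by blast
  obtain k' where k': "small.resolvent \<alpha> f k'"
    "\<And>u. u \<in> L2 \<mu> \<Longrightarrow> ((\<lambda>t. exp (- \<alpha> * t) * L2_inner \<mu> (T' t f) u) has_integral L2_inner \<mu> k' u) {0..}"
    using T(1) \<alpha> f unfolding form_semigroup_def small.resolvent_def by blast
  have TL: "T t f \<in> L2 \<mu>" "T' t f \<in> L2 \<mu>" if "0 \<le> t" for t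
    using T f that unfolding form_semigroup_def L2_contraction_semigroup_def by auto
  have kL: "k \<in> L2 \<mu>" "k' \<in> L2 \<mu>"
    using big.F_L2[OF big.resolvent_F[OF k(1)]] small.F_L2[OF small.resolvent_F[OF k'(1)]] by auto
  define d where "d x = k' x - k x" for x
  define p where "p x = max (d x) 0" for x
  have dL: "d \<in> L2 \<mu>" unfolding d_def[abs_def] by (rule L2_diff[OF kL(2,1)])
  have pL: "p \<in> L2 \<mu>"
    unfolding p_def[abs_def] using L2_measurable[OF dL] by (intro L2_dominated[OF _ dL]) auto
  have "L2_inner \<mu> k' p \<le> L2_inner \<mu> k p"
  proof (rule has_integral_le[OF k'(2)[OF pL] k(2)[OF pL]])
    fix t :: real assume t: "t \<in> {0..}"
    have "L2_inner \<mu> (T' t f) p \<le> L2_inner \<mu> (T t f) p"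
    proof (rule L2_inner_mono)
      show "AE x in \<mu>. T' t f x * p x \<le> T t f x * p x"
        using le[of t] t by (auto elim!: eventually_mono intro!: mult_right_mono simp: p_def)
    qed (use TL t pL in auto)
    then show "exp (- \<alpha> * t) * L2_inner \<mu> (T' t f) p \<le> exp (- \<alpha> * t) * L2_inner \<mu> (T t f) p"
      by (intro mult_left_mono) auto
  qed
  moreover have "L2_inner \<mu> k' p = L2_inner \<mu> k p + L2_inner \<mu> d p"
    using L2_inner_diff_left[OF kL(2,1) pL] by (simp add: d_def[abs_def])
  moreover have "L2_inner \<mu> d p = L2_inner \<mu> p p"
  proof -
    have "(\<lambda>x. d x * p x) = (\<lambda>x. p x * p x)" by (auto simp: p_def max_def)
    then show ?thesis by (simp add: L2_inner_def)
  qed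
  ultimately have "AE x in \<mu>. p x = 0" by (intro L2_sq_eq_0_AE[OF pL]) linarith
  moreover have "AE x in \<mu>. g x = k x" by (rule big.resolvent_unique[OF r k(1) f f \<alpha>]) simp
  moreover have "AE x in \<mu>. g' x = k' x" by (rule small.resolvent_unique[OF r' k'(1) f f \<alpha>]) simp
  ultimately show ?thesis by eventually_elim (auto simp: p_def d_def)
qed

text \<open>
  For \<open>u \<ge> 0\<close> the energy of \<open>\<beta> G\<^sub>\<beta> u\<close> is at most \<open>\<beta> (u - \<beta> G\<^sub>\<beta> u, u) \<le> \<beta> (u - \<beta> G'\<^sub>\<beta> u, u) = E' (\<beta> G'\<^sub>\<beta> u) u\<close>, which stays
  bounded if \<open>u \<in> F'\<close>.
\<close>

lemma nonneg_small_subset_big: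
  assumes u: "u \<in> F'" and nn: "AE x in \<mu>. 0 \<le> u x"
  shows "u \<in> F"
proof -
  note uL = small.F_L2[OF u]
  obtain C where C: "0 \<le> C" "\<And>\<beta> u g. 0 < \<beta> \<Longrightarrow> u \<in> F' \<Longrightarrow> small.resolvent \<beta> u g \<Longrightarrow> small.Q (\<lambda>x. \<beta> * g x) \<le> C * small.Q u"
    using small.resolvent_approx by blast
  obtain c where c: "0 \<le> c" "\<And>u v. u \<in> F' \<Longrightarrow> v \<in> F' \<Longrightarrow> \<bar>small.B 1 u v\<bar> \<le> small.Q u / 4 + c * small.Q v"
    using small.sector by blast
  have "\<exists>g. big.resolvent (real (Suc n)) u g" for n
    using big.resolvent_exists[of "real (Suc n)" u] uL by auto
  then obtain g where g: "\<And>n. big.resolvent (real (Suc n)) u (g n)" by metis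
  have "\<exists>g. small.resolvent (real (Suc n)) u g" for n
    using small.resolvent_exists[of "real (Suc n)" u] uL by auto
  then obtain g' where g': "\<And>n. small.resolvent (real (Suc n)) u (g' n)" by metis
  define p where "p n x = real (Suc n) * g n x" for n x
  define p' where "p' n x = real (Suc n) * g' n x" for n x
  have pF: "p n \<in> F" for n unfolding p_def[abs_def] by (rule big.F_scale[OF big.resolvent_F[OF g]])
  have pF': "p' n \<in> F'" for n unfolding p'_def[abs_def] by (rule small.F_scale[OF small.resolvent_F[OF g']])
  have bound: "big.Q (p n) \<le> (C / 4 + c + 2) * small.Q u" for n
  proof -
    have "big.B 0 (p n) (p n) \<le> real (Suc n) * L2_inner \<mu> (\<lambda>x. u x - p n x) u"
      using big.resolvent_energy_self_le[OF g uL, of n] by (simp add: p_def[abs_def])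
    also have "\<dots> \<le> real (Suc n) * L2_inner \<mu> (\<lambda>x. u x - p' n x) u"
    proof (intro mult_left_mono L2_inner_mono L2_diff uL big.F_L2[OF pF] small.F_L2[OF pF'])
      show "AE x in \<mu>. (u x - p n x) * u x \<le> (u x - p' n x) * u x"
        using nn resolvent_dominated[OF g g' uL nn, of n]
        by (auto elim!: eventually_elim2 intro!: mult_right_mono mult_left_mono simp: p_def p'_def)
    qed simp
    also have "\<dots> = small.B 0 (p' n) u"
      using small.resolvent_energy[OF g' uL u, of n] by (simp add: p'_def[abs_def])
    also have "\<dots> = small.B 1 (p' n) u - L2_inner \<mu> (p' n) u"
      by (simp add: shifted_form_def)
    also have "\<dots> \<le> (C / 4 + c + 1) * small.Q u"
    proof -
      have "small.B 1 (p' n) u \<le> small.Q (p' n) / 4 + c * small.Q u"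
        using c(2)[OF pF' u, of n] by linarith
      moreover have "small.Q (p' n) \<le> C * small.Q u"
        using C(2)[OF _ u g', of n] by (simp add: p'_def[abs_def])
      moreover have "- L2_inner \<mu> (p' n) u \<le> small.Q u"
        using L2_inner_le_half_squares[OF small.F_L2[OF pF'] uL, of n] small.L2_sq_le_Q[OF u]
          small.resolvent_contraction[OF g' uL, of n] by (simp add: p'_def[abs_def])
      ultimately show ?thesis by (simp add: algebra_simps)
    qed
    finally have "big.B 0 (p n) (p n) \<le> (C / 4 + c + 1) * small.Q u" .
    moreover have "L2_inner \<mu> (p n) (p n) \<le> small.Q u"
      using big.resolvent_contraction[OF g uL, of n] small.L2_sq_le_Q[OF u] by (simp add: p_def[abs_def])
    ultimately show ?thesis using big.Q_eq[of "p n"] by (simp add: algebra_simps)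
  qed
  have "(\<lambda>n. L2_inner \<mu> (\<lambda>x. p n x - u x) (\<lambda>x. p n x - u x)) \<longlonglongrightarrow> 0"
    using big.resolvent_tendsto[OF uL g] by (simp add: p_def)
  then show ?thesis using big.Q_lower_semicontinuous[of p, OF pF bound uL] by blast
qed

lemma small_subset_big: "u \<in> F' \<Longrightarrow> u \<in> F"
proof -
  assume u: "u \<in> F'"
  have "(\<lambda>x. max (u x) 0) \<in> F" "(\<lambda>x. max ((-1) * u x) 0) \<in> F"
    using u by (intro nonneg_small_subset_big small.pos_part small.F_scale; simp)+
  from big.F_diff[OF this] have "(\<lambda>x. max (u x) 0 - max ((-1) * u x) 0) \<in> F" .
  moreover have "(\<lambda>x. max (u x) 0 - max ((-1) * u x) 0) = u" by (auto simp: max_def)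
  ultimately show ?thesis by simp
qed

text \<open>
  The approximating form \<open>\<beta> (u - \<beta> G'\<^sub>\<beta> u, v)\<close> of \<open>E'\<close> at \<open>(g, g)\<close> is its value at \<open>(g, f)\<close> minus that at
  \<open>(g, f - g)\<close>. The former is bounded because \<open>f \<in> F'\<close>. The latter can only decrease when \<open>G'\<close> is replaced by \<open>G\<close>, as
  \<open>g\<close> and \<open>f - g\<close> are nonnegative, and then it is bounded because \<open>g\<close> and \<open>f - g\<close> are in \<open>F\<close>.
\<close>

lemma order_ideal:
  "\<exists>K\<ge>0. \<forall>f\<in>F'. \<forall>g\<in>F. (AE x in \<mu>. 0 \<le> g x \<and> g x \<le> f x) \<longrightarrow>
     g \<in> F' \<and> small.Q g \<le> K * (small.Q f + big.Q f + big.Q g)"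
proof -
  obtain C where C: "0 \<le> C" "\<And>\<beta> u g. 0 < \<beta> \<Longrightarrow> u \<in> F \<Longrightarrow> big.resolvent \<beta> u g \<Longrightarrow> big.Q (\<lambda>x. \<beta> * g x) \<le> C * big.Q u"
    using big.resolvent_approx by blast
  obtain c where c: "0 \<le> c" "\<And>u v. u \<in> F \<Longrightarrow> v \<in> F \<Longrightarrow> \<bar>big.B 1 u v\<bar> \<le> big.Q u / 4 + c * big.Q v"
    using big.sector by blast
  obtain c' where c': "0 \<le> c'" "\<And>u v. u \<in> F' \<Longrightarrow> v \<in> F' \<Longrightarrow> \<bar>small.B 1 u v\<bar> \<le> small.Q u / 4 + c' * small.Q v"
    using small.sector by blast
  define K where "K = 4 * (c' + C + 2 * c + 3)"
  have "g \<in> F' \<and> small.Q g \<le> 2 * (K * (small.Q f + big.Q f + big.Q g))"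
    if f: "f \<in> F'" and g: "g \<in> F" and gf: "AE x in \<mu>. 0 \<le> g x \<and> g x \<le> f x" for f g
  proof -
    note fF = small_subset_big[OF f]
    note fL = big.F_L2[OF fF] and gL = big.F_L2[OF g]
    define e where "e x = f x - g x" for x
    have eF: "e \<in> F" unfolding e_def[abs_def] by (rule big.F_diff[OF fF g])
    note eL = big.F_L2[OF eF]
    have g0: "AE x in \<mu>. 0 \<le> g x" using gf by eventually_elim simp
    have "\<exists>k. big.resolvent (real (Suc n)) g k" for n
      using big.resolvent_exists[of "real (Suc n)" g] gL by auto
    then obtain k where k: "\<And>n. big.resolvent (real (Suc n)) g (k n)" by metis
    have "\<exists>k. small.resolvent (real (Suc n)) g k" for n
      using small.resolvent_exists[of "real (Suc n)" g] gL by auto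
    then obtain k' where k': "\<And>n. small.resolvent (real (Suc n)) g (k' n)" by metis
    define p where "p n x = real (Suc n) * k n x" for n x
    define p' where "p' n x = real (Suc n) * k' n x" for n x
    have pF: "p n \<in> F" for n unfolding p_def[abs_def] by (rule big.F_scale[OF big.resolvent_F[OF k]])
    have pF': "p' n \<in> F'" for n unfolding p'_def[abs_def] by (rule small.F_scale[OF small.resolvent_F[OF k']])
    have bound: "small.Q (p' n) \<le> K * (small.Q f + big.Q f + big.Q g)" for n
    proof -
      define \<beta> where "\<beta> = real (Suc n)"
      have \<beta>: "0 < \<beta>" by (simp add: \<beta>_def)
      note pL = big.F_L2[OF pF[of n]] and pL' = small.F_L2[OF pF'[of n]]
      have "small.B 0 (p' n) (p' n) \<le> \<beta> * L2_inner \<mu> (\<lambda>x. g x - p' n x) g"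
        using small.resolvent_energy_self_le[OF k' gL, of n] by (simp add: p'_def[abs_def] \<beta>_def)
      also have "L2_inner \<mu> (\<lambda>x. g x - p' n x) g = L2_inner \<mu> (\<lambda>x. g x - p' n x) f - L2_inner \<mu> (\<lambda>x. g x - p' n x) e"
        using L2_inner_diff_right[OF fL eL L2_diff[OF gL pL']] by (simp add: e_def)
      also have "\<beta> * \<dots> = small.B 0 (p' n) f - \<beta> * L2_inner \<mu> (\<lambda>x. g x - p' n x) e"
        using small.resolvent_energy[OF k' gL f, of n] by (simp add: p'_def[abs_def] \<beta>_def right_diff_distrib)
      also have "\<dots> \<le> small.B 0 (p' n) f - \<beta> * L2_inner \<mu> (\<lambda>x. g x - p n x) e"
      proof (intro diff_left_mono mult_left_mono L2_inner_mono L2_diff gL eL pL pL')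
        show "AE x in \<mu>. (g x - p n x) * e x \<le> (g x - p' n x) * e x"
          using gf resolvent_dominated[OF k k' gL g0, of n]
          by (auto elim!: eventually_elim2 intro!: mult_right_mono mult_left_mono simp: p_def p'_def e_def)
      qed (use \<beta> in simp)
      also have "\<beta> * L2_inner \<mu> (\<lambda>x. g x - p n x) e = big.B 0 (p n) e"
        using big.resolvent_energy[OF k gL eF, of n] by (simp add: p_def[abs_def] \<beta>_def)
      finally have main: "small.B 0 (p' n) (p' n) \<le> small.B 0 (p' n) f - big.B 0 (p n) e" .
      have np: "L2_inner \<mu> (p n) (p n) \<le> L2_inner \<mu> g g" "L2_inner \<mu> (p' n) (p' n) \<le> L2_inner \<mu> g g"
        using big.resolvent_contraction[OF k gL, of n] small.resolvent_contraction[OF k' gL, of n]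
        by (simp_all add: p_def[abs_def] p'_def[abs_def])
      have 1: "small.B 0 (p' n) f = small.B 1 (p' n) f - L2_inner \<mu> (p' n) f"
        "big.B 0 (p n) e = big.B 1 (p n) e - L2_inner \<mu> (p n) e"
        by (simp_all add: shifted_form_def)
      have 2: "small.B 1 (p' n) f \<le> small.Q (p' n) / 4 + c' * small.Q f"
        using c'(2)[OF pF' f, of n] by linarith
      have 3: "- big.B 1 (p n) e \<le> big.Q (p n) / 4 + c * big.Q e"
        using c(2)[OF pF eF, of n] by linarith
      have 4: "big.Q (p n) \<le> C * big.Q g" using C(2)[OF _ g k, of n] by (simp add: p_def[abs_def])
      have 5: "c * big.Q e \<le> c * (2 * big.Q f + 2 * big.Q g)"
        unfolding e_def[abs_def] by (rule mult_left_mono[OF big.Q_diff_le[OF fF g] c(1)])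
      have 6: "- L2_inner \<mu> (p' n) f \<le> (big.Q g + big.Q f) / 2"
        using L2_inner_le_half_squares[OF pL' fL] np(2) big.L2_sq_le_Q[OF g] big.L2_sq_le_Q[OF fF] by argo
      have 7: "L2_inner \<mu> (p n) e \<le> (big.Q g + (2 * big.Q f + 2 * big.Q g)) / 2"
        using L2_inner_le_half_squares[OF pL eL] np(1) big.L2_sq_le_Q[OF g] big.L2_sq_le_Q[OF eF]
          big.Q_diff_le[OF fF g] unfolding e_def[symmetric, abs_def] by argo
      have 8: "L2_inner \<mu> (p' n) (p' n) \<le> big.Q g" using np(2) big.L2_sq_le_Q[OF g] by linarith
      have 9: "0 \<le> big.Q g" "0 \<le> big.Q f" "0 \<le> small.Q f" "0 \<le> small.Q (p' n)"
        using big.Q_nonneg[OF g] big.Q_nonneg[OF fF] small.Q_nonneg[OF f] small.Q_nonneg[OF pF'] by auto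
      have "3/4 * small.Q (p' n) \<le> c' * small.Q f + C * big.Q g / 4 + c * (2 * big.Q f + 2 * big.Q g)
          + (big.Q g + big.Q f) / 2 + (big.Q g + (2 * big.Q f + 2 * big.Q g)) / 2 + big.Q g"
        using main 1 2 3 4 5 6 7 8 small.Q_eq[of "p' n"] by argo
      also have "\<dots> \<le> 3/4 * (K * (small.Q f + big.Q f + big.Q g))"
      proof -
        have "K * (small.Q f + big.Q f + big.Q g) = 4 * (c' * small.Q f) + 4 * (c' * big.Q f) + 4 * (c' * big.Q g)
          + 4 * (C * small.Q f) + 4 * (C * big.Q f) + 4 * (C * big.Q g)
          + 8 * (c * small.Q f) + 8 * (c * big.Q f) + 8 * (c * big.Q g)
          + 12 * small.Q f + 12 * big.Q f + 12 * big.Q g"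
          by (simp add: K_def algebra_simps)
        moreover have "0 \<le> c' * small.Q f" "0 \<le> c' * big.Q f" "0 \<le> c' * big.Q g" "0 \<le> C * small.Q f"
          "0 \<le> C * big.Q f" "0 \<le> C * big.Q g" "0 \<le> c * small.Q f" "0 \<le> c * big.Q f" "0 \<le> c * big.Q g"
          using 9 c(1) c'(1) C(1) by auto
        moreover have "c * (2 * big.Q f + 2 * big.Q g) = 2 * (c * big.Q f) + 2 * (c * big.Q g)"
          by (simp add: algebra_simps)
        ultimately show ?thesis using 9 by argo
      qed
      finally show ?thesis by simp
    qed
    have "(\<lambda>n. L2_inner \<mu> (\<lambda>x. p' n x - g x) (\<lambda>x. p' n x - g x)) \<longlonglongrightarrow> 0"
      using small.resolvent_tendsto[OF gL k'] by (simp add: p'_def)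
    then show ?thesis using small.Q_lower_semicontinuous[of p', OF pF' bound gL] by blast
  qed
  moreover have "0 \<le> 2 * K" using c(1) c'(1) C(1) by (simp add: K_def)
  ultimately show ?thesis by (intro exI[of _ "2 * K"]) (auto simp: mult.assoc)
qed

text \<open>
  If \<open>u\<close> approximates \<open>f\<close> in \<open>F\<close>, then \<open>min f u\<^sup>+\<close> is in \<open>F'\<close> by the ideal property and still bounded in energy, so
  that it approximates \<open>f\<close> well enough in \<open>L\<^sup>2\<close>.
\<close>

lemma nonneg_approx_supported:
  assumes A: "incseq A" and dense: "form_dense \<mu> F E (\<Union>n. big.supported (A n))"
    and f: "f \<in> F'" and nn: "AE x in \<mu>. 0 \<le> f x" and \<epsilon>: "0 < \<epsilon>"
  shows "\<exists>w\<in>(\<Union>n. small.supported (A n)). small.Q (\<lambda>x. f x - w x) < \<epsilon>"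
proof -
  obtain K where K: "0 \<le> K" "\<And>f g. f \<in> F' \<Longrightarrow> g \<in> F \<Longrightarrow> AE x in \<mu>. 0 \<le> g x \<and> g x \<le> f x \<Longrightarrow>
     g \<in> F' \<and> small.Q g \<le> K * (small.Q f + big.Q f + big.Q g)"
    using order_ideal by blast
  note fF = small_subset_big[OF f]
  define C where "C = K * (small.Q f + big.Q f + (10 * big.Q f + 16 * (2 * big.Q f + 2)))"
  have "f \<in> F' \<and> (\<forall>\<epsilon>>0. \<exists>w\<in>(\<Union>n. small.supported (A n)). small.Q (\<lambda>x. f x - w x) < \<epsilon>) \<and> small.Q f \<le> 2 * C"
  proof (rule small.L2_approx_imp_Q_approx)
    show "(\<Union>n. small.supported (A n)) \<subseteq> F'" by (auto simp: small.supported_F)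
    show "f \<in> L2 \<mu>" by (rule small.F_L2[OF f])
    show "(\<lambda>x. 1/2 * u x + 1/2 * w x) \<in> (\<Union>n. small.supported (A n))"
      if uw: "u \<in> (\<Union>n. small.supported (A n))" "w \<in> (\<Union>n. small.supported (A n))" for u w
    proof -
      obtain i j where "u \<in> small.supported (A i)" "w \<in> small.supported (A j)" using uw by blast
      from small.supported_lin[OF A this, of "1/2" "1/2"] show ?thesis by blast
    qed
    fix \<epsilon> :: real assume "0 < \<epsilon>"
    then have "0 < min 1 \<epsilon>" by simp
    then obtain u n where u: "u \<in> big.supported (A n)" "big.Q (\<lambda>x. f x - u x) < min 1 \<epsilon>"
      using dense fF unfolding form_dense_def by blast
    note uF = big.supported_F[OF u(1)]
    define w where "w x = min (f x) (max (u x) 0)" for x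
    have pF: "(\<lambda>x. max (u x) 0) \<in> F" by (rule big.pos_part[OF uF])
    have wF: "w \<in> F" unfolding w_def[abs_def] by (rule big.min_F(1)[OF fF pF])
    have Qw: "big.Q w \<le> 10 * big.Q f + 16 * (2 * big.Q f + 2)"
    proof -
      have "big.Q w \<le> 10 * big.Q f + 8 * (2 * big.Q u)"
        unfolding w_def[abs_def] using big.min_F(2)[OF fF pF] big.pos_part(2)[OF uF] by linarith
      moreover have "big.Q u \<le> 2 * big.Q f + 2 * big.Q (\<lambda>x. f x - u x)"
        using big.Q_diff_le[OF fF big.F_diff[OF fF uF]] by simp
      moreover have "big.Q (\<lambda>x. f x - u x) < 1" using u(2) by simp
      ultimately show ?thesis by argo
    qed
    have "AE x in \<mu>. 0 \<le> w x \<and> w x \<le> f x"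
      using nn by eventually_elim (auto simp: w_def)
    from K(2)[OF f wF this] have w: "w \<in> F'" "small.Q w \<le> K * (small.Q f + big.Q f + big.Q w)" by auto
    have "small.Q w \<le> C"
      unfolding C_def using w(2) mult_left_mono[OF add_left_mono[OF Qw, of "small.Q f + big.Q f"] K(1)] by linarith
    moreover have "w \<in> small.supported (A n)"
    proof -
      have "AE x in \<mu>. x \<notin> A n \<longrightarrow> u x = 0" using u(1) by (simp add: big.supported_def)
      then have "AE x in \<mu>. x \<notin> A n \<longrightarrow> w x = 0"
        using nn by eventually_elim (auto simp: w_def)
      then show ?thesis using w(1) by (simp add: small.supported_def)
    qed
    moreover have "L2_inner \<mu> (\<lambda>x. w x - f x) (\<lambda>x. w x - f x) \<le> \<epsilon>"
    proof -
      have "L2_inner \<mu> (\<lambda>x. w x - f x) (\<lambda>x. w x - f x) \<le> L2_inner \<mu> (\<lambda>x. f x - u x) (\<lambda>x. f x - u x)"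
      proof (rule L2_sq_mono)
        show "AE x in \<mu>. \<bar>w x - f x\<bar> \<le> \<bar>f x - u x\<bar>"
          using nn by eventually_elim (auto simp: w_def)
      qed (intro big.F_L2 big.F_diff wF fF uF)+
      then show ?thesis using big.L2_sq_le_Q[OF big.F_diff[OF fF uF]] u(2) by linarith
    qed
    ultimately show "\<exists>w\<in>(\<Union>n. small.supported (A n)). L2_inner \<mu> (\<lambda>x. w x - f x) (\<lambda>x. w x - f x) \<le> \<epsilon> \<and>
        small.Q w \<le> C" by blast
  qed
  then show ?thesis using \<epsilon> by blast
qed

lemma supported_dense:
  assumes A: "incseq A" and dense: "form_dense \<mu> F E (\<Union>n. big.supported (A n))"
  shows "form_dense \<mu> F' E' (\<Union>n. small.supported (A n))"
  unfolding form_dense_def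
proof (intro conjI ballI allI impI)
  show "(\<Union>n. small.supported (A n)) \<subseteq> F'" by (auto simp: small.supported_F)
  fix u and \<epsilon> :: real assume u: "u \<in> F'" and \<epsilon>: "0 < \<epsilon>"
  define p q where "p x = max (u x) 0" and "q x = max ((-1) * u x) 0" for x
  have F': "p \<in> F'" "q \<in> F'"
    unfolding p_def[abs_def] q_def[abs_def] by (intro small.pos_part small.F_scale u)+
  have nn: "AE x in \<mu>. 0 \<le> p x" "AE x in \<mu>. 0 \<le> q x" by (auto simp: p_def q_def)
  have \<epsilon>4: "0 < \<epsilon> / 4" using \<epsilon> by simp
  obtain w i where w: "w \<in> small.supported (A i)" "small.Q (\<lambda>x. p x - w x) < \<epsilon> / 4"
    using nonneg_approx_supported[OF A dense F'(1) nn(1) \<epsilon>4] by blast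
  obtain v j where v: "v \<in> small.supported (A j)" "small.Q (\<lambda>x. q x - v x) < \<epsilon> / 4"
    using nonneg_approx_supported[OF A dense F'(2) nn(2) \<epsilon>4] by blast
  have eq: "(\<lambda>x. u x - (1 * w x + (-1) * v x)) = (\<lambda>x. (p x - w x) - (q x - v x))"
    by (auto simp: p_def q_def max_def)
  have "small.Q (\<lambda>x. u x - (1 * w x + (-1) * v x)) < \<epsilon>"
    unfolding eq
    using small.Q_diff_le[OF small.F_diff[OF F'(1) small.supported_F[OF w(1)]] small.F_diff[OF F'(2) small.supported_F[OF v(1)]]]
      w(2) v(2) by linarith
  then show "\<exists>v\<in>(\<Union>n. small.supported (A n)). small.Q (\<lambda>x. u x - v x) < \<epsilon>"
    using small.supported_lin[OF A w(1) v(1), of 1 "-1"]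
    by (intro bexI[of _ "\<lambda>x. 1 * w x + (-1) * v x"] UN_I[OF UNIV_I])
qed

end

lemma dominated_nest:
  fixes \<mu> :: "'a::topological_space measure"
  assumes "dominated_forms \<mu> F E F' E'" "nest \<mu> F E C"
  shows "nest \<mu> F' E' C"
proof -
  interpret dominated_forms \<mu> F E F' E' by fact
  show ?thesis using assms(2) supported_dense[of C]
    by (auto simp: nest_def big.supported_def small.supported_def)
qed

lemma dominated_quasi_continuous:
  fixes \<mu> :: "'a::topological_space measure"
  assumes "dominated_forms \<mu> F E F' E'" "quasi_continuous \<mu> F E v"
  shows "quasi_continuous \<mu> F' E' v"
  using assms dominated_nest unfolding quasi_continuous_def by blast

section \<open>Quasi-regularity of dominated forms\<close>

theorem dominated_quasi_regular:
  fixes \<mu> :: "'a::topological_space measure"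
  assumes "sigma_finite_measure \<mu>" "dirichlet_form \<mu> F E" "dirichlet_form \<mu> F' E'"
    and "dominated_form \<mu> F' E' F E" "quasi_regular \<mu> F E"
  shows "quasi_regular \<mu> F' E'"
proof -
  have dom: "dominated_forms \<mu> F E F' E'"
    using assms(2-4) by unfold_locales (auto simp: dirichlet_form_def dominated_form_def)
  then interpret dominated_forms \<mu> F E F' E' .
  note nest' = dominated_nest[OF dom] and qc' = dominated_quasi_continuous[OF dom]

  have "\<exists>\<phi>. \<phi> \<in> borel_measurable \<mu> \<and> (\<forall>x. 0 < \<phi> x) \<and> (\<forall>x. \<phi> x \<le> (1::real)) \<and> integrable \<mu> \<phi>"
    by (rule sigma_finite_measure.obtain_positive_integrable_function[OF assms(1)]) auto
  then obtain \<phi> :: "'a \<Rightarrow> real" where \<phi>: "\<phi> \<in> borel_measurable \<mu>" "\<And>x. 0 < \<phi> x" "\<And>x. \<phi> x \<le> 1" "integrable \<mu> \<phi>"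
    by blast
  have \<phi>L: "\<phi> \<in> L2 \<mu>"
  proof (rule L2_I[OF \<phi>(1)], rule Bochner_Integration.integrable_bound[OF \<phi>(4)])
    show "(\<lambda>x. \<phi> x * \<phi> x) \<in> borel_measurable \<mu>" using \<phi>(1) by measurable
    have "\<phi> x * \<phi> x \<le> \<phi> x" for x
      using mult_left_mono[OF \<phi>(3)[of x], of "\<phi> x"] \<phi>(2)[of x] by simp
    then show "AE x in \<mu>. norm (\<phi> x * \<phi> x) \<le> norm (\<phi> x)" using \<phi>(2) by (simp add: less_imp_le)
  qed
  obtain h where h: "big.resolvent 1 \<phi> h" by (rule big.resolvent_exists[OF zero_less_one \<phi>L])
  obtain h' where h': "small.resolvent 1 \<phi> h'" by (rule small.resolvent_exists[OF zero_less_one \<phi>L])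
  interpret R: topological_reference \<mu> F E \<phi> h
    using \<phi> \<phi>L h by unfold_locales auto
  interpret R': topological_reference \<mu> F' E' \<phi> h'
    using \<phi> \<phi>L h' by unfold_locales auto

  have "\<exists>C. nest \<mu> F E C \<and> (\<forall>n. compact (C n))"
    and "\<exists>D. form_dense \<mu> F E D \<and> (\<forall>u\<in>D. \<exists>v. qc_version \<mu> F E u v)"
    by (rule assms(5)[unfolded quasi_regular_def, THEN conjunct1],
      rule assms(5)[unfolded quasi_regular_def, THEN conjunct2, THEN conjunct1])
  then obtain C D where C: "nest \<mu> F E C" "\<And>n. compact (C n)"
    and D: "form_dense \<mu> F E D" "\<And>u. u \<in> D \<Longrightarrow> \<exists>v. qc_version \<mu> F E u v"
    by blast
  have "\<exists>(u :: nat \<Rightarrow> 'a \<Rightarrow> real) v N. polar \<mu> F E N \<and> (\<forall>n. u n \<in> F \<and> qc_version \<mu> F E (u n) (v n)) \<and>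
      (\<forall>x y. x \<notin> N \<and> y \<notin> N \<and> x \<noteq> y \<longrightarrow> (\<exists>n. v n x \<noteq> v n y))"
    using assms(5)[unfolded quasi_regular_def] by (elim conjE)
  then obtain u :: "nat \<Rightarrow> 'a \<Rightarrow> real" and v N where N: "polar \<mu> F E N"
    and u_all: "\<forall>n. u n \<in> F \<and> qc_version \<mu> F E (u n) (v n)"
    and sep: "\<forall>x y. x \<notin> N \<and> y \<notin> N \<and> x \<noteq> y \<longrightarrow> (\<exists>n. v n x \<noteq> v n y)"
    by (elim exE conjE)
  have u: "\<And>n. u n \<in> F" "\<And>n. qc_version \<mu> F E (u n) (v n)" using u_all by simp_all
  obtain C0 where C0: "nest \<mu> F E C0" "N \<subseteq> - (\<Union>n. C0 n)" using N by (auto simp: polar_def)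
  have version: "\<exists>r. quasi_continuous \<mu> F' E' (\<lambda>x. ereal (r x)) \<and> (AE x in \<mu>. r x = w x)" if "w \<in> F'" for w
    using R.qc_version_exists[OF D small_subset_big[OF that]] qc' by (auto simp: qc_version_def)

  have dense': "form_dense \<mu> F' E' F'"
    unfolding form_dense_def
  proof (intro conjI ballI allI impI)
    fix w and \<epsilon> :: real assume w: "w \<in> F'" and "0 < \<epsilon>"
    then show "\<exists>v\<in>F'. small.Q (\<lambda>x. w x - v x) < \<epsilon>"
      using small.B_bilinear(2)[OF w w small.F_diff[OF w w], of 1] by (intro bexI[of _ w]) auto
  qed simp

  obtain \<rho> where \<rho>: "quasi_continuous \<mu> F' E' (\<lambda>x. ereal (\<rho> x))" "AE x in \<mu>. \<rho> x = h' x"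
    using version[OF R'.h_F] by blast
  define r where "r n x = real_of_ereal (v n x)" for n x
  \<comment> \<open>Closed sets with complements of small \<open>E'\<close>-capacity on which all versions are continuous and that of \<open>h'\<close>
    is positive.\<close>
  have "\<exists>S. closed S \<and> R'.thick S (1 / real (Suc n)) \<and> S \<subseteq> (\<Union>n. C0 n) \<and>
      continuous_on S \<rho> \<and> (\<forall>x\<in>S. 0 < \<rho> x) \<and> (\<forall>k. continuous_on S (r k) \<and> (\<forall>x\<in>S. \<bar>v k x\<bar> \<noteq> \<infinity>))" for n
  proof -
    \<comment> \<open>Two intersections lose the factor \<open>18\<close> each.\<close>
    define \<epsilon> where "\<epsilon> = 1 / (324 * real (Suc n))"
    have \<epsilon>: "0 < \<epsilon>" by (simp add: \<epsilon>_def)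
    define w where "w = case_nat (\<lambda>x. ereal (\<rho> x)) v"
    have "quasi_continuous \<mu> F' E' (w k)" for k
      using \<rho>(1) qc' u(2) by (cases k) (auto simp: w_def qc_version_def)
    from R'.common_continuity_set[of w, OF this \<epsilon>]
    obtain S0 where S0_all: "closed S0 \<and> R'.thick S0 \<epsilon> \<and>
      (\<forall>k. continuous_on S0 (\<lambda>x. real_of_ereal (w k x)) \<and> (\<forall>x\<in>S0. \<bar>w k x\<bar> \<noteq> \<infinity>))" ..
    then have S0: "closed S0" "R'.thick S0 \<epsilon>"
      "\<And>k. continuous_on S0 (\<lambda>x. real_of_ereal (w k x))" "\<And>k x. x \<in> S0 \<Longrightarrow> \<bar>w k x\<bar> \<noteq> \<infinity>" by simp_all
    have cont_\<rho>: "continuous_on S0 \<rho>" using S0(3)[of 0] by (simp add: w_def)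
    have cont_r: "continuous_on S0 (r k)" and fin: "\<And>x. x \<in> S0 \<Longrightarrow> \<bar>v k x\<bar> \<noteq> \<infinity>" for k
      using S0(3)[of "Suc k"] S0(4)[of _ "Suc k"] by (simp_all add: w_def r_def[abs_def])
    obtain k where k: "R'.thick (C0 k) \<epsilon>"
      using nest'[OF C0(1)] \<epsilon> unfolding R'.nest_iff_thick by blast
    obtain j where j: "R'.thick {x. 1 / real (Suc j) \<le> h' x} \<epsilon>"
      using R'.thick_superlevel_set[OF \<epsilon>] by blast
    have j': "R'.thick {x. 1 / real (Suc j) \<le> \<rho> x} \<epsilon>"
      by (rule R'.thick_AE_mono[OF j]) (use \<rho>(2) in \<open>auto elim: eventually_mono\<close>)
    define S where "S = {x \<in> S0. 1 / real (Suc j) \<le> \<rho> x} \<inter> C0 k"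
    have "R'.thick (S0 \<inter> (C0 k \<inter> {x. 1 / real (Suc j) \<le> \<rho> x})) (18 * (18 * \<epsilon>))"
      using R'.thick_mono[OF S0(2), of S0 "18 * \<epsilon>"] \<epsilon> by (intro R'.thick_Int k j') auto
    then have "R'.thick S (1 / real (Suc n))"
      by (rule R'.thick_mono) (auto simp: S_def \<epsilon>_def field_simps)
    moreover have "closed S"
      unfolding S_def using C0(1) S0(1) cont_\<rho>
      by (intro closed_Int continuous_on_closed_Collect_le continuous_intros) (auto simp: nest_def)
    moreover have "S \<subseteq> (\<Union>n. C0 n)" "S \<subseteq> S0" by (auto simp: S_def)
    moreover have "\<forall>x\<in>S. 0 < \<rho> x"
    proof
      fix x assume "x \<in> S"
      then have "1 / real (Suc j) \<le> \<rho> x" by (simp add: S_def)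
      then show "0 < \<rho> x" by (rule less_le_trans[rotated]) simp
    qed
    moreover have "continuous_on S \<rho>" "\<And>k. continuous_on S (r k)"
      using cont_\<rho> cont_r \<open>S \<subseteq> S0\<close> by (auto intro: continuous_on_subset)
    moreover have "\<forall>x\<in>S. \<bar>v k x\<bar> \<noteq> \<infinity>" for k
      using fin \<open>S \<subseteq> S0\<close> by (intro ballI) (rule fin, rule subsetD)
    ultimately show ?thesis by (intro exI[of _ S] conjI allI) assumption+
  qed
  then have "\<exists>S. \<forall>n. closed (S n) \<and> R'.thick (S n) (1 / real (Suc n)) \<and> S n \<subseteq> (\<Union>n. C0 n) \<and>
      continuous_on (S n) \<rho> \<and> (\<forall>x\<in>S n. 0 < \<rho> x) \<and>
      (\<forall>k. continuous_on (S n) (r k) \<and> (\<forall>x\<in>S n. \<bar>v k x\<bar> \<noteq> \<infinity>))"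
    by (intro choice allI)
  then obtain S where S_all: "\<forall>n. closed (S n) \<and> R'.thick (S n) (1 / real (Suc n)) \<and> S n \<subseteq> (\<Union>n. C0 n) \<and>
      continuous_on (S n) \<rho> \<and> (\<forall>x\<in>S n. 0 < \<rho> x) \<and>
      (\<forall>k. continuous_on (S n) (r k) \<and> (\<forall>x\<in>S n. \<bar>v k x\<bar> \<noteq> \<infinity>))" ..
  then have S: "\<And>n. closed (S n)" "\<And>n. R'.thick (S n) (1 / real (Suc n))" "\<And>n. S n \<subseteq> (\<Union>n. C0 n)"
    "\<And>n. continuous_on (S n) \<rho>" "\<And>n x. x \<in> S n \<Longrightarrow> 0 < \<rho> x"
    "\<And>n k. continuous_on (S n) (r k)" "\<And>n k x. x \<in> S n \<Longrightarrow> \<bar>v k x\<bar> \<noteq> \<infinity>"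
    by simp_all
  define C1 where "C1 n = (\<Union>i\<le>n. S i)" for n
  have C1: "nest \<mu> F' E' C1"
    unfolding C1_def[abs_def] by (rule R'.nest_of_thick_sequence[OF S(1,2)])

  \<comment> \<open>Cutting off at \<open>h'\<close> brings \<open>(u\<^sub>n - q)\<^sup>+\<close> and \<open>(- u\<^sub>n - q)\<^sup>+\<close> into \<open>F'\<close>. The two signs are needed because
    only levels \<open>q \<ge> 0\<close> are admissible.\<close>
  define sg :: "bool \<Rightarrow> real" where "sg b = (if b then 1 else -1)" for b
  define cut where "cut a \<gamma> q b x = min (\<gamma> x) (max (sg b * a x - \<bar>real_of_rat q\<bar>) 0)"
    for a \<gamma> :: "'a \<Rightarrow> real" and q b x
  have cut_F: "cut (u n) h' q b \<in> F'" for n q b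
  proof -
    have 1: "(\<lambda>x. max (sg b * u n x - \<bar>real_of_rat q\<bar>) 0) \<in> F"
      by (intro big.excess_F big.F_scale u) simp
    have "cut (u n) h' q b \<in> F"
      unfolding cut_def[abs_def] by (rule big.min_F(1)[OF small_subset_big[OF R'.h_F] 1])
    moreover have "AE x in \<mu>. 0 \<le> cut (u n) h' q b x \<and> cut (u n) h' q b x \<le> h' x"
      using R'.h_nonneg by eventually_elim (auto simp: cut_def)
    ultimately show ?thesis using order_ideal R'.h_F by blast
  qed
  have cut_qc: "qc_version \<mu> F' E' (cut (u n) h' q b) (\<lambda>x. ereal (cut (r n) \<rho> q b x))" for n q b
    unfolding qc_version_def quasi_continuous_def
  proof (intro conjI exI[of _ C1] allI C1)
    fix k
    show "\<forall>x\<in>C1 k. \<bar>ereal (cut (r n) \<rho> q b x)\<bar> \<noteq> \<infinity>" by simp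
    show "continuous_on (C1 k) (\<lambda>x. ereal (cut (r n) \<rho> q b x))"
      unfolding C1_def cut_def using S(1,4,6)
      by (intro continuous_on_ereal continuous_on_closed_Union continuous_intros) auto
  next
    have "AE x in \<mu>. v n x = ereal (u n x)" using u(2) by (simp add: qc_version_def)
    then show "AE x in \<mu>. ereal (cut (r n) \<rho> q b x) = ereal (cut (u n) h' q b x)"
      using \<rho>(2) by eventually_elim (simp add: cut_def r_def)
  qed
  define ix :: "nat \<Rightarrow> nat \<times> rat \<times> bool" where "ix = from_nat"
  define u' where "u' k = (case ix k of (n, q, b) \<Rightarrow> cut (u n) h' q b)" for k
  define v' where "v' k = (case ix k of (n, q, b) \<Rightarrow> (\<lambda>x. ereal (cut (r n) \<rho> q b x)))" for k
  have separates: "\<exists>k. v' k x \<noteq> v' k y"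
    if x: "x \<notin> - (\<Union>n. C1 n)" and y: "y \<notin> - (\<Union>n. C1 n)" and "x \<noteq> y" for x y
  proof -
    obtain i j where ij: "x \<in> S i" "y \<in> S j" using x y by (auto simp: C1_def)
    have "x \<notin> N" "y \<notin> N" using ij S(3) C0(2) by blast+
    then obtain n where "v n x \<noteq> v n y" using sep \<open>x \<noteq> y\<close> by blast
    then have ne: "r n x \<noteq> r n y"
      using S(7)[OF ij(1), of n] S(7)[OF ij(2), of n] unfolding r_def by (metis ereal_real)
    have pos: "0 < \<rho> x" "0 < \<rho> y" using S(5) ij by auto
    have ordered: "\<exists>q b. cut (r n) \<rho> q b s \<noteq> cut (r n) \<rho> q b t"
      if lt: "r n s < r n t" and pos: "0 < \<rho> s" "0 < \<rho> t" for s t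
    proof -
      obtain q where q: "r n s < real_of_rat q" "real_of_rat q < r n t"
        using of_rat_dense[OF lt] by blast
      show ?thesis
      proof (cases "0 \<le> real_of_rat q")
        case True
        then have "cut (r n) \<rho> q True s = 0" "0 < cut (r n) \<rho> q True t"
          using q pos by (auto simp: cut_def sg_def abs_if max_def min_def of_rat_minus)
        then show ?thesis by (metis less_irrefl)
      next
        case False
        then have "0 < cut (r n) \<rho> q False s" "cut (r n) \<rho> q False t = 0"
          using q pos by (auto simp: cut_def sg_def abs_if max_def min_def of_rat_minus)
        then show ?thesis by (metis less_irrefl)
      qed
    qed
    obtain q b where qb: "cut (r n) \<rho> q b x \<noteq> cut (r n) \<rho> q b y"
    proof (cases "r n x < r n y")
      case True
      then show ?thesis using ordered[OF _ pos] that by blast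
    next
      case False
      then have "r n y < r n x" using ne by simp
      then show ?thesis using ordered[OF _ pos(2,1)] that by metis
    qed
    have "v' (to_nat (n, q, b)) x \<noteq> v' (to_nat (n, q, b)) y" using qb by (simp add: v'_def ix_def)
    then show ?thesis ..
  qed
  show ?thesis
    unfolding quasi_regular_def
  proof (intro conjI)
    show "\<exists>C. nest \<mu> F' E' C \<and> (\<forall>n. compact (C n))" using nest'[OF C(1)] C(2) by blast
    show "\<exists>D. form_dense \<mu> F' E' D \<and> (\<forall>u\<in>D. \<exists>v. qc_version \<mu> F' E' u v)"
    proof (intro exI[of _ F'] conjI dense' ballI)
      fix w assume "w \<in> F'"
      then obtain r where "quasi_continuous \<mu> F' E' (\<lambda>x. ereal (r x))" "AE x in \<mu>. r x = w x"
        using version by blast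
      then show "\<exists>v. qc_version \<mu> F' E' w v"
        by (intro exI[of _ "\<lambda>x. ereal (r x)"]) (simp add: qc_version_def)
    qed
    show "\<exists>(u :: nat \<Rightarrow> 'a \<Rightarrow> real) v N. polar \<mu> F' E' N \<and> (\<forall>n. u n \<in> F' \<and> qc_version \<mu> F' E' (u n) (v n)) \<and>
        (\<forall>x y. x \<notin> N \<and> y \<notin> N \<and> x \<noteq> y \<longrightarrow> (\<exists>n. v n x \<noteq> v n y))"
    proof (intro exI[of _ u'] exI[of _ v'] exI[of _ "- (\<Union>n. C1 n)"] conjI allI)
      show "polar \<mu> F' E' (- (\<Union>n. C1 n))" unfolding polar_def using C1 by blast
      show "u' n \<in> F'" "qc_version \<mu> F' E' (u' n) (v' n)" for n
        using cut_F cut_qc by (auto simp: u'_def v'_def split: prod.split)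
      show "x \<notin> - (\<Union>n. C1 n) \<and> y \<notin> - (\<Union>n. C1 n) \<and> x \<noteq> y \<longrightarrow> (\<exists>n. v' n x \<noteq> v' n y)" for x y
        using separates by blast
    qed
  qed
qed

section \<open>Forms on a set of full measure\<close>

lemma L2_contraction_semigroup_AE_cong:
  assumes T: "L2_contraction_semigroup \<mu> T" and t: "0 \<le> t"
    and f: "f \<in> L2 \<mu>" "g \<in> L2 \<mu>" "AE x in \<mu>. f x = g x"
  shows "AE x in \<mu>. T t f x = T t g x"
proof -
  define d where "d x = 1 * f x + (-1) * g x" for x
  have dL: "d \<in> L2 \<mu>" unfolding d_def[abs_def] by (rule L2_lin[OF f(1,2)])
  have TdL: "T t d \<in> L2 \<mu>" and le: "(\<integral>x. (T t d x)\<^sup>2 \<partial>\<mu>) \<le> (\<integral>x. (d x)\<^sup>2 \<partial>\<mu>)"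
    using T t dL by (auto simp: L2_contraction_semigroup_def)
  have "(\<integral>x. (d x)\<^sup>2 \<partial>\<mu>) = (\<integral>x. 0 \<partial>\<mu>)"
  proof (rule integral_cong_AE)
    show "AE x in \<mu>. (d x)\<^sup>2 = 0" using f(3) by eventually_elim (simp add: d_def)
  qed (use L2_measurable[OF dL] in measurable)
  then have "AE x in \<mu>. T t d x = 0"
    using le by (intro L2_sq_eq_0_AE[OF TdL]) (simp add: L2_inner_def power2_eq_square)
  moreover have "AE x in \<mu>. T t d x = 1 * T t f x + (-1) * T t g x"
    using T t f(1,2) unfolding L2_contraction_semigroup_def d_def[abs_def] by blast
  ultimately show ?thesis by eventually_elim simp
qed

text \<open>
  \<open>A\<close> need not be in \<open>sets m\<close>; functions on \<open>N\<close> are measurable for the completion and have to be replaced by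
  representatives that are measurable for \<open>m\<close>.
\<close>

locale conull_restriction =
  fixes m :: "'a measure" and A :: "'a set"
  assumes subset: "A \<subseteq> space m" and conull: "space m - A \<in> null_sets (completion m)"
begin

abbreviation N :: "'a measure" where
  "N \<equiv> restrict_space (completion m) A"

lemma A_sets: "A \<in> sets (completion m)"
proof -
  have "space (completion m) - (space m - A) \<in> sets (completion m)"
    using conull by (intro sets.compl_sets null_setsD2)
  moreover have "space (completion m) - (space m - A) = A" using subset by auto
  ultimately show ?thesis by simp
qed

lemma A_Int: "A \<inter> space (completion m) \<in> sets (completion m)"
  using A_sets by (rule sets.Int) simp

lemma AE_A: "AE x in m. x \<in> A"
proof -
  have "AE x in completion m. x \<notin> space m - A" by (rule AE_not_in[OF conull])
  then have "AE x in completion m. x \<in> A" using AE_space by eventually_elim auto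
  then show ?thesis by (simp add: AE_completion_iff)
qed

lemma AE_iff: "(AE x in N. P x) \<longleftrightarrow> (AE x in m. P x)"
proof -
  have "(AE x in N. P x) \<longleftrightarrow> (AE x in completion m. x \<in> A \<longrightarrow> P x)"
    by (rule AE_restrict_space_iff[OF A_Int])
  also have "\<dots> \<longleftrightarrow> (AE x in m. x \<in> A \<longrightarrow> P x)" by (simp add: AE_completion_iff)
  also have "\<dots> \<longleftrightarrow> (AE x in m. P x)" using AE_A by (auto elim: eventually_elim2)
  finally show ?thesis .
qed

lemma measurable_N: "f \<in> borel_measurable m \<Longrightarrow> f \<in> borel_measurable N" for f :: "'a \<Rightarrow> real"
  by (intro measurable_restrict_space1 measurable_completion)

lemma integral_N:
  fixes f :: "'a \<Rightarrow> real"
  assumes [measurable]: "f \<in> borel_measurable m"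
  shows "integrable N f \<longleftrightarrow> integrable m f" "integral\<^sup>L N f = integral\<^sup>L m f"
proof -
  have meas: "f \<in> borel_measurable (completion m)"
    "(\<lambda>x. indicator A x *\<^sub>R f x) \<in> borel_measurable (completion m)"
    using A_sets measurable_completion[OF assms] by (auto intro: borel_measurable_scaleR borel_measurable_indicator)
  have AE: "AE x in completion m. indicator A x *\<^sub>R f x = f x"
    using AE_A by (auto simp: AE_completion_iff elim: eventually_mono)
  have "integrable N f \<longleftrightarrow> integrable (completion m) (\<lambda>x. indicator A x *\<^sub>R f x)"
    by (rule integrable_restrict_space[OF A_Int])
  also have "\<dots> \<longleftrightarrow> integrable (completion m) f" using meas AE by (intro integrable_cong_AE) auto
  also have "\<dots> \<longleftrightarrow> integrable m f" by (rule integrable_completion[OF assms])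
  finally show "integrable N f \<longleftrightarrow> integrable m f" .
  have "integral\<^sup>L N f = integral\<^sup>L (completion m) (\<lambda>x. indicator A x *\<^sub>R f x)"
    by (rule integral_restrict_space[OF A_Int])
  also have "\<dots> = integral\<^sup>L (completion m) f" using meas AE by (intro integral_cong_AE) auto
  also have "\<dots> = integral\<^sup>L m f" by (rule integral_completion[OF assms])
  finally show "integral\<^sup>L N f = integral\<^sup>L m f" .
qed

lemma L2_N: "f \<in> L2 m \<Longrightarrow> f \<in> L2 N"
  by (auto simp: L2_def measurable_N integral_N)

lemma L2_inner_N: "f \<in> L2 m \<Longrightarrow> g \<in> L2 m \<Longrightarrow> L2_inner N f g = L2_inner m f g"
  unfolding L2_inner_def by (intro integral_N borel_measurable_times L2_measurable)

lemma shifted_form_N: "f \<in> L2 m \<Longrightarrow> g \<in> L2 m \<Longrightarrow> shifted_form N E \<alpha> f g = shifted_form m E \<alpha> f g"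
  by (simp add: shifted_form_def L2_inner_N)

lemma L2_N_version:
  assumes "f \<in> L2 N"
  shows "\<exists>g\<in>L2 m. AE x in m. f x = g x"
proof -
  have "f \<in> borel_measurable N" by (rule L2_measurable[OF assms])
  then have "(\<lambda>x. indicator A x *\<^sub>R f x) \<in> borel_measurable (completion m)"
    using borel_measurable_restrict_space_iff[OF A_Int] by blast
  then obtain g where g: "g \<in> borel_measurable m" "AE x in m. indicator A x *\<^sub>R f x = g x"
    using completion_ex_borel_measurable_real by blast
  have fg: "AE x in m. f x = g x" using g(2) AE_A by eventually_elim simp
  have "g \<in> L2 N"
  proof (rule L2_dominated[OF measurable_N[OF g(1)] assms])
    show "AE x in N. \<bar>g x\<bar> \<le> \<bar>f x\<bar>" unfolding AE_iff using fg by eventually_elim simp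
  qed
  then have "g \<in> L2 m" using g(1) by (simp add: L2_def integral_N)
  then show ?thesis using fg by blast
qed

end

locale form_on_conull = conull_restriction +
  fixes FM :: "('a \<Rightarrow> real) set" and EM :: "('a \<Rightarrow> real) \<Rightarrow> ('a \<Rightarrow> real) \<Rightarrow> real"
  assumes dirichlet_N: "dirichlet_form N FM EM"
begin

sublocale dirichlet N FM EM
  using dirichlet_N by unfold_locales (auto simp: dirichlet_form_def)

abbreviation F0 :: "('a \<Rightarrow> real) set" where
  "F0 \<equiv> domain_on_E m FM"

lemma F0_iff: "f \<in> F0 \<longleftrightarrow> f \<in> L2 m \<and> f \<in> FM"
  by (simp add: domain_on_E_def)

lemma F0_version:
  assumes "f \<in> FM"
  shows "\<exists>g\<in>F0. AE x in m. f x = g x"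
proof -
  obtain g where g: "g \<in> L2 m" "AE x in m. f x = g x"
    using L2_N_version[OF F_L2[OF assms]] by blast
  then have "g \<in> FM" using F_AE_cong[OF assms L2_N] by (simp add: AE_iff)
  then show ?thesis using g F0_iff by blast
qed

lemma bilinear_F0: "bilinear_form m F0 EM"
proof -
  have "E u w = E v w \<and> E w u = E w v"
    if "bilinear_form N FM E" "u \<in> FM" "v \<in> L2 N" "AE x in N. u x = v x" "w \<in> FM" for u v w E
    using that unfolding bilinear_form_def by blast
  note cong = this[OF bilinear]
  have lin: "EM (\<lambda>x. a * u x + b * v x) w = a * EM u w + b * EM v w \<and>
      EM w (\<lambda>x. a * u x + b * v x) = a * EM w u + b * EM w v"
    if "u \<in> FM" "v \<in> FM" "w \<in> FM" for u v w a b
    using bilinear that unfolding bilinear_form_def by blast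
  have zero: "(\<lambda>x. 0) \<in> L2 m" by (simp add: L2_def)
  show ?thesis
    unfolding bilinear_form_def
  proof (intro conjI ballI allI impI)
    fix u v assume uv: "u \<in> F0" "v \<in> L2 m" "AE x in m. u x = v x"
    then show "v \<in> F0"
      using F_AE_cong[OF _ L2_N, of u v] by (simp add: F0_iff AE_iff)
    fix w assume "w \<in> F0"
    then show "EM u w = EM v w" "EM w u = EM w v"
      using cong[of u v w] uv by (simp_all add: F0_iff AE_iff L2_N)
  qed (use lin zero F_zero F_lin L2_lin in \<open>auto simp: F0_iff\<close>)
qed

lemma coercive_closed_F0: "coercive_closed_form m F0 EM"
  unfolding coercive_closed_form_def
proof (intro conjI bilinear_F0 ballI allI impI)
  fix f and \<epsilon> :: real assume f: "f \<in> L2 m" and "0 < \<epsilon>"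
  then obtain u where u: "u \<in> FM" "(\<integral>x. (f x - u x)\<^sup>2 \<partial>N) < \<epsilon>"
    using coercive_closed L2_N unfolding coercive_closed_form_def by blast
  obtain v where v: "v \<in> F0" "AE x in m. u x = v x" using F0_version[OF u(1)] by blast
  have vL: "v \<in> L2 m" using v by (simp add: F0_iff)
  note [measurable] = L2_measurable[OF f] L2_measurable[OF vL] F_measurable[OF u(1)] measurable_N[OF L2_measurable[OF f]]
    measurable_N[OF L2_measurable[OF vL]]
  have "(\<integral>x. (f x - v x)\<^sup>2 \<partial>m) = (\<integral>x. (f x - v x)\<^sup>2 \<partial>N)"
    by (intro integral_N(2)[symmetric]) measurable
  also have "\<dots> = (\<integral>x. (f x - u x)\<^sup>2 \<partial>N)"
    using v(2) by (intro integral_cong_AE) (auto simp: AE_iff)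
  finally show "\<exists>u\<in>F0. (\<integral>x. (f x - u x)\<^sup>2 \<partial>m) < \<epsilon>"
    using u(2) v(1) by (intro bexI[of _ v]) simp_all
next
  fix u assume "u \<in> F0"
  then show "0 \<le> EM u u" using E_diag_nonneg[of u] by (simp add: F0_iff shifted_form_def)
next
  fix u :: "nat \<Rightarrow> 'a \<Rightarrow> real"
  assume u: "(\<forall>n. u n \<in> F0) \<and> (\<forall>\<epsilon>>0. \<exists>N. \<forall>i\<ge>N. \<forall>j\<ge>N.
    shifted_form m EM 1 (\<lambda>x. u i x - u j x) (\<lambda>x. u i x - u j x) < \<epsilon>)"
  have uF: "u n \<in> FM" and uL: "u n \<in> L2 m" for n using u by (auto simp: F0_iff)
  have "\<exists>N. \<forall>i\<ge>N. \<forall>j\<ge>N. Q (\<lambda>x. u i x - u j x) < \<epsilon>" if "0 < \<epsilon>" for \<epsilon>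
    using u that by (simp add: shifted_form_N L2_diff uL)
  then obtain v where v: "v \<in> FM" "(\<lambda>n. Q (\<lambda>x. u n x - v x)) \<longlonglongrightarrow> 0"
    using F_complete[of u] uF by blast
  obtain w where w: "w \<in> F0" "AE x in m. v x = w x" using F0_version[OF v(1)] by blast
  have wF: "w \<in> FM" and wL: "w \<in> L2 m" using w by (auto simp: F0_iff)
  have "Q (\<lambda>x. u n x - v x) = shifted_form m EM 1 (\<lambda>x. u n x - w x) (\<lambda>x. u n x - w x)" for n
  proof -
    have "AE x in N. u n x - v x = u n x - w x" unfolding AE_iff using w(2) by eventually_elim simp
    then have "Q (\<lambda>x. u n x - v x) = Q (\<lambda>x. u n x - w x)"
      by (rule Q_AE_cong[OF F_diff[OF uF v(1)] F_diff[OF uF wF]])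
    then show ?thesis by (simp add: shifted_form_N L2_diff uL wL)
  qed
  then show "\<exists>v\<in>F0. (\<lambda>n. shifted_form m EM 1 (\<lambda>x. u n x - v x) (\<lambda>x. u n x - v x)) \<longlonglongrightarrow> 0"
    using v(2) w(1) by auto
next
  obtain K where K: "\<And>u v. u \<in> FM \<Longrightarrow> v \<in> FM \<Longrightarrow> \<bar>B 1 u v\<bar> \<le> K * sqrt (Q u) * sqrt (Q v)"
    using coercive_closed unfolding coercive_closed_form_def by blast
  have "\<bar>shifted_form m EM 1 u v\<bar> \<le> K * sqrt (shifted_form m EM 1 u u) * sqrt (shifted_form m EM 1 v v)"
    if "u \<in> F0" "v \<in> F0" for u v
    using K[of u v] that by (simp add: F0_iff shifted_form_N)
  then show "\<exists>K. \<forall>u\<in>F0. \<forall>v\<in>F0. \<bar>shifted_form m EM 1 u v\<bar> \<le>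
      K * sqrt (shifted_form m EM 1 u u) * sqrt (shifted_form m EM 1 v v)" by blast
qed

lemma dirichlet_F0: "dirichlet_form m F0 EM"
  unfolding dirichlet_form_def
proof (intro conjI coercive_closed_F0 ballI)
  fix u assume u: "u \<in> F0"
  have "unit_contraction u \<in> L2 m"
  proof (rule L2_dominated)
    show "u \<in> L2 m" using u by (simp add: F0_iff)
    then show "unit_contraction u \<in> borel_measurable m"
      unfolding unit_contraction_def[abs_def] using L2_measurable by measurable
  qed (auto simp: unit_contraction_def)
  then show "unit_contraction u \<in> F0"
    using u dirichlet_N by (simp add: F0_iff dirichlet_form_def)
  show "0 \<le> EM (\<lambda>x. u x + unit_contraction u x) (\<lambda>x. u x - unit_contraction u x)"
    "0 \<le> EM (\<lambda>x. u x - unit_contraction u x) (\<lambda>x. u x + unit_contraction u x)"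
    using u dirichlet_N by (auto simp: F0_iff dirichlet_form_def)
qed

lemma semigroup_F0:
  assumes T: "form_semigroup N FM EM T"
  shows "\<exists>S. form_semigroup m F0 EM S \<and> (\<forall>t\<ge>0. \<forall>f\<in>L2 m. AE x in m. S t f x = T t f x)"
proof -
  have Tc: "L2_contraction_semigroup N T" using T by (simp add: form_semigroup_def)
  have TL: "T t f \<in> L2 N" if "0 \<le> t" "f \<in> L2 N" for t f
    using Tc that by (simp add: L2_contraction_semigroup_def)
  have T_cong: "AE x in m. T t f x = T t g x" if "0 \<le> t" "f \<in> L2 N" "g \<in> L2 N" "AE x in m. f x = g x" for t f g
    using L2_contraction_semigroup_AE_cong[OF Tc that(1-3)] that(4) by (simp add: AE_iff)
  define S where "S t f = (SOME g. g \<in> L2 m \<and> (AE x in m. T t f x = g x))" for t f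
  have S: "S t f \<in> L2 m \<and> (AE x in m. T t f x = S t f x)" if "0 \<le> t" "f \<in> L2 m" for t f
    unfolding S_def
    by (rule someI_ex[of "\<lambda>g. g \<in> L2 m \<and> (AE x in m. T t f x = g x)"]) (use L2_N_version[OF TL[OF that(1) L2_N[OF that(2)]]] in blast)
  have SL: "S t f \<in> L2 m" if "0 \<le> t" "f \<in> L2 m" for t f using S[OF that] by simp
  have SN: "S t f \<in> L2 N" if "0 \<le> t" "f \<in> L2 m" for t f by (rule L2_N[OF SL[OF that]])
  have ST: "AE x in m. S t f x = T t f x" if "0 \<le> t" "f \<in> L2 m" for t f
    using conjunct2[OF S[OF that]] by eventually_elim simp
  have sq: "(\<integral>x. (S t f x - c * f x)\<^sup>2 \<partial>m) = (\<integral>x. (T t f x - c * f x)\<^sup>2 \<partial>N)" if "0 \<le> t" "f \<in> L2 m" for t f c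
  proof -
    note [measurable] = L2_measurable[OF SL[OF that]] L2_measurable[OF that(2)] L2_measurable[OF SN[OF that]]
      L2_measurable[OF L2_N[OF that(2)]] L2_measurable[OF TL[OF that(1) L2_N[OF that(2)]]]
    have "(\<integral>x. (S t f x - c * f x)\<^sup>2 \<partial>m) = (\<integral>x. (S t f x - c * f x)\<^sup>2 \<partial>N)"
      by (intro integral_N(2)[symmetric]) measurable
    also have "\<dots> = (\<integral>x. (T t f x - c * f x)\<^sup>2 \<partial>N)"
      using ST[OF that] by (intro integral_cong_AE) (auto simp: AE_iff)
    finally show ?thesis .
  qed
  have inner: "L2_inner m (S t f) k = L2_inner N (T t f) k" if "0 \<le> t" "f \<in> L2 m" "k \<in> L2 m" for t f k
  proof -
    have "L2_inner m (S t f) k = L2_inner N (S t f) k" by (rule L2_inner_N[symmetric, OF SL[OF that(1,2)] that(3)])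
    also have "\<dots> = L2_inner N (T t f) k"
      using ST[OF that(1,2)] TL SN L2_N that
      by (intro L2_inner_cong_AE L2_measurable) (simp_all add: AE_iff)
    finally show ?thesis .
  qed
  have semi: "L2_contraction_semigroup m S"
    unfolding L2_contraction_semigroup_def
  proof (intro conjI ballI allI impI)
    fix t :: real and f assume t: "0 \<le> t" and f: "f \<in> L2 m"
    show "S t f \<in> L2 m" by (rule SL[OF t f])
    have "(\<integral>x. (T t f x)\<^sup>2 \<partial>N) \<le> (\<integral>x. (f x)\<^sup>2 \<partial>N)"
      using Tc t L2_N[OF f] by (simp add: L2_contraction_semigroup_def)
    moreover have "(\<integral>x. (f x)\<^sup>2 \<partial>N) = (\<integral>x. (f x)\<^sup>2 \<partial>m)"
      using L2_measurable[OF f] by (intro integral_N(2)) measurable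
    ultimately show "(\<integral>x. (S t f x)\<^sup>2 \<partial>m) \<le> (\<integral>x. (f x)\<^sup>2 \<partial>m)" using sq[OF t f, of 0] by simp
  next
    fix t :: real and f g a b assume t: "0 \<le> t" and f: "f \<in> L2 m" and g: "g \<in> L2 m"
    have "AE x in N. T t (\<lambda>y. a * f y + b * g y) x = a * T t f x + b * T t g x"
      using Tc t L2_N[OF f] L2_N[OF g] unfolding L2_contraction_semigroup_def by blast
    then show "AE x in m. S t (\<lambda>y. a * f y + b * g y) x = a * S t f x + b * S t g x"
      using ST[OF t L2_lin[OF f g, of a b]] ST[OF t f] ST[OF t g] unfolding AE_iff by eventually_elim simp
  next
    fix f assume f: "f \<in> L2 m"
    have "AE x in N. T 0 f x = f x" using Tc L2_N[OF f] by (simp add: L2_contraction_semigroup_def)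
    then show "AE x in m. S 0 f x = f x" using ST[OF order_refl f] unfolding AE_iff by eventually_elim simp
    have "((\<lambda>t. \<integral>x. (T t f x - f x)\<^sup>2 \<partial>N) \<longlongrightarrow> 0) (at_right 0)"
      using Tc L2_N[OF f] by (simp add: L2_contraction_semigroup_def)
    moreover have "\<forall>\<^sub>F t in at_right 0. (\<integral>x. (T t f x - f x)\<^sup>2 \<partial>N) = (\<integral>x. (S t f x - f x)\<^sup>2 \<partial>m)"
      using eventually_at_right_less[of "0::real"] by eventually_elim (use sq[OF _ f, of _ 1] in simp)
    ultimately show "((\<lambda>t. \<integral>x. (S t f x - f x)\<^sup>2 \<partial>m) \<longlongrightarrow> 0) (at_right 0)"
      by (rule Lim_transform_eventually)
  next
    fix s t :: real and f assume s: "0 \<le> s" and t: "0 \<le> t" and f: "f \<in> L2 m"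
    have "AE x in N. T (s + t) f x = T s (T t f) x"
      using Tc s t L2_N[OF f] by (simp add: L2_contraction_semigroup_def)
    moreover have "AE x in m. T s (S t f) x = T s (T t f) x"
      by (rule T_cong[OF s SN[OF t f] TL[OF t L2_N[OF f]] ST[OF t f]])
    ultimately show "AE x in m. S (s + t) f x = S s (S t f) x"
      using ST[OF add_nonneg_nonneg[OF s t] f] ST[OF s SL[OF t f]] unfolding AE_iff by eventually_elim simp
  qed
  have "form_semigroup m F0 EM S"
    unfolding form_semigroup_def
  proof (intro conjI semi allI impI ballI)
    fix \<alpha> :: real and f assume \<alpha>: "0 < \<alpha>" and f: "f \<in> L2 m"
    obtain g where g: "g \<in> FM"
      "\<And>k. k \<in> L2 N \<Longrightarrow> ((\<lambda>t. exp (- \<alpha> * t) * L2_inner N (T t f) k) has_integral L2_inner N g k) {0..}"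
      "\<And>u. u \<in> FM \<Longrightarrow> B \<alpha> g u = L2_inner N f u"
      using T \<alpha> L2_N[OF f] unfolding form_semigroup_def by blast
    obtain k where k: "k \<in> F0" "AE x in m. g x = k x" using F0_version[OF g(1)] by blast
    have kF: "k \<in> FM" and kL: "k \<in> L2 m" using k(1) by (auto simp: F0_iff)
    have gk: "AE x in N. g x = k x" using k(2) by (simp add: AE_iff)
    show "\<exists>g\<in>F0. (\<forall>h\<in>L2 m. ((\<lambda>t. exp (- \<alpha> * t) * L2_inner m (S t f) h) has_integral L2_inner m g h) {0..}) \<and>
        (\<forall>u\<in>F0. shifted_form m EM \<alpha> g u = L2_inner m f u)"
    proof (intro bexI[OF _ k(1)] conjI ballI)
      fix h assume h: "h \<in> L2 m"
      have "L2_inner N g h = L2_inner N k h"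
        using gk by (intro L2_inner_cong_AE F_measurable g(1) kF L2_measurable[OF L2_N[OF h]]) simp_all
      also have "\<dots> = L2_inner m k h" by (rule L2_inner_N[OF kL h])
      finally have "L2_inner N g h = L2_inner m k h" .
      then have "((\<lambda>t. exp (- \<alpha> * t) * L2_inner N (T t f) h) has_integral L2_inner m k h) {0..}"
        using g(2)[OF L2_N[OF h]] by simp
      then show "((\<lambda>t. exp (- \<alpha> * t) * L2_inner m (S t f) h) has_integral L2_inner m k h) {0..}"
        by (rule has_integral_eq[rotated]) (simp add: inner f h)
    next
      fix u assume u: "u \<in> F0"
      then have uF: "u \<in> FM" and uL: "u \<in> L2 m" by (auto simp: F0_iff)
      have "shifted_form m EM \<alpha> k u = B \<alpha> k u" by (rule shifted_form_N[OF kL uL, symmetric])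
      also have "\<dots> = B \<alpha> g u" by (rule B_AE_cong(1)[OF g(1) kF gk uF, symmetric])
      also have "\<dots> = L2_inner N f u" by (rule g(3)[OF uF])
      also have "\<dots> = L2_inner m f u" by (rule L2_inner_N[OF f uL])
      finally show "shifted_form m EM \<alpha> k u = L2_inner m f u" .
    qed
  qed
  then show ?thesis using ST by blast
qed

end

section \<open>Killing by a multiplicative functional\<close>

lemma subprocess_transition_le:
  assumes "\<And>\<omega>. M t \<omega> \<le> 1"
  shows "subprocess_transition X P M t f x \<le> transition X P t f x"
  unfolding subprocess_transition_def transition_def
proof (rule nn_integral_mono)
  fix \<omega>
  have "ennreal (M t \<omega>) \<le> 1" using assms[of \<omega>] by (simp add: ennreal_le_1)
  from mult_left_mono[OF this, of "case_option 0 f (X t \<omega>)"]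
  show "case_option 0 f (X t \<omega>) * ennreal (M t \<omega>) \<le> case_option 0 f (X t \<omega>)" by simp
qed

theorem corollary3p16:
  fixes m :: "'e::t2_space measure"
    and F FM :: "('e \<Rightarrow> real) set"
    and E EM :: "('e \<Rightarrow> real) \<Rightarrow> ('e \<Rightarrow> real) \<Rightarrow> real"
    and X :: "real \<Rightarrow> 'w \<Rightarrow> 'e option"
    and \<theta> :: "real \<Rightarrow> 'w \<Rightarrow> 'w"
    and P :: "'e option \<Rightarrow> 'w measure"
    and M :: "real \<Rightarrow> 'w \<Rightarrow> real"
  assumes "lusin_space (euclidean :: 'e topology)"
    and "sets (borel :: 'e measure) = sigma_continuous"
    and "sets m = sets borel" and "sigma_finite_measure m"
    and "\<And>U. open U \<Longrightarrow> U \<noteq> {} \<Longrightarrow> emeasure m U > 0"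
    and "dirichlet_form m F E" and "quasi_regular m F E"
    and "borel_right_process X \<theta> P" and "m_tight m X P" and "properly_associated m F E X P"
    and "M \<in> MF X \<theta> P" and "- permanent_points P M \<in> null_sets (completion m)"
    and "subprocess_form m X P M FM EM"
  shows "dominated_form m (domain_on_E m FM) EM F E \<and>
         dirichlet_form m (domain_on_E m FM) EM \<and>
         quasi_regular m (domain_on_E m FM) EM"
proof -
  have space: "space m = UNIV" using sets_eq_imp_space_eq[OF assms(3)] by simp
  have N_eq: "subprocess_measure m P M = restrict_space (completion m) (permanent_points P M)"
    by (rule subprocess_measure_def)
  interpret form_on_conull m "permanent_points P M" FM EM
  proof
    show "permanent_points P M \<subseteq> space m" by (simp add: space)
    show "space m - permanent_points P M \<in> null_sets (completion m)"
      using assms(12) by (simp add: space Compl_eq_Diff_UNIV)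
    show "dirichlet_form (restrict_space (completion m) (permanent_points P M)) FM EM"
      using assms(13) unfolding subprocess_form_def N_eq by (elim conjE)
  qed
  obtain TM where TM: "form_semigroup N FM EM TM"
    and TM_sub: "\<And>t f. 0 \<le> t \<Longrightarrow> f \<in> L2 N \<Longrightarrow> f \<in> borel_measurable borel \<Longrightarrow> (\<And>x. 0 \<le> f x) \<Longrightarrow>
      AE x in N. enn2ereal (subprocess_transition X P M t (\<lambda>y. ennreal (f y)) x) = ereal (TM t f x)"
    using assms(13) unfolding subprocess_form_def N_eq by blast
  obtain S where S: "form_semigroup m F0 EM S"
    and S_TM: "\<And>t f. 0 \<le> t \<Longrightarrow> f \<in> L2 m \<Longrightarrow> AE x in m. S t f x = TM t f x"
    using semigroup_F0[OF TM] by blast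
  obtain T where T: "form_semigroup m F E T"
    and T_trans: "\<And>t f. 0 < t \<Longrightarrow> f \<in> L2 m \<Longrightarrow> f \<in> borel_measurable borel \<Longrightarrow> (\<And>x. 0 \<le> f x) \<Longrightarrow>
      AE x in m. enn2ereal (transition X P t (\<lambda>y. ennreal (f y)) x) = ereal (T t f x)"
    using assms(10) unfolding properly_associated_def qc_version_def by blast
  have Sc: "L2_contraction_semigroup m S" and Tc: "L2_contraction_semigroup m T"
    using S T by (auto simp: form_semigroup_def)
  have M_le: "M t \<omega> \<le> 1" if "0 \<le> t" for t \<omega>
    using assms(11) that by (simp add: MF_def multiplicative_functional_def)

  have le: "AE x in m. S t f x \<le> T t f x"
    if t: "0 \<le> t" and f: "f \<in> L2 m" and nn: "AE x in m. 0 \<le> f x" for t f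
  proof (cases "t = 0")
    case True
    have "AE x in m. S 0 f x = f x" "AE x in m. T 0 f x = f x"
      using Sc Tc f by (auto simp: L2_contraction_semigroup_def)
    then show ?thesis unfolding True by eventually_elim simp
  next
    case False
    define g where "g x = max (f x) 0" for x
    have fg: "AE x in m. f x = g x" using nn by eventually_elim (simp add: g_def)
    have gm: "g \<in> borel_measurable m"
      unfolding g_def[abs_def] using L2_measurable[OF f] by measurable
    have gL: "g \<in> L2 m" by (rule L2_dominated[OF gm f]) (auto simp: g_def)
    have gb: "g \<in> borel_measurable borel" using gm measurable_cong_sets[OF assms(3) refl] by blast
    have g0: "0 \<le> g x" for x by (simp add: g_def)
    have "AE x in m. TM t g x \<le> T t g x"
      using TM_sub[OF t L2_N[OF gL] gb g0] T_trans[OF _ gL gb g0, of t] t False unfolding AE_iff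
    proof (elim eventually_elim2)
      fix x
      assume "enn2ereal (subprocess_transition X P M t (\<lambda>y. ennreal (g y)) x) = ereal (TM t g x)"
        and "enn2ereal (transition X P t (\<lambda>y. ennreal (g y)) x) = ereal (T t g x)"
      then have "ereal (TM t g x) \<le> ereal (T t g x)"
        using subprocess_transition_le[of M t X P "\<lambda>y. ennreal (g y)" x, OF M_le[OF t]]
        by (metis less_eq_ennreal.rep_eq)
      then show "TM t g x \<le> T t g x" by simp
    qed simp
    then show ?thesis
      using S_TM[OF t gL] L2_contraction_semigroup_AE_cong[OF Sc t f gL fg]
        L2_contraction_semigroup_AE_cong[OF Tc t f gL fg]
      by eventually_elim simp
  qed
  have dom: "dominated_form m F0 EM F E"
    unfolding dominated_form_def using S T le by blast
  moreover have "quasi_regular m F0 EM"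
    by (rule dominated_quasi_regular[OF assms(4,6) dirichlet_F0 dom assms(7)])
  ultimately show ?thesis using dirichlet_F0 by blast
qed

end
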